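(* Let $P_{\theta^*}=\mathcal{N}(\theta^*,I_p)$ with $\theta^*\in\Theta=\mathbb{R}^p$, let $P$ satisfy $W(P,P_{\theta^*})\le\epsilon$, and let $X_1,\dots,X_n\stackrel{i.i.d.}{\sim}P$. Let $B>0$, $L\ge2$, and let $\widehat\theta$ be the W-GAN estimator over the family $\{\mathcal{N}(\theta,I_p):\theta\in\mathbb{R}^p\}$ with function class $\mathcal{D}(B,L)$. There are constants $c>0$ (sufficiently small) and $C'>0$, with $C'$ depending only on $B$, such that if $2^L\cdot\frac{p}{n}+\epsilon^2\le c$, then with probability at least $1-e^{-(p+n\epsilon^2)}$, $$\|\widehat\theta-\theta^*\|_2\le C'\left(2^L\sqrt{\frac{p}{n}}\vee\epsilon\right).$$
   Context: $W$ is the Wasserstein-1 distance. $\mathcal{D}(B,L)$: networks $f:\mathbb{R}^p\to\mathbb{R}$ whose first-layer nodes are $x\mapsto\sigma(w^Tx+b)$, $\sigma(u)=1/(1+e^{-u})$, $\|w\|_2\le B$, $b\in\mathbb{R}$; for $1\le l<L-1$, nodes of layer $l+1$ are $\max(\sum_iw_if^{(l)}_i(x),0)$ with $f_i^{(l)}$ nodes of layer $l$ (finite width) and $\sum_i|w_i|\le1$; output $\sum_iw_if_i^{(L-1)}(x)$ with $\sum_i|w_i|\le1$. W-GAN estimator: $\widehat\theta\in\arg\min_{\theta}\sup_{f\in\mathcal{D}}\{\frac1n\sum_if(X_i)-\mathbb{E}_{P_\theta}f(X)\}$ (assumed attained). $a\vee b=\max(a,b)$. *)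

theory Defs
  imports "HOL-Probability.Probability"
begin

text \<open>Points of R^p are represented as functions nat => real, of which only the
coordinates i < p matter (measures live on PiM {..<p} (\<lambda>_. borel)).\<close>

definition sigmoid :: "real \<Rightarrow> real" where
  "sigmoid u = 1 / (1 + exp (- u))"

definition enorm :: "nat \<Rightarrow> (nat \<Rightarrow> real) \<Rightarrow> real" where
  "enorm p x = sqrt (\<Sum>i<p. (x i)\<^sup>2)"

definition Rp :: "nat \<Rightarrow> (nat \<Rightarrow> real) measure" where
  "Rp p = (\<Pi>\<^sub>M i\<in>{..<p}. (borel :: real measure))"

definition gauss :: "nat \<Rightarrow> (nat \<Rightarrow> real) \<Rightarrow> (nat \<Rightarrow> real) measure" where
  "gauss p \<theta> = (\<Pi>\<^sub>M i\<in>{..<p}. density lborel (normal_density (\<theta> i) 1))"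

definition couplings :: "nat \<Rightarrow> (nat \<Rightarrow> real) measure \<Rightarrow> (nat \<Rightarrow> real) measure
    \<Rightarrow> ((nat \<Rightarrow> real) \<times> (nat \<Rightarrow> real)) measure set" where
  "couplings p P Q = {\<pi>. sets \<pi> = sets (Rp p \<Otimes>\<^sub>M Rp p) \<and>
      distr \<pi> (Rp p) fst = P \<and> distr \<pi> (Rp p) snd = Q}"

definition wasserstein1 :: "nat \<Rightarrow> (nat \<Rightarrow> real) measure \<Rightarrow> (nat \<Rightarrow> real) measure \<Rightarrow> ennreal" where
  "wasserstein1 p P Q =
     (INF \<pi>\<in>couplings p P Q. \<integral>\<^sup>+ z. ennreal (enorm p (\<lambda>i. fst z i - snd z i)) \<partial>\<pi>)"

fun node :: "nat \<Rightarrow> real \<Rightarrow> nat \<Rightarrow> ((nat \<Rightarrow> real) \<Rightarrow> real) set" where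
  "node p B 0 = {}"
| "node p B (Suc 0) =
     {(\<lambda>x. sigmoid ((\<Sum>i<p. w i * x i) + b)) | w b. enorm p w \<le> B}"
| "node p B (Suc (Suc l)) =
     {(\<lambda>x. max (\<Sum>j<k. a j * f j x) 0) | (k::nat) a f.
        (\<Sum>j<k. \<bar>a j\<bar>) \<le> 1 \<and> (\<forall>j<k. f j \<in> node p B (Suc l))}"

text \<open>The discriminator class D(B,L): output layer L combines nodes of layer L-1.\<close>
definition Dnet :: "nat \<Rightarrow> real \<Rightarrow> nat \<Rightarrow> ((nat \<Rightarrow> real) \<Rightarrow> real) set" where
  "Dnet p B L = {(\<lambda>x. \<Sum>j<k. a j * f j x) | (k::nat) a f.
        (\<Sum>j<k. \<bar>a j\<bar>) \<le> 1 \<and> (\<forall>j<k. f j \<in> node p B (L - 1))}"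

definition wgan_obj :: "nat \<Rightarrow> real \<Rightarrow> nat \<Rightarrow> nat \<Rightarrow> (nat \<Rightarrow> nat \<Rightarrow> real)
    \<Rightarrow> (nat \<Rightarrow> real) \<Rightarrow> real" where
  "wgan_obj p B L n X \<theta> =
     (SUP f\<in>Dnet p B L. (\<Sum>i<n. f (X i)) / real n - (\<integral>x. f x \<partial>gauss p \<theta>))"

definition is_wgan_estimate :: "nat \<Rightarrow> real \<Rightarrow> nat \<Rightarrow> nat \<Rightarrow> (nat \<Rightarrow> nat \<Rightarrow> real)
    \<Rightarrow> (nat \<Rightarrow> real) \<Rightarrow> bool" where
  "is_wgan_estimate p B L n X \<theta>h \<longleftrightarrow>
     (\<forall>\<theta>. wgan_obj p B L n X \<theta>h \<le> wgan_obj p B L n X \<theta>)"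

end

theory Submission
  imports Defs
begin

text \<open>
Write \<open>Q\<close> for the true Gaussian and \<open>P\<^sub>n\<close> for the empirical measure. Replacing \<open>P\<close> by \<open>Q\<close> in the
expected supremum of \<open>P\<^sub>n f - Q f\<close> costs \<open>B \<epsilon> / 4\<close>, since every discriminator is \<open>B / 4\<close>-Lipschitz.
Under \<open>Q\<close>, symmetrization and one contraction per layer (a factor 2 each) reduce the problem to
\<open>sigmoid (w \<bullet> x + b)\<close>. The bias is unbounded, so a two-component contraction compares this map with
\<open>w \<bullet> x / 4\<close> and a multiple of \<open>(1 + (r / l)\<^sup>2) arctan (b / l)\<close>, where \<open>r = B \<parallel>x - \<theta>\<parallel>\<close> and \<open>l\<close> has
order \<open>\<surd>p\<close>; both averages are of order \<open>\<surd>(p / n)\<close>. Bounded differences give the exponential tail.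

Comparing the estimator with the true parameter on a single sigmoid in the direction
\<open>\<theta>h - \<theta>s\<close> bounds \<open>\<parallel>\<theta>h - \<theta>s\<parallel>\<close> by the deviation as long as it is bounded at all. The deviation itself
need not be small, because the smallness constant \<open>c\<close> depends neither on \<open>B\<close> nor on \<open>L\<close>.
Boundedness comes from the class with \<open>B = 1\<close>, \<open>L = 2\<close>, whose deviation is small: it forces a fixed
fraction of the sample into each half-space through \<open>\<theta>s\<close>, so that no sigmoid, and
hence no network of any depth, separates \<open>P\<^sub>n\<close> from \<open>Q\<close> with an advantage close to 1, whereas the
advantage against a distant Gaussian is close to 1.
\<close>


section \<open>The logistic sigmoid\<close>

text \<open>The passage from \<open>P\<close> to \<open>Q\<close> is made only for the expected
  supremum. The Rademacher bound needs second and fourth moments of the sample, which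
  \<open>P\<close> need not have; bounded differences use only boundedness of the discriminators and
  are applied under \<open>P\<close> itself. A scalar contraction through the sigmoid would leave
  the linear map w.x + b, whose signed sums are unbounded in b. The arctan is bounded in b, and its
  weight 1 + (r/l)^2 has a second moment bounded independently of p once l is at least B sqrt(p).
  The hypothesis controls 2^L p/n, while the deviation carries 2^L sqrt(p/n), larger than the square
  root of the former by 2^(L/2), and also a factor 1 + B. It may therefore exceed 1/2, and then the
  comparison on one sigmoid says nothing because Gaussian means of sigmoids saturate; this is why
  boundedness of the estimation error needs a separate argument. The class is uncountable, so
  suprema are handled over finite subclasses, then over a countable subclass, and reach the whole
  class by pointwise limits.\<close>

lemma sigmoid_pos: "0 < sigmoid u"
  by (simp add: sigmoid_def add_pos_pos)

lemma sigmoid_less_one: "sigmoid u < 1"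
  by (simp add: sigmoid_def add_pos_pos)

lemma sigmoid_minus: "sigmoid (- u) = 1 - sigmoid u"
proof -
  have "1 + exp u > 0" "1 + exp (- u) > 0" by (simp_all add: add_pos_pos)
  then show ?thesis by (simp add: sigmoid_def exp_minus field_simps)
qed

lemma sigmoid_zero: "sigmoid 0 = 1 / 2"
  by (simp add: sigmoid_def)

lemma DERIV_sigmoid: "(sigmoid has_real_derivative sigmoid x * (1 - sigmoid x)) (at x)"
proof -
  have p: "1 + exp (- x) > 0" by (simp add: add_pos_pos)
  have "((\<lambda>u. 1 / (1 + exp (- u))) has_real_derivative exp (- x) / (1 + exp (- x))\<^sup>2) (at x)"
    using p by (auto intro!: derivative_eq_intros simp: power2_eq_square)
  moreover have "exp (- x) / (1 + exp (- x))\<^sup>2 = sigmoid x * (1 - sigmoid x)"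
    using p by (simp add: sigmoid_def field_simps power2_eq_square)
  ultimately show ?thesis
    by (simp add: sigmoid_def[abs_def])
qed

lemma sigmoid_deriv_nonneg: "0 \<le> sigmoid x * (1 - sigmoid x)"
  using sigmoid_pos[of x] sigmoid_less_one[of x] by simp

lemma sigmoid_deriv_le_quarter: "sigmoid x * (1 - sigmoid x) \<le> 1 / 4"
  using mult_const_minus_self_real_le[of "sigmoid x" 1] by simp

text \<open>The right-hand side is the reciprocal of \<open>sigmoid x * (1 - sigmoid x)\<close>, so
  this expresses quadratic decay of the derivative, the same order as for arctan. Integrating
  \<open>cosh \<ge> 1\<close> twice from 0 gives the lower bound on cosh.\<close>

lemma one_plus_sq_le_cosh: "1 + x\<^sup>2 \<le> 2 + exp x + exp (- x :: real)"
proof -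
  have *: "1 + y\<^sup>2 \<le> 2 + exp y + exp (- y)" if "y \<ge> 0" for y :: real
  proof -
    have "1 + y + y\<^sup>2 / 2 \<le> exp y" using exp_lower_Taylor_quadratic that by blast
    moreover have "exp y + exp (- y) \<ge> 2 + y\<^sup>2"
    proof -
      have "0 \<le> cosh y - 1 - y\<^sup>2 / 2"
      proof -
        have d2: "((\<lambda>y. sinh y - y) has_real_derivative cosh y - 1) (at y)" for y :: real
          by (auto intro!: derivative_eq_intros)
        have sp: "0 \<le> sinh y - y" if "0 \<le> y" for y :: real
          using DERIV_nonneg_imp_nondecreasing[of 0 y "\<lambda>y. sinh y - y"] d2 that cosh_real_ge_1
          by (fastforce simp: diff_ge_0_iff_ge)
        have d1: "((\<lambda>y. cosh y - 1 - y\<^sup>2 / 2) has_real_derivative sinh y - y) (at y)" for y :: real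
          by (auto intro!: derivative_eq_intros)
        show ?thesis
          using DERIV_nonneg_imp_nondecreasing[of 0 y "\<lambda>y. cosh y - 1 - y\<^sup>2 / 2"] d1 sp that
          by fastforce
      qed
      then show ?thesis by (simp add: cosh_def field_simps)
    qed
    ultimately show ?thesis by simp
  qed
  show ?thesis
    using *[of x] *[of "- x"] by (cases "x \<ge> 0") (auto simp: algebra_simps)
qed

lemma sigmoid_deriv_le: "sigmoid x * (1 - sigmoid x) \<le> 1 / (1 + x\<^sup>2)"
proof -
  have p: "1 + exp (- x) > 0" by (simp add: add_pos_pos)
  have "sigmoid x * (1 - sigmoid x) = 1 / (2 + exp x + exp (- x))"
  proof -
    have "(2 + exp x + exp (- x)) * exp (- x) = (1 + exp (- x))\<^sup>2"
      by (simp add: algebra_simps power2_eq_square exp_minus)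
    moreover have "sigmoid x * (1 - sigmoid x) = exp (- x) / (1 + exp (- x))\<^sup>2"
      using p by (simp add: sigmoid_def field_simps power2_eq_square)
    moreover have "2 + exp x + exp (- x) > 0" by (simp add: add_pos_pos)
    ultimately show ?thesis
      by (smt (verit) divide_eq_eq exp_gt_zero nonzero_divide_mult_cancel_right)
  qed
  also have "\<dots> \<le> 1 / (1 + x\<^sup>2)"
    using one_plus_sq_le_cosh[of x] by (intro divide_left_mono) (auto intro!: mult_pos_pos add_pos_pos add_pos_nonneg)
  finally show ?thesis .
qed

lemma sigmoid_mono: "u \<le> v \<Longrightarrow> sigmoid u \<le> sigmoid v"
  using DERIV_nonneg_imp_nondecreasing[of u v sigmoid] DERIV_sigmoid sigmoid_deriv_nonneg by blast

text \<open>When \<open>f\<close> and \<open>g - f\<close> both increase, every increment of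
  \<open>g\<close> dominates that of \<open>f\<close>. This converts a comparison of derivatives
  into the comparison of increments that contraction asks for.\<close>

lemma abs_diff_le_by_mono:
  fixes f g :: "real \<Rightarrow> real"
  assumes "\<And>x y. x \<le> y \<Longrightarrow> f x \<le> f y" and "\<And>x y. x \<le> y \<Longrightarrow> g x - f x \<le> g y - f y"
  shows "\<bar>f x - f y\<bar> \<le> \<bar>g x - g y\<bar>"
  using assms[of x y] assms[of y x] by (cases "x \<le> y") (auto simp: abs_if)

lemma sigmoid_lipschitz: "\<bar>sigmoid u - sigmoid v\<bar> \<le> \<bar>u - v\<bar> / 4"
proof -
  have "u / 4 - sigmoid u \<le> v / 4 - sigmoid v" if "u \<le> v" for u v
  proof (rule DERIV_nonneg_imp_nondecreasing[OF that])
    fix x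
    show "\<exists>y. ((\<lambda>x. x / 4 - sigmoid x) has_real_derivative y) (at x) \<and> 0 \<le> y"
      by (rule exI[of _ "1 / 4 - sigmoid x * (1 - sigmoid x)"])
        (use sigmoid_deriv_le_quarter[of x] in \<open>auto intro!: derivative_eq_intros DERIV_sigmoid\<close>)
  qed
  from abs_diff_le_by_mono[of sigmoid "\<lambda>x. x / 4", OF sigmoid_mono this]
  show ?thesis by (simp flip: diff_divide_distrib)
qed

text \<open>Peetre's inequality \<open>1 + b\<^sup>2 \<le> 2 (1 + u\<^sup>2) (1 + (u + b)\<^sup>2)\<close> separates the unbounded bias
  from the bounded part of the argument.\<close>

lemma sigmoid_bias_separation:
  assumes l: "1 \<le> l" and u: "\<bar>u\<bar> \<le> r"
  shows "\<bar>sigmoid (u + b) - sigmoid (u + b')\<bar>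
    \<le> \<bar>2 * l * (1 + (r / l)\<^sup>2) * arctan (b / l) - 2 * l * (1 + (r / l)\<^sup>2) * arctan (b' / l)\<bar>"
proof (rule abs_diff_le_by_mono)
  show "sigmoid (u + x) \<le> sigmoid (u + y)" if "x \<le> y" for x y
    using that by (intro sigmoid_mono) auto
  fix x y :: real assume "x \<le> y"
  then show "2 * l * (1 + (r / l)\<^sup>2) * arctan (x / l) - sigmoid (u + x)
    \<le> 2 * l * (1 + (r / l)\<^sup>2) * arctan (y / l) - sigmoid (u + y)"
  proof (rule DERIV_nonneg_imp_nondecreasing)
    fix x :: real
    have "((\<lambda>x. 2 * l * (1 + (r / l)\<^sup>2) * arctan (x / l)) has_real_derivative
        2 * l * (1 + (r / l)\<^sup>2) * (inverse (1 + (x / l)\<^sup>2) * (1 / l))) (at x)"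
      using l by (auto intro!: derivative_eq_intros)
    moreover have "2 * l * (1 + (r / l)\<^sup>2) * (inverse (1 + (x / l)\<^sup>2) * (1 / l))
        = 2 * (1 + (r / l)\<^sup>2) / (1 + (x / l)\<^sup>2)"
    proof -
      have "2 * l * c * (inverse d * (1 / l)) = 2 * c / d" for c d :: real
        using l by (simp add: divide_inverse)
      then show ?thesis .
    qed
    moreover have "((\<lambda>x. sigmoid (u + x)) has_real_derivative sigmoid (u + x) * (1 - sigmoid (u + x)) * 1) (at x)"
      by (rule DERIV_chain2[OF DERIV_sigmoid]) (auto intro!: derivative_eq_intros)
    moreover have "sigmoid (u + x) * (1 - sigmoid (u + x)) \<le> 2 * (1 + (r / l)\<^sup>2) / (1 + (x / l)\<^sup>2)"
    proof -
      define c where "c = u / l"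
      define d where "d = x / l"
      have ru: "c\<^sup>2 \<le> (r / l)\<^sup>2"
        using u l unfolding c_def
        by (intro power2_le_iff_abs_le[THEN iffD2]) (auto simp: abs_divide divide_right_mono)
      \<comment> \<open>\<open>1 \<le> l\<close> enters here: rescaling by \<open>l\<close> only
        shrinks \<open>u + x\<close>, so the sigmoid may decay on scale 1 while the arctan lives on
        scale \<open>l\<close>.\<close>
      have cd: "(c + d)\<^sup>2 \<le> (u + x)\<^sup>2"
      proof -
        have "c + d = (u + x) / l" by (simp add: c_def d_def add_divide_distrib)
        moreover have "\<bar>(u + x) / l\<bar> \<le> \<bar>u + x\<bar>"
          using l by (simp add: abs_divide divide_le_eq mult_le_cancel_left1)
        ultimately show ?thesis by (metis abs_le_square_iff)
      qed
      have "1 + d\<^sup>2 \<le> 2 * (1 + c\<^sup>2) * (1 + (c + d)\<^sup>2)"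
      proof -
        \<comment> \<open>Peetre's inequality as a sum of squares: this expression is its right side
          minus its left side.\<close>
        have "0 \<le> (2 * c + d)\<^sup>2 + 1 + 2 * (c\<^sup>2 * (c + d)\<^sup>2)" by (intro add_nonneg_nonneg) auto
        then show ?thesis by (simp add: power2_eq_square algebra_simps)
      qed
      also have "\<dots> \<le> 2 * (1 + (r / l)\<^sup>2) * (1 + (u + x)\<^sup>2)"
        using ru cd by (intro mult_mono) auto
      finally have "1 + d\<^sup>2 \<le> 2 * (1 + (r / l)\<^sup>2) * (1 + (u + x)\<^sup>2)" .
      then have "1 / (1 + (u + x)\<^sup>2) \<le> 2 * (1 + (r / l)\<^sup>2) / (1 + d\<^sup>2)"
        by (simp add: field_simps add_pos_nonneg)
      with sigmoid_deriv_le[of "u + x"] show ?thesis by (simp add: d_def)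
    qed
    ultimately show "\<exists>y. ((\<lambda>x. 2 * l * (1 + (r / l)\<^sup>2) * arctan (x / l) - sigmoid (u + x)) has_real_derivative y) (at x) \<and> 0 \<le> y"
      by (intro exI[of _ "2 * (1 + (r / l)\<^sup>2) / (1 + (x / l)\<^sup>2) - sigmoid (u + x) * (1 - sigmoid (u + x)) * 1"] conjI DERIV_diff)
        auto
  qed
qed

section \<open>Rademacher averages\<close>

text \<open>Expectation over independent uniform signs, written as a recursion so that inductions
  peel off the last sign. Coordinates from \<open>n\<close> on keep the value 0.\<close>

primrec savg :: "nat \<Rightarrow> ((nat \<Rightarrow> real) \<Rightarrow> real) \<Rightarrow> real" where
  "savg 0 \<Phi> = \<Phi> (\<lambda>_. 0)"
| "savg (Suc n) \<Phi> = (savg n (\<lambda>s. \<Phi> (s(n := 1))) + savg n (\<lambda>s. \<Phi> (s(n := - 1)))) / 2"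

lemma savg_mono:
  "(\<And>s. (\<And>i. i < n \<Longrightarrow> \<bar>s i\<bar> = 1) \<Longrightarrow> \<Phi> s \<le> \<Psi> s) \<Longrightarrow> savg n \<Phi> \<le> savg n \<Psi>"
proof (induction n arbitrary: \<Phi> \<Psi>)
  case (Suc n)
  have "savg n (\<lambda>s. \<Phi> (s(n := e))) \<le> savg n (\<lambda>s. \<Psi> (s(n := e)))" if "\<bar>e\<bar> = 1" for e
    by (rule Suc.IH, rule Suc.prems) (use that in \<open>auto simp: less_Suc_eq\<close>)
  from this[of 1] this[of "- 1"] show ?case by simp
qed simp

lemma savg_cong:
  "(\<And>s. (\<And>i. i < n \<Longrightarrow> \<bar>s i\<bar> = 1) \<Longrightarrow> \<Phi> s = \<Psi> s) \<Longrightarrow> savg n \<Phi> = savg n \<Psi>"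
  by (intro antisym savg_mono) auto

lemma savg_add: "savg n (\<lambda>s. \<Phi> s + \<Psi> s) = savg n \<Phi> + savg n \<Psi>"
  by (induction n arbitrary: \<Phi> \<Psi>) (auto simp: field_simps)

lemma savg_cmult: "savg n (\<lambda>s. c * \<Phi> s) = c * savg n \<Phi>"
  by (induction n arbitrary: \<Phi>) (auto simp: field_simps)

lemma savg_const: "savg n (\<lambda>s. c) = c"
  by (induction n) auto

lemma savg_sum: "savg n (\<lambda>s. \<Sum>k\<in>A. \<Phi> k s) = (\<Sum>k\<in>A. savg n (\<Phi> k))"
  by (induction A rule: infinite_finite_induct) (auto simp: savg_add savg_const)

lemma savg_uminus: "savg n (\<lambda>s. \<Phi> (\<lambda>i. - s i)) = savg n \<Phi>"
proof (induction n arbitrary: \<Phi>)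
  case (Suc n)
  have *: "(\<lambda>s. \<Phi> (\<lambda>i. - (s(n := e)) i)) = (\<lambda>s. (\<lambda>s. \<Phi> (s(n := - e))) (\<lambda>i. - s i))" for e
    by (rule ext, rule arg_cong[of _ _ \<Phi>]) auto
  show ?case
    using Suc.IH[of "\<lambda>s. \<Phi> (s(n := 1))"] Suc.IH[of "\<lambda>s. \<Phi> (s(n := - 1))"]
    unfolding savg.simps * by simp
qed simp

lemma sum_sign_update:
  fixes h :: "nat \<Rightarrow> real"
  shows "(\<Sum>i<Suc n. (s(n := e)) i * h i) = (\<Sum>i<n. s i * h i) + e * h n"
  by simp

text \<open>Orthogonality of the signs. The shift \<open>c\<close> is the induction parameter: the
  last term \<open>e * a n\<close> is absorbed into it and its cross terms cancel between the two
  values of \<open>e\<close>.\<close>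

lemma savg_square: "savg n (\<lambda>s. (c + (\<Sum>i<n. s i * a i))\<^sup>2) = c\<^sup>2 + (\<Sum>i<n. (a i)\<^sup>2)"
proof (induction n arbitrary: c)
  case (Suc n)
  have "savg n (\<lambda>s. (c + (\<Sum>i<Suc n. (s(n := e)) i * a i))\<^sup>2) = (c + e * a n)\<^sup>2 + (\<Sum>i<n. (a i)\<^sup>2)" for e
    unfolding sum_sign_update Suc[of "c + e * a n", symmetric]
    by (simp add: algebra_simps)
  from this[of 1] this[of "- 1"] show ?case
    unfolding savg.simps by (simp add: power2_eq_square algebra_simps)
qed simp

lemma abs_le_AM_GM:
  fixes x K :: real
  assumes "K > 0"
  shows "\<bar>x\<bar> \<le> (K + x\<^sup>2 / K) / 2"
proof -
  have "0 \<le> (\<bar>x\<bar> - K)\<^sup>2" by simp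
  then have "2 * K * \<bar>x\<bar> \<le> K\<^sup>2 + x\<^sup>2" by (simp add: power2_eq_square algebra_simps)
  then show ?thesis using assms by (simp add: field_simps power2_eq_square)
qed

text \<open>AM-GM takes the place of Jensen and a square root. The bound stays linear in the sum of
  squares, so it can later be integrated over the sample term by term; the free \<open>K\<close> is
  then set to the expected order of magnitude.\<close>

lemma savg_abs_le:
  assumes "K > 0"
  shows "savg n (\<lambda>s. \<bar>\<Sum>i<n. s i * a i\<bar>) \<le> (K + (\<Sum>i<n. (a i)\<^sup>2) / K) / 2"
proof -
  have "savg n (\<lambda>s. \<bar>\<Sum>i<n. s i * a i\<bar>) \<le> savg n (\<lambda>s. K / 2 + 1 / (2 * K) * (0 + (\<Sum>i<n. s i * a i))\<^sup>2)"
    using abs_le_AM_GM[OF assms] by (intro savg_mono) (simp add: add_divide_distrib mult.commute)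
  also have "\<dots> = K / 2 + 1 / (2 * K) * (\<Sum>i<n. (a i)\<^sup>2)"
    unfolding savg_add savg_cmult savg_const savg_square by simp
  finally show ?thesis by (simp add: add_divide_distrib)
qed

section \<open>Suprema of signed sums and their contraction\<close>

definition rademacher :: "'a set \<Rightarrow> ('a \<Rightarrow> real) \<Rightarrow> nat \<Rightarrow> (nat \<Rightarrow> 'a \<Rightarrow> real) \<Rightarrow> real" where
  "rademacher I G n h = savg n (\<lambda>s. SUP t\<in>I. G t + (\<Sum>i<n. s i * h i t))"

text \<open>The offset \<open>G\<close> exists for this recursion: a sign that has been fixed moves
  its term into \<open>G\<close>, and the remaining process has one sign fewer. The averages are not
  divided by \<open>n\<close>.\<close>

lemma rademacher_Suc:
  "rademacher I G (Suc n) h =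
    (rademacher I (\<lambda>t. G t + h n t) n h + rademacher I (\<lambda>t. G t - h n t) n h) / 2"
  unfolding rademacher_def savg.simps sum_sign_update by (simp add: algebra_simps)

lemma bdd_real_image_iff: "bounded (f ` I) \<longleftrightarrow> (\<exists>M. \<forall>t\<in>I. \<bar>f t :: real\<bar> \<le> M)"
  by (auto simp: bounded_iff)

lemma bounded_image_add: "bounded (f ` I) \<Longrightarrow> bounded (g ` I) \<Longrightarrow> bounded ((\<lambda>t. f t + g t :: real) ` I)"
  by (rule bounded_plus_comp)

lemma bounded_image_diff: "bounded (f ` I) \<Longrightarrow> bounded (g ` I) \<Longrightarrow> bounded ((\<lambda>t. f t - g t :: real) ` I)"
  by (rule bounded_minus_comp)

lemma bounded_image_cmult: "bounded (f ` I) \<Longrightarrow> bounded ((\<lambda>t. c * f t :: real) ` I)"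
proof -
  assume "bounded (f ` I)"
  then obtain M where M: "\<forall>t\<in>I. \<bar>f t\<bar> \<le> M" by (auto simp: bdd_real_image_iff)
  have "\<forall>t\<in>I. \<bar>c * f t\<bar> \<le> \<bar>c\<bar> * M" using M by (auto simp: abs_mult intro!: mult_left_mono)
  then show ?thesis unfolding bdd_real_image_iff by blast
qed

lemma bounded_image_sum:
  "(\<And>i. i \<in> A \<Longrightarrow> bounded (h i ` I)) \<Longrightarrow> bounded ((\<lambda>t. \<Sum>i\<in>A. h i t :: real) ` I)"
proof (induction A rule: infinite_finite_induct)
  case (insert x F)
  then show ?case by (auto intro: bounded_image_add)
qed (auto simp: bdd_real_image_iff)

lemma bounded_imp_bdd_above_image: "bounded (f ` I) \<Longrightarrow> bdd_above (f ` I :: real set)"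
  by (rule bounded_imp_bdd_above)

lemma cSUP_add_cSUP_le:
  fixes f g :: "'a \<Rightarrow> real"
  assumes "I \<noteq> {}" "\<And>s t. s \<in> I \<Longrightarrow> t \<in> I \<Longrightarrow> f s + g t \<le> C"
  shows "(SUP t\<in>I. f t) + (SUP t\<in>I. g t) \<le> C"
proof -
  have "(SUP t\<in>I. g t) \<le> C - f s" if "s \<in> I" for s
    using assms that by (intro cSUP_least) (auto simp: algebra_simps)
  then have "(SUP t\<in>I. f t) \<le> C - (SUP t\<in>I. g t)"
    using assms(1) by (intro cSUP_least) (auto simp: algebra_simps)
  then show ?thesis by simp
qed

text \<open>One sign of the Ledoux-Talagrand comparison. For near-maximisers \<open>s\<close> and
  \<open>t\<close> on the left, the same pair is used on the right, swapped if necessary so that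
  \<open>\<psi>\<close> contributes its absolute difference.\<close>

lemma cSUP_sign_contraction:
  fixes G \<phi> \<psi> :: "'a \<Rightarrow> real"
  assumes I: "I \<noteq> {}" and b: "bounded (G ` I)" "bounded (\<psi> ` I)"
    and le: "\<And>s t. s \<in> I \<Longrightarrow> t \<in> I \<Longrightarrow> \<bar>\<phi> t - \<phi> s\<bar> \<le> \<bar>\<psi> t - \<psi> s\<bar>"
  shows "(SUP t\<in>I. G t + \<phi> t) + (SUP t\<in>I. G t - \<phi> t) \<le> (SUP t\<in>I. G t + \<psi> t) + (SUP t\<in>I. G t - \<psi> t)"
proof (rule cSUP_add_cSUP_le[OF I])
  fix s t assume st: "s \<in> I" "t \<in> I"
  have *: "G x + \<psi> x \<le> (SUP t\<in>I. G t + \<psi> t)" "G x - \<psi> x \<le> (SUP t\<in>I. G t - \<psi> t)" if "x \<in> I" for x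
    by (intro cSUP_upper that bounded_imp_bdd_above_image bounded_image_add bounded_image_diff b)+
  show "G s + \<phi> s + (G t - \<phi> t) \<le> (SUP t\<in>I. G t + \<psi> t) + (SUP t\<in>I. G t - \<psi> t)"
    using *[OF st(1)] *[OF st(2)] le[OF st] by linarith
qed

text \<open>One sign on the left is traded for two independent signs on the right. The key is |x| +
  |y| <= |x + y| + |x - y|: the first term on the right is reached by the sign pairs ++ and --, the
  second by +- and -+. With four suprema to average, the increments enter with the factor
  1/2.\<close>

lemma cSUP_sign_contraction2:
  fixes G \<phi> a b :: "'a \<Rightarrow> real"
  assumes I: "I \<noteq> {}" and b: "bounded (G ` I)" "bounded (a ` I)" "bounded (b ` I)"
    and le: "\<And>s t. s \<in> I \<Longrightarrow> t \<in> I \<Longrightarrow> \<bar>\<phi> t - \<phi> s\<bar> \<le> (\<bar>a t - a s\<bar> + \<bar>b t - b s\<bar>) / 2"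
  shows "(SUP t\<in>I. G t + \<phi> t) + (SUP t\<in>I. G t - \<phi> t) \<le>
    ((SUP t\<in>I. G t + b t + a t) + (SUP t\<in>I. G t + b t - a t)
      + (SUP t\<in>I. G t - b t + a t) + (SUP t\<in>I. G t - b t - a t)) / 2"
    (is "_ \<le> (?pp + ?pm + ?mp + ?mm) / 2")
proof (rule cSUP_add_cSUP_le[OF I])
  fix s t assume st: "s \<in> I" "t \<in> I"
  have *: "G x + b x + a x \<le> ?pp" "G x + b x - a x \<le> ?pm" "G x - b x + a x \<le> ?mp" "G x - b x - a x \<le> ?mm"
    if "x \<in> I" for x
    by (intro cSUP_upper that bounded_imp_bdd_above_image bounded_image_add bounded_image_diff b)+
  show "G s + \<phi> s + (G t - \<phi> t) \<le> (?pp + ?pm + ?mp + ?mm) / 2"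
  proof -
    have ar: "p + f + (q - g) \<le> (pp + pm + mp + mm) / 2"
      if "2 * (f - g) \<le> c + d" "c + d \<le> u + v" "u \<le> pp + mm - p - q" "v \<le> pm + mp - p - q"
      for c d p q f g u v pp pm mp mm :: real using that by argo
    have 1: "2 * (\<phi> s - \<phi> t) \<le> \<bar>a t - a s\<bar> + \<bar>b t - b s\<bar>"
      using le[OF st] abs_ge_minus_self[of "\<phi> t - \<phi> s"] by (simp add: field_simps)
    have "\<bar>x\<bar> + \<bar>y\<bar> \<le> \<bar>x + y\<bar> + \<bar>x - y\<bar>" for x y :: real by linarith
    note 2 = this[of "a t - a s" "b t - b s"]
    have 3: "\<bar>(a t - a s) + (b t - b s)\<bar> \<le> ?pp + ?mm - G s - G t"
      using *[OF st(1)] *[OF st(2)] by linarith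
    have 4: "\<bar>(a t - a s) - (b t - b s)\<bar> \<le> ?pm + ?mp - G s - G t"
      using *[OF st(1)] *[OF st(2)] by linarith
    show ?thesis by (rule ar[OF 1 2 3 4])
  qed
qed

text \<open>The induction hypothesis replaces \<open>\<phi>\<close> by \<open>h\<close> under the
  first \<open>n\<close> signs; the last sign is then treated for each fixed choice of the others,
  whose signed sum is part of the offset.\<close>

lemma rademacher_contraction:
  fixes \<phi> h :: "nat \<Rightarrow> 'a \<Rightarrow> real"
  assumes I: "I \<noteq> {}" and "bounded (G ` I)" and "\<And>i. i < n \<Longrightarrow> bounded (h i ` I)"
    and "\<And>i. i < n \<Longrightarrow> bounded (\<phi> i ` I)"
    and "\<And>i s t. i < n \<Longrightarrow> s \<in> I \<Longrightarrow> t \<in> I \<Longrightarrow> \<bar>\<phi> i t - \<phi> i s\<bar> \<le> \<bar>h i t - h i s\<bar>"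
  shows "rademacher I G n \<phi> \<le> rademacher I G n h"
  using assms(2-)
proof (induction n arbitrary: G)
  case 0
  then show ?case by (simp add: rademacher_def)
next
  case (Suc n)
  have "rademacher I (\<lambda>t. G t + \<phi> n t) n \<phi> \<le> rademacher I (\<lambda>t. G t + \<phi> n t) n h"
    "rademacher I (\<lambda>t. G t - \<phi> n t) n \<phi> \<le> rademacher I (\<lambda>t. G t - \<phi> n t) n h"
    using Suc.prems by (auto intro!: Suc.IH bounded_image_add bounded_image_diff)
  moreover have "rademacher I (\<lambda>t. G t + \<phi> n t) n h + rademacher I (\<lambda>t. G t - \<phi> n t) n h
      \<le> rademacher I (\<lambda>t. G t + h n t) n h + rademacher I (\<lambda>t. G t - h n t) n h"
    unfolding rademacher_def savg_add[symmetric]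
  proof (rule savg_mono)
    fix s :: "nat \<Rightarrow> real"
    have "bounded ((\<lambda>t. G t + (\<Sum>i<n. s i * h i t)) ` I)"
      using Suc.prems by (auto intro!: bounded_image_add bounded_image_sum bounded_image_cmult)
    from cSUP_sign_contraction[OF I this, of "h n" "\<phi> n"] Suc.prems
    show "(SUP t\<in>I. G t + \<phi> n t + (\<Sum>i<n. s i * h i t)) + (SUP t\<in>I. G t - \<phi> n t + (\<Sum>i<n. s i * h i t))
      \<le> (SUP t\<in>I. G t + h n t + (\<Sum>i<n. s i * h i t)) + (SUP t\<in>I. G t - h n t + (\<Sum>i<n. s i * h i t))"
      by (simp add: algebra_simps)
  qed
  ultimately show ?case unfolding rademacher_Suc
    by - (rule divide_right_mono[OF order_trans[OF add_mono]], assumption+, simp)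
qed

text \<open>A vector-valued contraction: the two scalar components become the even and odd coordinates
  of a process with \<open>2 n\<close> signs.\<close>

lemma rademacher_contraction2:
  fixes \<phi> a b :: "nat \<Rightarrow> 'a \<Rightarrow> real"
  defines "h \<equiv> \<lambda>j. if even j then (\<lambda>t. 2 * a (j div 2) t) else (\<lambda>t. 2 * b (j div 2) t)"
  assumes I: "I \<noteq> {}" and "bounded (G ` I)"
    and "\<And>i. i < n \<Longrightarrow> bounded (a i ` I)" "\<And>i. i < n \<Longrightarrow> bounded (b i ` I)"
    and "\<And>i. i < n \<Longrightarrow> bounded (\<phi> i ` I)"
    and "\<And>i s t. i < n \<Longrightarrow> s \<in> I \<Longrightarrow> t \<in> I \<Longrightarrow> \<bar>\<phi> i t - \<phi> i s\<bar> \<le> \<bar>a i t - a i s\<bar> + \<bar>b i t - b i s\<bar>"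
  shows "rademacher I G n \<phi> \<le> rademacher I G (2 * n) h"
  using assms(3-)
proof (induction n arbitrary: G)
  case 0
  then show ?case by (simp add: rademacher_def)
next
  case (Suc n)
  define A where "A = (\<lambda>t. 2 * a n t)"
  define B where "B = (\<lambda>t. 2 * b n t)"
  have h: "h (2 * n) = A" "h (Suc (2 * n)) = B" by (auto simp: h_def A_def B_def)
  have bAB: "bounded (A ` I)" "bounded (B ` I)"
    using Suc.prems by (auto simp: A_def B_def intro!: bounded_image_cmult)
  have r: "rademacher I (\<lambda>t. G t + \<phi> n t) n \<phi> \<le> rademacher I (\<lambda>t. G t + \<phi> n t) (2 * n) h"
    "rademacher I (\<lambda>t. G t - \<phi> n t) n \<phi> \<le> rademacher I (\<lambda>t. G t - \<phi> n t) (2 * n) h"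
    using Suc.prems by (auto intro!: Suc.IH bounded_image_add bounded_image_diff)
  have k: "2 * (rademacher I (\<lambda>t. G t + \<phi> n t) (2 * n) h + rademacher I (\<lambda>t. G t - \<phi> n t) (2 * n) h)
      \<le> rademacher I (\<lambda>t. G t + B t + A t) (2 * n) h + rademacher I (\<lambda>t. G t + B t - A t) (2 * n) h
        + rademacher I (\<lambda>t. G t - B t + A t) (2 * n) h + rademacher I (\<lambda>t. G t - B t - A t) (2 * n) h"
    unfolding rademacher_def savg_add[symmetric] savg_cmult[symmetric]
  proof (rule savg_mono)
    fix s :: "nat \<Rightarrow> real"
    have "bounded (h j ` I)" if "j < 2 * n" for j
      using Suc.prems that by (auto simp: h_def intro!: bounded_image_cmult)
    then have "bounded ((\<lambda>t. G t + (\<Sum>i<2 * n. s i * h i t)) ` I)"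
      using Suc.prems by (auto intro!: bounded_image_add bounded_image_sum bounded_image_cmult)
    moreover have "\<bar>\<phi> n t - \<phi> n s\<bar> \<le> (\<bar>A t - A s\<bar> + \<bar>B t - B s\<bar>) / 2" if "s \<in> I" "t \<in> I" for s t
    proof -
      have "\<bar>2 * x - 2 * y\<bar> = 2 * \<bar>x - y\<bar>" for x y :: real by argo
      then show ?thesis using Suc.prems(5)[of n s t] that by (simp add: A_def B_def)
    qed
    ultimately have key: "(SUP t\<in>I. (G t + (\<Sum>i<2 * n. s i * h i t)) + \<phi> n t) + (SUP t\<in>I. (G t + (\<Sum>i<2 * n. s i * h i t)) - \<phi> n t) \<le>
    ((SUP t\<in>I. (G t + (\<Sum>i<2 * n. s i * h i t)) + B t + A t) + (SUP t\<in>I. (G t + (\<Sum>i<2 * n. s i * h i t)) + B t - A t)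
      + (SUP t\<in>I. (G t + (\<Sum>i<2 * n. s i * h i t)) - B t + A t) + (SUP t\<in>I. (G t + (\<Sum>i<2 * n. s i * h i t)) - B t - A t)) / 2"
      by (intro cSUP_sign_contraction2[OF I _ bAB]) auto
    have half: "x + y \<le> (z + w + u + v) / 2 \<Longrightarrow> 2 * (x + y) \<le> z + w + u + v"
      for x y z w u v :: real by argo
    have eqs: "(\<lambda>t. G t + \<phi> n t + (\<Sum>i<2 * n. s i * h i t)) = (\<lambda>t. (G t + (\<Sum>i<2 * n. s i * h i t)) + \<phi> n t)"
      "(\<lambda>t. G t - \<phi> n t + (\<Sum>i<2 * n. s i * h i t)) = (\<lambda>t. (G t + (\<Sum>i<2 * n. s i * h i t)) - \<phi> n t)"
      "(\<lambda>t. G t + B t + A t + (\<Sum>i<2 * n. s i * h i t)) = (\<lambda>t. (G t + (\<Sum>i<2 * n. s i * h i t)) + B t + A t)"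
      "(\<lambda>t. G t + B t - A t + (\<Sum>i<2 * n. s i * h i t)) = (\<lambda>t. (G t + (\<Sum>i<2 * n. s i * h i t)) + B t - A t)"
      "(\<lambda>t. G t - B t + A t + (\<Sum>i<2 * n. s i * h i t)) = (\<lambda>t. (G t + (\<Sum>i<2 * n. s i * h i t)) - B t + A t)"
      "(\<lambda>t. G t - B t - A t + (\<Sum>i<2 * n. s i * h i t)) = (\<lambda>t. (G t + (\<Sum>i<2 * n. s i * h i t)) - B t - A t)"
      by (simp_all add: fun_eq_iff)
    show "2 * ((SUP t\<in>I. G t + \<phi> n t + (\<Sum>i<2 * n. s i * h i t)) + (SUP t\<in>I. G t - \<phi> n t + (\<Sum>i<2 * n. s i * h i t)))
      \<le> (SUP t\<in>I. G t + B t + A t + (\<Sum>i<2 * n. s i * h i t)) + (SUP t\<in>I. G t + B t - A t + (\<Sum>i<2 * n. s i * h i t))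
       + (SUP t\<in>I. G t - B t + A t + (\<Sum>i<2 * n. s i * h i t)) + (SUP t\<in>I. G t - B t - A t + (\<Sum>i<2 * n. s i * h i t))"
      unfolding eqs by (rule half[OF key])
  qed
  have ar: "a \<le> a' \<Longrightarrow> b \<le> b' \<Longrightarrow> 2 * (a' + b') \<le> x + y + z + w \<Longrightarrow> (a + b) / 2 \<le> ((x + y) / 2 + (z + w) / 2) / 2"
    for a b a' b' x y z w :: real by argo
  have e: "rademacher I G (2 * Suc n) h =
      ((rademacher I (\<lambda>t. G t + B t + A t) (2 * n) h + rademacher I (\<lambda>t. G t + B t - A t) (2 * n) h) / 2
        + (rademacher I (\<lambda>t. G t - B t + A t) (2 * n) h + rademacher I (\<lambda>t. G t - B t - A t) (2 * n) h) / 2) / 2"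
    by (simp add: rademacher_Suc h)
  show ?case
    unfolding rademacher_Suc[of I G n] e by (rule ar[OF r k])
qed

section \<open>The discriminator class\<close>

lemma enorm_eq_L2_set: "enorm p x = L2_set x {..<p}"
  by (simp add: enorm_def L2_set_def)

lemma enorm_nonneg: "0 \<le> enorm p x"
  by (simp add: enorm_eq_L2_set)

lemma enorm_power2: "(enorm p x)\<^sup>2 = (\<Sum>i<p. (x i)\<^sup>2)"
  by (simp add: enorm_def sum_nonneg)

lemma abs_inner_le_enorm: "\<bar>\<Sum>i<p. w i * x i\<bar> \<le> enorm p w * enorm p x"
proof -
  have "\<bar>\<Sum>i<p. w i * x i\<bar> \<le> (\<Sum>i<p. \<bar>w i\<bar> * \<bar>x i\<bar>)"
    by (rule order_trans[OF sum_abs]) (simp add: abs_mult)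
  also have "\<dots> \<le> enorm p w * enorm p x"
    unfolding enorm_eq_L2_set by (rule L2_set_mult_ineq)
  finally show ?thesis .
qed

lemma enorm_cmult: "enorm p (\<lambda>i. c * x i) = \<bar>c\<bar> * enorm p x"
  by (simp add: enorm_def power_mult_distrib real_sqrt_mult flip: sum_distrib_left)

text \<open>The absolutely convex hull, containing 0 through \<open>k = 0\<close>. With it a hidden
  layer is the ReLU applied to the hull of the previous layer, and the output layer is a bare
  hull.\<close>

definition absconv :: "('a \<Rightarrow> real) set \<Rightarrow> ('a \<Rightarrow> real) set" where
  "absconv N = {(\<lambda>x. \<Sum>j<k. a j * f j x) | (k::nat) a f.
    (\<Sum>j<k. \<bar>a j\<bar>) \<le> 1 \<and> (\<forall>j<k. f j \<in> N)}"

lemma Dnet_eq_absconv: "Dnet p B L = absconv (node p B (L - 1))"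
  by (simp add: Dnet_def absconv_def)

lemma node_Suc_Suc: "node p B (Suc (Suc l)) = (\<lambda>g x. max (g x) 0) ` absconv (node p B (Suc l))"
  by (auto simp: absconv_def image_iff) blast+

lemma abs_weighted_sum_le:
  fixes a v :: "nat \<Rightarrow> real"
  assumes "(\<Sum>j<k. \<bar>a j\<bar>) \<le> 1" "\<And>j. j < k \<Longrightarrow> \<bar>v j\<bar> \<le> M" "0 \<le> M"
  shows "\<bar>\<Sum>j<k. a j * v j\<bar> \<le> M"
proof -
  have "\<bar>\<Sum>j<k. a j * v j\<bar> \<le> (\<Sum>j<k. \<bar>a j\<bar> * M)"
    by (rule order_trans[OF sum_abs]) (auto simp: abs_mult intro!: sum_mono mult_left_mono assms)
  also have "\<dots> \<le> 1 * M"
    unfolding sum_distrib_right[symmetric] using assms by (intro mult_right_mono) auto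
  finally show ?thesis by simp
qed

lemma absconv_superset: "f \<in> N \<Longrightarrow> f \<in> absconv N"
  unfolding absconv_def by (rule CollectI, rule exI[of _ 1], rule exI[of _ "\<lambda>_. 1"], rule exI[of _ "\<lambda>_. f"]) auto

lemma zero_in_absconv: "(\<lambda>_. 0) \<in> absconv N"
  unfolding absconv_def by (rule CollectI, rule exI[of _ 0]) auto

lemma absconv_uminus: "g \<in> absconv N \<Longrightarrow> (\<lambda>x. - g x) \<in> absconv N"
proof -
  assume "g \<in> absconv N"
  then obtain k :: nat and a f where "g = (\<lambda>x. \<Sum>j<k. a j * f j x)" "(\<Sum>j<k. \<bar>a j\<bar>) \<le> 1" "\<forall>j<k. f j \<in> N"
    by (auto simp: absconv_def)
  then show ?thesis
    unfolding absconv_def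
    by (intro CollectI exI[of _ k] exI[of _ "\<lambda>j. - a j"] exI[of _ f]) (auto simp: sum_negf)
qed

lemma absconv_abs_le:
  assumes "g \<in> absconv N" "\<And>f. f \<in> N \<Longrightarrow> \<bar>f x\<bar> \<le> M" "0 \<le> M"
  shows "\<bar>g x\<bar> \<le> M"
  using assms by (auto simp: absconv_def intro!: abs_weighted_sum_le)

lemma absconv_abs_diff_le:
  assumes "g \<in> absconv N" "\<And>f. f \<in> N \<Longrightarrow> \<bar>f x - f y\<bar> \<le> M" "0 \<le> M"
  shows "\<bar>g x - g y\<bar> \<le> M"
proof -
  obtain k :: nat and a f where g: "g = (\<lambda>x. \<Sum>j<k. a j * f j x)" "(\<Sum>j<k. \<bar>a j\<bar>) \<le> 1" "\<forall>j<k. f j \<in> N"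
    using assms(1) by (auto simp: absconv_def)
  have "g x - g y = (\<Sum>j<k. a j * (f j x - f j y))"
    by (simp add: g(1) sum_subtractf right_diff_distrib)
  then show ?thesis using abs_weighted_sum_le[OF g(2), of "\<lambda>j. f j x - f j y" M] assms g by auto
qed

lemma absconv_measurable:
  assumes "g \<in> absconv N" "N \<subseteq> borel_measurable M"
  shows "g \<in> borel_measurable M"
  using assms by (auto simp: absconv_def intro!: borel_measurable_sum borel_measurable_times)

lemma relu_lipschitz: "\<bar>max x 0 - max y 0\<bar> \<le> \<bar>x - y :: real\<bar>"
  by (auto simp: max_def)

lemma sigmoid_in_node: "enorm p w \<le> B \<Longrightarrow> (\<lambda>x. sigmoid ((\<Sum>i<p. w i * x i) + b)) \<in> node p B (Suc 0)"
  by auto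

text \<open>Weights of total size at most 1 cannot leave [-1,1], and the ReLU removes the negative
  part. Nonnegativity is what later allows negative weights to be dropped from above.\<close>

lemma node_range: "f \<in> node p B l \<Longrightarrow> 0 \<le> f x \<and> f x \<le> 1"
proof (induction p B l arbitrary: f rule: node.induct)
  case (2 p B)
  then show ?case using sigmoid_pos sigmoid_less_one by (auto intro: less_imp_le)
next
  case (3 p B l)
  then obtain g where g: "f = (\<lambda>x. max (g x) 0)" "g \<in> absconv (node p B (Suc l))"
    unfolding node_Suc_Suc by blast
  have "0 \<le> h x \<and> h x \<le> 1" if "h \<in> node p B (Suc l)" for h
    using "3.IH"[of 0 1 h] that by simp
  then have "\<bar>g x\<bar> \<le> 1" by (intro absconv_abs_le[OF g(2)]) (auto simp: abs_le_iff intro: order_trans[of _ 0])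
  then show ?case by (auto simp: g(1))
qed simp

text \<open>The constant is that of the first layer, the 1/4 coming from the sigmoid. Hulls and the
  ReLU do not increase it, so it is independent of the depth.\<close>

lemma node_lipschitz:
  "f \<in> node p B l \<Longrightarrow> 0 \<le> B \<Longrightarrow> \<bar>f x - f y\<bar> \<le> B / 4 * enorm p (\<lambda>i. x i - y i)"
proof (induction p B l arbitrary: f rule: node.induct)
  case (2 p B)
  then obtain w b where f: "f = (\<lambda>x. sigmoid ((\<Sum>i<p. w i * x i) + b))" and w: "enorm p w \<le> B"
    by auto
  have "\<bar>f x - f y\<bar> \<le> \<bar>((\<Sum>i<p. w i * x i) + b) - ((\<Sum>i<p. w i * y i) + b)\<bar> / 4"
    unfolding f by (rule sigmoid_lipschitz)
  also have "((\<Sum>i<p. w i * x i) + b) - ((\<Sum>i<p. w i * y i) + b) = (\<Sum>i<p. w i * (x i - y i))"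
    by (simp add: sum_subtractf right_diff_distrib)
  also have "\<bar>\<dots>\<bar> \<le> enorm p w * enorm p (\<lambda>i. x i - y i)" by (rule abs_inner_le_enorm)
  also have "\<dots> \<le> B * enorm p (\<lambda>i. x i - y i)" by (intro mult_right_mono w enorm_nonneg)
  finally show ?case by simp
next
  case (3 p B l)
  then obtain g where g: "f = (\<lambda>x. max (g x) 0)" "g \<in> absconv (node p B (Suc l))"
    unfolding node_Suc_Suc by blast
  have "\<bar>f x - f y\<bar> \<le> \<bar>g x - g y\<bar>" unfolding g(1) by (rule relu_lipschitz)
  also have "\<dots> \<le> B / 4 * enorm p (\<lambda>i. x i - y i)"
    using "3.IH"[of 0 1] "3.prems"(2)
    by (intro absconv_abs_diff_le[OF g(2)]) (auto intro!: mult_nonneg_nonneg enorm_nonneg)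
  finally show ?case .
qed simp

lemma borel_measurable_sigmoid [measurable]: "sigmoid \<in> borel_measurable borel"
  unfolding sigmoid_def[abs_def] by measurable

lemma measurable_affine [measurable]:
  "(\<lambda>x. (\<Sum>i<p. w i * x i) + b) \<in> borel_measurable (Rp p)"
  unfolding Rp_def by (intro borel_measurable_add borel_measurable_sum borel_measurable_times) auto

lemma node_measurable: "f \<in> node p B l \<Longrightarrow> f \<in> borel_measurable (Rp p)"
proof (induction p B l arbitrary: f rule: node.induct)
  case (2 p B)
  then show ?case by (auto intro!: measurable_compose[OF measurable_affine borel_measurable_sigmoid])
next
  case (3 p B l)
  then obtain g where g: "f = (\<lambda>x. max (g x) 0)" "g \<in> absconv (node p B (Suc l))"
    unfolding node_Suc_Suc by blast
  have "g \<in> borel_measurable (Rp p)"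
    using "3.IH"[of 0 1] by (intro absconv_measurable[OF g(2)]) auto
  then show ?case unfolding g(1) by measurable
qed simp

lemma Dnet_abs_le: "f \<in> Dnet p B L \<Longrightarrow> \<bar>f x\<bar> \<le> 1"
  unfolding Dnet_eq_absconv
  by (erule absconv_abs_le) (auto simp: abs_le_iff dest: node_range[of _ _ _ _ x] intro: order_trans[of _ 0])

lemma Dnet_lipschitz: "f \<in> Dnet p B L \<Longrightarrow> 0 \<le> B \<Longrightarrow> \<bar>f x - f y\<bar> \<le> B / 4 * enorm p (\<lambda>i. x i - y i)"
  unfolding Dnet_eq_absconv
  by (erule absconv_abs_diff_le) (use node_lipschitz[of _ p B _ x y] in \<open>auto intro: mult_nonneg_nonneg enorm_nonneg\<close>)

lemma Dnet_measurable: "f \<in> Dnet p B L \<Longrightarrow> f \<in> borel_measurable (Rp p)"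
  unfolding Dnet_eq_absconv by (rule absconv_measurable) (auto intro: node_measurable)

lemma Dnet_uminus: "f \<in> Dnet p B L \<Longrightarrow> (\<lambda>x. - f x) \<in> Dnet p B L"
  unfolding Dnet_eq_absconv by (rule absconv_uminus)

text \<open>A positive function passes unchanged through a ReLU node with the single weight 1, so a
  lone neuron is available as a discriminator at every depth.\<close>

lemma sigmoid_in_node_Suc:
  "enorm p w \<le> B \<Longrightarrow> (\<lambda>x. sigmoid ((\<Sum>i<p. w i * x i) + b)) \<in> node p B (Suc l)"
proof (induction l)
  case (Suc l)
  let ?f = "\<lambda>x. sigmoid ((\<Sum>i<p. w i * x i) + b)"
  have eq: "(\<lambda>x. max (?f x) 0) = ?f" by (simp add: fun_eq_iff max.absorb1 less_imp_le[OF sigmoid_pos])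
  have "(\<lambda>x. max (?f x) 0) \<in> node p B (Suc (Suc l))"
    unfolding node_Suc_Suc by (rule imageI) (rule absconv_superset[OF Suc.IH[OF Suc.prems]])
  then show ?case unfolding eq .
qed auto

lemma sigmoid_in_Dnet:
  assumes "enorm p w \<le> B" "2 \<le> L"
  shows "(\<lambda>x. sigmoid ((\<Sum>i<p. w i * x i) + b)) \<in> Dnet p B L"
proof -
  have "L - 1 = Suc (L - 2)" using assms(2) by simp
  then show ?thesis
    unfolding Dnet_eq_absconv by (simp only: absconv_superset[OF sigmoid_in_node_Suc[OF assms(1)]])
qed

section \<open>Rademacher average of the discriminator class\<close>

definition class_rademacher :: "(('b \<Rightarrow> real)) set \<Rightarrow> nat \<Rightarrow> (nat \<Rightarrow> 'b) \<Rightarrow> real" where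
  "class_rademacher N n z = rademacher N (\<lambda>_. 0) n (\<lambda>i f. f (z i))"

lemma bounded_image_of_bound: "(\<And>t. t \<in> I \<Longrightarrow> \<bar>f t\<bar> \<le> M) \<Longrightarrow> bounded (f ` I :: real set)"
  unfolding bdd_real_image_iff by blast

lemma bdd_above_sign_sum:
  fixes h :: "nat \<Rightarrow> 'a \<Rightarrow> real"
  assumes "\<And>i. i < n \<Longrightarrow> bounded (h i ` I)"
  shows "bdd_above ((\<lambda>t. \<Sum>i<n. s i * h i t) ` I)"
  using assms by (intro bounded_imp_bdd_above_image bounded_image_sum bounded_image_cmult) auto

lemma class_rademacher_relu_le:
  assumes "N \<noteq> {}" "\<And>f x. f \<in> N \<Longrightarrow> \<bar>f x\<bar> \<le> 1"
  shows "class_rademacher ((\<lambda>g x. max (g x) 0) ` N) n z \<le> class_rademacher N n z"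
proof -
  have "class_rademacher ((\<lambda>g x. max (g x) 0) ` N) n z = rademacher N (\<lambda>_. 0) n (\<lambda>i f. max (f (z i)) 0)"
    by (simp add: class_rademacher_def rademacher_def image_comp comp_def)
  also have "\<dots> \<le> rademacher N (\<lambda>_. 0) n (\<lambda>i f. f (z i))"
  proof (rule rademacher_contraction[OF assms(1)])
    show "bounded ((\<lambda>_. 0 :: real) ` N)" by (rule bounded_image_of_bound[where M = 0]) simp
    fix i
    show "bounded ((\<lambda>f. f (z i)) ` N)" by (rule bounded_image_of_bound[where M = 1]) (rule assms(2))
    show "bounded ((\<lambda>f. max (f (z i)) 0) ` N)"
    proof (rule bounded_image_of_bound[where M = 1])
      show "\<bar>max (f (z i)) 0\<bar> \<le> 1" if "f \<in> N" for f using assms(2)[OF that, of "z i"] by (auto simp: max_def)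
    qed
  qed (rule relu_lipschitz)
  finally show ?thesis by (simp add: class_rademacher_def)
qed

text \<open>A signed sum over the hull is at most the largest absolute signed sum over
  \<open>N\<close>. Since 0 lies in \<open>N\<close>, both \<open>S s\<close> and
  \<open>S (-s)\<close> are nonnegative and their sum bounds that absolute value; the symmetry of
  the signs gives them the same average. This is the source of the factor 2 per layer, the ReLU
  itself being free.\<close>

lemma class_rademacher_absconv_le:
  assumes 0: "(\<lambda>_. 0) \<in> N" and b: "\<And>f x. f \<in> N \<Longrightarrow> \<bar>f x\<bar> \<le> 1"
  shows "class_rademacher (absconv N) n z \<le> 2 * class_rademacher N n z"
proof -
  define S where "S s = (SUP f\<in>N. \<Sum>i<n. s i * f (z i))" for s
  have bd: "bdd_above ((\<lambda>f. \<Sum>i<n. s i * f (z i)) ` N)" for s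
    by (rule bdd_above_sign_sum) (use b in \<open>auto intro!: bounded_image_of_bound[where M = 1]\<close>)
  have up: "(\<Sum>i<n. s i * f (z i)) \<le> S s" if "f \<in> N" for f s
    unfolding S_def by (rule cSUP_upper[OF that bd])
  have S0: "0 \<le> S s" for s using up[OF 0, of s] by simp
  have "class_rademacher (absconv N) n z \<le> savg n (\<lambda>s. S s + S (\<lambda>i. - s i))"
    unfolding class_rademacher_def rademacher_def add_0
  proof (rule savg_mono, rule cSUP_least)
    show "absconv N \<noteq> {}" using zero_in_absconv by blast
    fix s g assume "g \<in> absconv N"
    then obtain k :: nat and a f where g: "g = (\<lambda>x. \<Sum>j<k. a j * f j x)" "(\<Sum>j<k. \<bar>a j\<bar>) \<le> 1" "\<forall>j<k. f j \<in> N"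
      by (auto simp: absconv_def)
    have "(\<Sum>i<n. s i * g (z i)) = (\<Sum>j<k. a j * (\<Sum>i<n. s i * f j (z i)))"
      unfolding g(1) sum_distrib_left by (subst sum.swap) (simp add: mult_ac)
    also have "\<dots> \<le> \<bar>\<dots>\<bar>" by simp
    also have "\<dots> \<le> S s + S (\<lambda>i. - s i)"
    proof (rule abs_weighted_sum_le[OF g(2)])
      fix j assume "j < k"
      then have "f j \<in> N" using g by blast
      from up[OF this, of s] up[OF this, of "\<lambda>i. - s i"] S0[of s] S0[of "\<lambda>i. - s i"]
      show "\<bar>\<Sum>i<n. s i * f j (z i)\<bar> \<le> S s + S (\<lambda>i. - s i)" by (simp add: sum_negf)
    qed (use S0[of s] S0[of "\<lambda>i. - s i"] in auto)
    finally show "(\<Sum>i<n. s i * g (z i)) \<le> S s + S (\<lambda>i. - s i)" .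
  qed
  also have "\<dots> = 2 * savg n S"
    unfolding savg_add savg_uminus by simp
  finally show ?thesis by (simp add: class_rademacher_def rademacher_def S_def[abs_def])
qed

lemma class_rademacher_Dnet_le:
  "class_rademacher (Dnet p B (Suc (Suc l))) n z \<le> 2 ^ l * class_rademacher (Dnet p B 2) n z"
proof (induction l)
  case (Suc l)
  let ?D = "Dnet p B (Suc (Suc l))"
  let ?N = "(\<lambda>g x. max (g x) 0) ` ?D"
  have "class_rademacher (Dnet p B (Suc (Suc (Suc l)))) n z = class_rademacher (absconv ?N) n z"
    unfolding Dnet_eq_absconv by (simp only: diff_Suc_1 node_Suc_Suc)
  also have "\<dots> \<le> 2 * class_rademacher ?N n z"
  proof (rule class_rademacher_absconv_le)
    have "(\<lambda>_. 0) \<in> ?D" unfolding Dnet_eq_absconv by (rule zero_in_absconv)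
    then show "(\<lambda>_. 0) \<in> ?N" by (rule rev_image_eqI) simp
  next
    fix f x assume "f \<in> ?N"
    then obtain g where "g \<in> ?D" "f = (\<lambda>x. max (g x) 0)" by blast
    then show "\<bar>f x\<bar> \<le> 1" using Dnet_abs_le[of g p B "Suc (Suc l)" x] by (auto simp: max_def)
  qed
  also have "\<dots> \<le> 2 * class_rademacher ?D n z"
  proof (rule mult_left_mono)
    show "class_rademacher ?N n z \<le> class_rademacher ?D n z"
    proof (rule class_rademacher_relu_le)
      show "?D \<noteq> {}" unfolding Dnet_eq_absconv using zero_in_absconv by blast
    qed (rule Dnet_abs_le)
  qed simp
  also have "\<dots> \<le> 2 * (2 ^ l * class_rademacher (Dnet p B 2) n z)"
    by (rule mult_left_mono[OF Suc.IH]) simp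
  finally show ?case by simp
next
  case 0
  then show ?case unfolding numeral_2_eq_2 by simp
qed

lemma class_rademacher_shallow_le:
  fixes y :: "nat \<Rightarrow> nat \<Rightarrow> real"
  assumes B: "0 \<le> B" and y: "y = (\<lambda>i k. z i k - \<theta> k)"
  shows "class_rademacher (Dnet p B 2) n z \<le> savg n (\<lambda>s. \<bar>\<Sum>i<n. s i * (1 / 2)\<bar>)
    + rademacher {(w, b). enorm p w \<le> B} (\<lambda>_. 0) n (\<lambda>i (w, b). sigmoid ((\<Sum>k<p. w k * y i k) + b) - 1 / 2)"
proof -
  let ?W = "{(w, b :: real). enorm p w \<le> B}"
  define h where "h = (\<lambda>i (w, b). sigmoid ((\<Sum>k<p. w k * y i k) + b) - 1 / 2)"
  define S where "S s = (SUP t\<in>?W. \<Sum>i<n. s i * h i t)" for s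
  have W0: "((\<lambda>_. 0), 0) \<in> ?W" using B by (simp add: enorm_def)
  have hb: "\<bar>h i t\<bar> \<le> 1" for i t
    using sigmoid_pos[of "(\<Sum>k<p. fst t k * y i k) + snd t"] sigmoid_less_one[of "(\<Sum>k<p. fst t k * y i k) + snd t"]
    by (cases t) (auto simp: h_def abs_le_iff)
  have bd: "bdd_above ((\<lambda>t. \<Sum>i<n. s i * h i t) ` ?W)" for s
    by (rule bdd_above_sign_sum) (use hb in \<open>auto intro!: bounded_image_of_bound[where M = 1]\<close>)
  have up: "(\<Sum>i<n. s i * h i t) \<le> S s" if "t \<in> ?W" for t s
    unfolding S_def by (rule cSUP_upper[OF that bd])
  have abs_up: "\<bar>\<Sum>i<n. s i * h i t\<bar> \<le> S s" if "t \<in> ?W" for t s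
  proof -
    obtain w b where t: "t = (w, b)" by (cases t)
    have "h i ((\<lambda>k. - w k), - b) = - h i t" for i
      using sigmoid_minus[of "(\<Sum>k<p. w k * y i k) + b"] by (simp add: h_def t sum_negf add.commute)
    moreover have "((\<lambda>k. - w k), - b) \<in> ?W" using that by (simp add: t enorm_def)
    ultimately have "- (\<Sum>i<n. s i * h i t) \<le> S s"
      using up[of "((\<lambda>k. - w k), - b)" s] by (simp add: sum_negf)
    with up[OF that, of s] show ?thesis by simp
  qed
  have S0: "0 \<le> S s" for s using abs_up[OF W0, of s] by linarith
  have "class_rademacher (Dnet p B 2) n z \<le> savg n (\<lambda>s. \<bar>\<Sum>i<n. s i * (1 / 2)\<bar> + S s)"
    unfolding class_rademacher_def rademacher_def add_0 Dnet_eq_absconv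
  proof (rule savg_mono, rule cSUP_least)
    show "absconv (node p B (2 - 1)) \<noteq> {}" using zero_in_absconv by blast
    fix s g assume "g \<in> absconv (node p B (2 - 1))"
    then obtain k :: nat and a f where g: "g = (\<lambda>x. \<Sum>j<k. a j * f j x)" "(\<Sum>j<k. \<bar>a j\<bar>) \<le> 1"
      "\<forall>j<k. f j \<in> node p B (Suc 0)"
      by (auto simp: absconv_def)
    have "(\<Sum>i<n. s i * g (z i)) = (\<Sum>j<k. a j * (\<Sum>i<n. s i * f j (z i)))"
      unfolding g(1) sum_distrib_left by (subst sum.swap) (simp add: mult_ac)
    also have "\<dots> \<le> \<bar>\<dots>\<bar>" by simp
    also have "\<dots> \<le> \<bar>\<Sum>i<n. s i * (1 / 2)\<bar> + S s"
    proof (rule abs_weighted_sum_le[OF g(2)])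
      fix j assume "j < k"
      then have "f j \<in> node p B (Suc 0)" using g by blast
      then obtain w b where f: "f j = (\<lambda>x. sigmoid ((\<Sum>i<p. w i * x i) + b))" and w: "enorm p w \<le> B"
        by auto
      let ?t = "(w, b + (\<Sum>k<p. w k * \<theta> k))"
      have "f j (z i) = 1 / 2 + h i ?t" for i
        by (simp add: f h_def y sum_subtractf right_diff_distrib)
      then have "(\<Sum>i<n. s i * f j (z i)) = (\<Sum>i<n. s i * (1 / 2)) + (\<Sum>i<n. s i * h i ?t)"
        by (simp add: distrib_left sum.distrib)
      then show "\<bar>\<Sum>i<n. s i * f j (z i)\<bar> \<le> \<bar>\<Sum>i<n. s i * (1 / 2)\<bar> + S s"
        using abs_up[of ?t s] w by simp
    qed (use S0[of s] in auto)
    finally show "(\<Sum>i<n. s i * g (z i)) \<le> \<bar>\<Sum>i<n. s i * (1 / 2)\<bar> + S s" .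
  qed
  also have "\<dots> = savg n (\<lambda>s. \<bar>\<Sum>i<n. s i * (1 / 2)\<bar>) + savg n S"
    by (rule savg_add)
  finally show ?thesis by (simp add: rademacher_def S_def[abs_def] h_def)
qed

lemma sum_even_indices:
  fixes f :: "nat \<Rightarrow> real"
  shows "(\<Sum>j<2 * n. if even j then f (j div 2) else 0) = (\<Sum>i<n. f i)"
    and "(\<Sum>j<2 * n. if even j then 0 else f (j div 2)) = (\<Sum>i<n. f i)"
  by (induction n) auto

text \<open>After the two-component contraction both processes are linear in a bounded parameter:
  the weight vector of norm at most \<open>B\<close>, and the number \<open>arctan (b / l)\<close>
  of size at most pi/2. Their suprema are then a Euclidean norm and an absolute value of signed
  sums.\<close>

lemma rademacher_sigmoid_le:
  fixes p :: nat and y :: "nat \<Rightarrow> nat \<Rightarrow> real"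
  assumes B: "0 \<le> B" and l: "1 \<le> l" and K: "0 < K1" "0 < K2"
  defines "q \<equiv> \<lambda>i. 1 + (B * enorm p (y i) / l)\<^sup>2"
  shows "rademacher {(w, b). enorm p w \<le> B} (\<lambda>_. 0) n (\<lambda>i (w, b). sigmoid ((\<Sum>k<p. w k * y i k) + b) - 1 / 2)
    \<le> B / 4 * (K2 + (\<Sum>i<n. (enorm p (y i))\<^sup>2) / K2) + pi * l * (K1 + (\<Sum>i<n. (q i)\<^sup>2) / K1)"
proof -
  let ?W = "{(w, b :: real). enorm p w \<le> B}"
  define a where "a = (\<lambda>i (w :: nat \<Rightarrow> real, b :: real). (\<Sum>k<p. w k * y i k) / 4)"
  define c where "c = (\<lambda>i (w :: nat \<Rightarrow> real, b). 2 * l * q i * arctan (b / l))"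
  define h where "h = (\<lambda>j. if even j then (\<lambda>t. 2 * a (j div 2) t) else (\<lambda>t. 2 * c (j div 2) t))"
  \<comment> \<open>Zero padding lets the even and the odd signs be summed over the common index
    range \<open>2 * n\<close>.\<close>
  define Y where "Y = (\<lambda>j k. if even j then y (j div 2) k else 0)"
  define Q where "Q = (\<lambda>j. if even j then 0 else q (j div 2))"
  have W0: "((\<lambda>_. 0), 0) \<in> ?W" using B by (simp add: enorm_def)
  have in_le: "\<bar>\<Sum>k<p. w k * x k\<bar> \<le> B * enorm p x" if "enorm p w \<le> B" for w x
    using abs_inner_le_enorm[of w x p] mult_right_mono[OF that enorm_nonneg[of p x]] by linarith
  have "rademacher ?W (\<lambda>_. 0) n (\<lambda>i (w, b). sigmoid ((\<Sum>k<p. w k * y i k) + b) - 1 / 2)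
      \<le> rademacher ?W (\<lambda>_. 0) (2 * n) h"
    unfolding h_def
  proof (rule rademacher_contraction2)
    show "?W \<noteq> {}" using W0 by blast
    show "bounded ((\<lambda>_. 0 :: real) ` ?W)" by (rule bounded_image_of_bound[where M = 0]) simp
    fix i
    show "bounded (a i ` ?W)"
      by (rule bounded_image_of_bound[where M = "B * enorm p (y i) / 4"]) (auto simp: a_def in_le)
    show "bounded (c i ` ?W)"
    proof (rule bounded_image_of_bound[where M = "2 * l * q i * (pi / 2)"])
      have "\<bar>2 * l * q i * arctan x\<bar> \<le> 2 * l * q i * (pi / 2)" for x
      proof -
        have "0 \<le> 2 * l * q i" using l by (simp add: q_def)
        moreover have "\<bar>arctan x\<bar> \<le> pi / 2" using arctan_bounded[of x] by linarith
        ultimately show ?thesis unfolding abs_mult[of "2 * l * q i"] by (intro mult_mono) auto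
      qed
      then show "\<bar>c i t\<bar> \<le> 2 * l * q i * (pi / 2)" for t by (cases t) (simp add: c_def)
    qed
    show "bounded ((\<lambda>(w, b). sigmoid ((\<Sum>k<p. w k * y i k) + b) - 1 / 2) ` ?W)"
    proof (rule bounded_image_of_bound[where M = 1])
      fix t :: "(nat \<Rightarrow> real) \<times> real"
      show "\<bar>case t of (w, b) \<Rightarrow> sigmoid ((\<Sum>k<p. w k * y i k) + b) - 1 / 2\<bar> \<le> 1"
        using sigmoid_pos[of "(\<Sum>k<p. fst t k * y i k) + snd t"] sigmoid_less_one[of "(\<Sum>k<p. fst t k * y i k) + snd t"]
        by (cases t) (auto simp: abs_le_iff)
    qed
    fix s t assume st: "s \<in> ?W" "t \<in> ?W"
    obtain w b where s: "s = (w, b)" by (cases s)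
    obtain w' b' where t: "t = (w', b')" by (cases t)
    let ?u = "\<Sum>k<p. w k * y i k" and ?u' = "\<Sum>k<p. w' k * y i k"
    have "\<bar>sigmoid (?u' + b') - sigmoid (?u + b)\<bar>
        \<le> \<bar>sigmoid (?u' + b') - sigmoid (?u + b')\<bar> + \<bar>sigmoid (?u + b') - sigmoid (?u + b)\<bar>"
      by linarith
    also have "\<dots> \<le> \<bar>(?u' + b') - (?u + b')\<bar> / 4
        + \<bar>2 * l * q i * arctan (b' / l) - 2 * l * q i * arctan (b / l)\<bar>"
      unfolding q_def using st by (intro add_mono sigmoid_lipschitz sigmoid_bias_separation l in_le) (auto simp: s)
    finally show "\<bar>(case t of (w, b) \<Rightarrow> sigmoid ((\<Sum>k<p. w k * y i k) + b) - 1 / 2)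
          - (case s of (w, b) \<Rightarrow> sigmoid ((\<Sum>k<p. w k * y i k) + b) - 1 / 2)\<bar>
        \<le> \<bar>a i t - a i s\<bar> + \<bar>c i t - c i s\<bar>"
      by (simp add: s t a_def c_def flip: diff_divide_distrib)
  qed
  also have "\<dots> \<le> savg (2 * n) (\<lambda>s. B / 2 * ((K2 + (\<Sum>k<p. (\<Sum>j<2 * n. s j * Y j k)\<^sup>2) / K2) / 2)
      + 2 * pi * l * \<bar>\<Sum>j<2 * n. s j * Q j\<bar>)"
    unfolding rademacher_def add_0
  proof (rule savg_mono, rule cSUP_least)
    show "?W \<noteq> {}" using W0 by blast
    fix s :: "nat \<Rightarrow> real" and t assume tW: "t \<in> ?W"
    obtain w b where t: "t = (w, b)" by (cases t)
    have w: "enorm p w \<le> B" using tW t by simp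
    let ?V = "\<lambda>k. \<Sum>j<2 * n. s j * Y j k"
    have "h j t = 1 / 2 * (\<Sum>k<p. w k * Y j k) + 4 * l * arctan (b / l) * Q j" for j
      by (simp add: h_def a_def c_def t Y_def Q_def)
    then have "(\<Sum>j<2 * n. s j * h j t)
        = (\<Sum>j<2 * n. 1 / 2 * (\<Sum>k<p. w k * (s j * Y j k)) + 4 * l * arctan (b / l) * (s j * Q j))"
      by (intro sum.cong refl) (simp add: distrib_left sum_distrib_left mult_ac)
    also have "\<dots> = 1 / 2 * (\<Sum>j<2 * n. \<Sum>k<p. w k * (s j * Y j k)) + 4 * l * arctan (b / l) * (\<Sum>j<2 * n. s j * Q j)"
      by (simp only: sum.distrib sum_distrib_left)
    also have "(\<Sum>j<2 * n. \<Sum>k<p. w k * (s j * Y j k)) = (\<Sum>k<p. w k * ?V k)"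
      unfolding sum_distrib_left by (rule sum.swap)
    also have "1 / 2 * (\<Sum>k<p. w k * ?V k) + 4 * l * arctan (b / l) * (\<Sum>j<2 * n. s j * Q j)
        \<le> B / 2 * ((K2 + (enorm p ?V)\<^sup>2 / K2) / 2) + 2 * pi * l * \<bar>\<Sum>j<2 * n. s j * Q j\<bar>"
    proof (rule add_mono)
      have "(\<Sum>k<p. w k * ?V k) \<le> B * enorm p ?V" using in_le[OF w, of ?V] by linarith
      also have "\<dots> \<le> B * ((K2 + (enorm p ?V)\<^sup>2 / K2) / 2)"
        using abs_le_AM_GM[OF K(2), of "enorm p ?V"] by (intro mult_left_mono B) linarith
      finally show "1 / 2 * (\<Sum>k<p. w k * ?V k) \<le> B / 2 * ((K2 + (enorm p ?V)\<^sup>2 / K2) / 2)" by simp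
      have "4 * l * arctan (b / l) * (\<Sum>j<2 * n. s j * Q j) \<le> \<bar>4 * l * arctan (b / l) * (\<Sum>j<2 * n. s j * Q j)\<bar>"
        by simp
      also have "\<dots> = 4 * l * \<bar>arctan (b / l)\<bar> * \<bar>\<Sum>j<2 * n. s j * Q j\<bar>"
        using l by (simp add: abs_mult)
      also have "\<dots> \<le> 4 * l * (pi / 2) * \<bar>\<Sum>j<2 * n. s j * Q j\<bar>"
        using arctan_bounded[of "b / l"] l by (intro mult_right_mono mult_left_mono) auto
      finally show "4 * l * arctan (b / l) * (\<Sum>j<2 * n. s j * Q j) \<le> 2 * pi * l * \<bar>\<Sum>j<2 * n. s j * Q j\<bar>"
        by (simp add: mult_ac)
    qed
    finally show "(\<Sum>j<2 * n. s j * h j t) \<le> B / 2 * ((K2 + (\<Sum>k<p. (?V k)\<^sup>2) / K2) / 2)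
        + 2 * pi * l * \<bar>\<Sum>j<2 * n. s j * Q j\<bar>"
      unfolding enorm_power2 .
  qed
  also have "\<dots> = B / 4 * K2 + B / (4 * K2) * (\<Sum>k<p. savg (2 * n) (\<lambda>s. (0 + (\<Sum>j<2 * n. s j * Y j k))\<^sup>2))
      + 2 * pi * l * savg (2 * n) (\<lambda>s. \<bar>\<Sum>j<2 * n. s j * Q j\<bar>)"
  proof -
    have "(\<lambda>s. B / 2 * ((K2 + (\<Sum>k<p. (\<Sum>j<2 * n. s j * Y j k)\<^sup>2) / K2) / 2) + 2 * pi * l * \<bar>\<Sum>j<2 * n. s j * Q j\<bar>)
      = (\<lambda>s. (B / 4 * K2 + B / (4 * K2) * (\<Sum>k<p. (0 + (\<Sum>j<2 * n. s j * Y j k))\<^sup>2)) + 2 * pi * l * \<bar>\<Sum>j<2 * n. s j * Q j\<bar>)"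
      using K by (auto simp: fun_eq_iff field_simps)
    then show ?thesis by (simp only: savg_add savg_cmult savg_const savg_sum)
  qed
  also have "(\<Sum>k<p. savg (2 * n) (\<lambda>s. (0 + (\<Sum>j<2 * n. s j * Y j k))\<^sup>2)) = (\<Sum>i<n. (enorm p (y i))\<^sup>2)"
  proof -
    have "(\<Sum>j<2 * n. (Y j k)\<^sup>2) = (\<Sum>i<n. (y i k)\<^sup>2)" for k
      unfolding sum_even_indices(1)[of "\<lambda>i. (y i k)\<^sup>2" n, symmetric] by (intro sum.cong) (auto simp: Y_def)
    then show ?thesis
      unfolding savg_square enorm_power2 by (simp add: sum.swap[of _ "{..<p}" "{..<n}"])
  qed
  also have "2 * pi * l * savg (2 * n) (\<lambda>s. \<bar>\<Sum>j<2 * n. s j * Q j\<bar>)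
      \<le> 2 * pi * l * ((K1 + (\<Sum>j<2 * n. (Q j)\<^sup>2) / K1) / 2)"
    using l by (intro mult_left_mono savg_abs_le K) auto
  also have "(\<Sum>j<2 * n. (Q j)\<^sup>2) = (\<Sum>i<n. (q i)\<^sup>2)"
    unfolding sum_even_indices(2)[of "\<lambda>i. (q i)\<^sup>2" n, symmetric] by (intro sum.cong) (auto simp: Q_def)
  finally show ?thesis by (simp add: distrib_left add_divide_distrib)
qed

lemma class_rademacher_Dnet_bound:
  fixes y :: "nat \<Rightarrow> nat \<Rightarrow> real"
  assumes B: "0 \<le> B" and l: "1 \<le> l" and K: "0 < K1" "0 < K2" and y: "y = (\<lambda>i k. z i k - \<theta> k)"
  shows "class_rademacher (Dnet p B (Suc (Suc m))) n z \<le> 2 ^ m * ((K1 + real n / (4 * K1)) / 2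
    + (B / 4 * (K2 + (\<Sum>i<n. (enorm p (y i))\<^sup>2) / K2)
      + pi * l * (K1 + (\<Sum>i<n. (1 + (B * enorm p (y i) / l)\<^sup>2)\<^sup>2) / K1)))"
proof -
  have "class_rademacher (Dnet p B (Suc (Suc m))) n z \<le> 2 ^ m * class_rademacher (Dnet p B 2) n z"
    by (rule class_rademacher_Dnet_le)
  also have "\<dots> \<le> 2 ^ m * ((K1 + (\<Sum>i<n. (1 / 2)\<^sup>2) / K1) / 2
    + (B / 4 * (K2 + (\<Sum>i<n. (enorm p (y i))\<^sup>2) / K2)
      + pi * l * (K1 + (\<Sum>i<n. (1 + (B * enorm p (y i) / l)\<^sup>2)\<^sup>2) / K1)))"
  proof (rule mult_left_mono)
    show "class_rademacher (Dnet p B 2) n z \<le> (K1 + (\<Sum>i<n. (1 / 2)\<^sup>2) / K1) / 2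
      + (B / 4 * (K2 + (\<Sum>i<n. (enorm p (y i))\<^sup>2) / K2)
        + pi * l * (K1 + (\<Sum>i<n. (1 + (B * enorm p (y i) / l)\<^sup>2)\<^sup>2) / K1))"
      using class_rademacher_shallow_le[OF B y, of p n] savg_abs_le[OF K(1), of n "\<lambda>_. 1 / 2"]
        rademacher_sigmoid_le[OF B l K, of p n y] by linarith
  qed simp
  also have "(\<Sum>i<n. (1 / 2 :: real)\<^sup>2) / K1 = real n / (4 * K1)"
    by (simp add: power2_eq_square)
  finally show ?thesis .
qed

section \<open>Bounded functions of an i.i.d. sample\<close>

text \<open>Bounded measurable functions: integrable under every probability measure and stable
  under finite suprema, sign averages, sections and partial integration. Integrability obligations
  then reduce to closure rules.\<close>

definition bmf :: "'a measure \<Rightarrow> ('a \<Rightarrow> real) \<Rightarrow> bool" where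
  "bmf M f \<longleftrightarrow> f \<in> borel_measurable M \<and> (\<exists>C. \<forall>x\<in>space M. \<bar>f x\<bar> \<le> C)"

lemma bmfI: "f \<in> borel_measurable M \<Longrightarrow> (\<And>x. x \<in> space M \<Longrightarrow> \<bar>f x\<bar> \<le> C) \<Longrightarrow> bmf M f"
  unfolding bmf_def by blast

lemma bmf_measurable: "bmf M f \<Longrightarrow> f \<in> borel_measurable M"
  by (simp add: bmf_def)

lemma (in prob_space) bmf_integrable: "bmf M f \<Longrightarrow> integrable M f"
  unfolding bmf_def by (auto intro!: integrable_const_bound AE_I2)

lemma bmf_const: "bmf M (\<lambda>_. c)"
  by (rule bmfI[where C = "\<bar>c\<bar>"]) auto

lemma bmf_cmult: "bmf M f \<Longrightarrow> bmf M (\<lambda>x. c * f x)"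
proof -
  assume f: "bmf M f"
  then obtain C where C: "\<forall>x\<in>space M. \<bar>f x\<bar> \<le> C" by (auto simp: bmf_def)
  show ?thesis
    by (rule bmfI[where C = "\<bar>c\<bar> * C"])
      (use bmf_measurable[OF f] C in \<open>auto simp: abs_mult intro!: mult_left_mono borel_measurable_times\<close>)
qed

lemma bmf_add: "bmf M f \<Longrightarrow> bmf M g \<Longrightarrow> bmf M (\<lambda>x. f x + g x)"
proof -
  assume f: "bmf M f" and g: "bmf M g"
  then obtain C C' where C: "\<forall>x\<in>space M. \<bar>f x\<bar> \<le> C" "\<forall>x\<in>space M. \<bar>g x\<bar> \<le> C'" by (auto simp: bmf_def)
  show ?thesis
  proof (rule bmfI[where C = "C + C'"])
    show "(\<lambda>x. f x + g x) \<in> borel_measurable M" using bmf_measurable[OF f] bmf_measurable[OF g] by simp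
    fix x assume "x \<in> space M"
    then show "\<bar>f x + g x\<bar> \<le> C + C'" using C abs_triangle_ineq[of "f x" "g x"] by fastforce
  qed
qed

lemma bmf_diff: "bmf M f \<Longrightarrow> bmf M g \<Longrightarrow> bmf M (\<lambda>x. f x - g x)"
  using bmf_add[of M f "\<lambda>x. - 1 * g x"] bmf_cmult[of M g "- 1"] by simp

lemma bmf_sum: "(\<And>i. i \<in> A \<Longrightarrow> bmf M (h i)) \<Longrightarrow> bmf M (\<lambda>x. \<Sum>i\<in>A. h i x)"
  by (induction A rule: infinite_finite_induct) (auto intro: bmf_const bmf_add)

lemma bmf_compose: "bmf N f \<Longrightarrow> g \<in> measurable M N \<Longrightarrow> bmf M (\<lambda>x. f (g x))"
proof -
  assume f: "bmf N f" and g: "g \<in> measurable M N"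
  then obtain C where C: "\<forall>x\<in>space N. \<bar>f x\<bar> \<le> C" by (auto simp: bmf_def)
  show ?thesis
    by (rule bmfI[where C = C]) (use bmf_measurable[OF f] g C measurable_space[OF g] in auto)
qed

lemma abs_cSUP_le:
  fixes h :: "'a \<Rightarrow> real"
  assumes "I \<noteq> {}" "\<And>t. t \<in> I \<Longrightarrow> \<bar>h t\<bar> \<le> C"
  shows "\<bar>SUP t\<in>I. h t\<bar> \<le> C"
proof -
  obtain t where t: "t \<in> I" using assms(1) by blast
  have "h t \<le> (SUP t\<in>I. h t)"
    by (intro cSUP_upper t bounded_imp_bdd_above_image bounded_image_of_bound[where M = C] assms(2))
  moreover have "(SUP t\<in>I. h t) \<le> C"
    using assms by (intro cSUP_least) (auto simp: abs_le_iff)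
  ultimately show ?thesis using assms(2)[OF t] by linarith
qed

lemma bmf_SUP:
  assumes F: "finite F" "F \<noteq> {}" and h: "\<And>f. f \<in> F \<Longrightarrow> bmf M (h f)"
  shows "bmf M (\<lambda>x. SUP f\<in>F. h f x)"
proof -
  have "\<forall>f\<in>F. \<exists>C. \<forall>x\<in>space M. \<bar>h f x\<bar> \<le> C" using h by (auto simp: bmf_def)
  then obtain C where C: "\<forall>f\<in>F. \<forall>x\<in>space M. \<bar>h f x\<bar> \<le> C f" by metis
  show ?thesis
  proof (rule bmfI[where C = "\<Sum>f\<in>F. \<bar>C f\<bar>"])
    show "(\<lambda>x. SUP f\<in>F. h f x) \<in> borel_measurable M"
      by (intro borel_measurable_cSUP countable_finite F bmf_measurable h) (use F in auto)
    fix x assume x: "x \<in> space M"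
    show "\<bar>SUP f\<in>F. h f x\<bar> \<le> (\<Sum>f\<in>F. \<bar>C f\<bar>)"
    proof (rule abs_cSUP_le[OF F(2)])
      fix f assume f: "f \<in> F"
      have "\<bar>h f x\<bar> \<le> \<bar>C f\<bar>" using C f x by fastforce
      also have "\<dots> \<le> (\<Sum>f\<in>F. \<bar>C f\<bar>)" by (rule member_le_sum[OF f]) (use F in auto)
      finally show "\<bar>h f x\<bar> \<le> (\<Sum>f\<in>F. \<bar>C f\<bar>)" .
    qed
  qed
qed

lemma bmf_savg: "(\<And>s. bmf M (\<Phi> s)) \<Longrightarrow> bmf M (\<lambda>x. savg n (\<lambda>s. \<Phi> s x))"
proof (induction n arbitrary: \<Phi>)
  case (Suc n)
  have "bmf M (\<lambda>x. 1 / 2 * (savg n (\<lambda>s. \<Phi> (s(n := 1)) x) + savg n (\<lambda>s. \<Phi> (s(n := - 1)) x)))"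
    by (intro bmf_cmult bmf_add Suc.IH Suc.prems)
  then show ?case by simp
qed simp

lemma (in prob_space) abs_integral_le:
  fixes h :: "'a \<Rightarrow> real"
  assumes "integrable M h" "\<And>x. x \<in> space M \<Longrightarrow> \<bar>h x\<bar> \<le> C"
  shows "\<bar>\<integral>x. h x \<partial>M\<bar> \<le> C"
proof -
  have "\<bar>\<integral>x. h x \<partial>M\<bar> \<le> (\<integral>x. \<bar>h x\<bar> \<partial>M)" by (rule integral_abs_bound)
  also have "\<dots> \<le> C" using assms by (intro integral_le_const integrable_abs AE_I2) auto
  finally show ?thesis .
qed

section \<open>Splitting off one coordinate of an i.i.d. sample\<close>

abbreviation iid :: "'a measure \<Rightarrow> nat \<Rightarrow> (nat \<Rightarrow> 'a) measure" where
  "iid M n \<equiv> \<Pi>\<^sub>M i\<in>{..<n}. M"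

lemma prob_space_iid: "prob_space M \<Longrightarrow> prob_space (iid M n)"
  by (rule prob_space_PiM)

lemma measurable_iid_update:
  "(\<lambda>(x, y). x(n := y)) \<in> measurable (iid M n \<Otimes>\<^sub>M M) (iid M (Suc n))"
  using measurable_add_dim[of n "{..<n}" "\<lambda>_. M"] by (simp add: lessThan_Suc)

lemma space_iid_update: "x \<in> space (iid M n) \<Longrightarrow> y \<in> space M \<Longrightarrow> x(n := y) \<in> space (iid M (Suc n))"
  using measurable_space[OF measurable_iid_update, of "(x, y)" n M] by (simp add: space_pair_measure)

lemma bmf_iid_component: "bmf M f \<Longrightarrow> i < n \<Longrightarrow> bmf (iid M n) (\<lambda>x. f (x i))"
  by (rule bmf_compose[of M f]) auto

text \<open>Fubini for the last coordinate in both orders. Concentration integrates that coordinate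
  out first, transfer freezes it, and symmetrization switches between the two.\<close>

lemma
  assumes M: "prob_space M" and F: "bmf (iid M (Suc n)) F"
  shows bmf_iid_section_last: "x \<in> space (iid M n) \<Longrightarrow> bmf M (\<lambda>y. F (x(n := y)))"
    and bmf_iid_section_init: "y \<in> space M \<Longrightarrow> bmf (iid M n) (\<lambda>x. F (x(n := y)))"
    and bmf_iid_integral_last: "bmf (iid M n) (\<lambda>x. \<integral>y. F (x(n := y)) \<partial>M)"
    and bmf_iid_integral_init: "bmf M (\<lambda>y. \<integral>x. F (x(n := y)) \<partial>iid M n)"
    and iid_integral_Suc: "(\<integral>x. F x \<partial>iid M (Suc n)) = (\<integral>x. (\<integral>y. F (x(n := y)) \<partial>M) \<partial>iid M n)"
    and iid_integral_Suc_rev: "(\<integral>x. F x \<partial>iid M (Suc n)) = (\<integral>y. (\<integral>x. F (x(n := y)) \<partial>iid M n) \<partial>M)"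
proof -
  interpret M: prob_space M by (rule M)
  interpret I: prob_space "iid M n" by (rule prob_space_iid[OF M])
  interpret S: prob_space "iid M (Suc n)" by (rule prob_space_iid[OF M])
  interpret P: pair_prob_space "iid M n" M ..
  interpret PM: product_sigma_finite "\<lambda>_. M" by standard
  have 1: "bmf (iid M n \<Otimes>\<^sub>M M) (\<lambda>(x, y). F (x(n := y)))"
    using bmf_compose[OF F measurable_iid_update] by (simp add: case_prod_unfold)
  show 2: "bmf M (\<lambda>y. F (x(n := y)))" if "x \<in> space (iid M n)" for x
    using bmf_compose[OF 1 measurable_Pair1'[OF that]] by simp
  show 3: "bmf (iid M n) (\<lambda>x. F (x(n := y)))" if "y \<in> space M" for y
    using bmf_compose[OF 1 measurable_Pair2'[OF that]] by simp
  obtain C where C: "\<And>x. x \<in> space (iid M (Suc n)) \<Longrightarrow> \<bar>F x\<bar> \<le> C" using F by (auto simp: bmf_def)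
  show "bmf (iid M n) (\<lambda>x. \<integral>y. F (x(n := y)) \<partial>M)"
  proof (rule bmfI[where C = C])
    show "(\<lambda>x. \<integral>y. F (x(n := y)) \<partial>M) \<in> borel_measurable (iid M n)"
      using bmf_measurable[OF 1] by (rule M.borel_measurable_lebesgue_integral)
  qed (intro M.abs_integral_le M.bmf_integrable 2 C space_iid_update)
  have sw: "(\<lambda>(y, x). F (x(n := y))) \<in> borel_measurable (M \<Otimes>\<^sub>M iid M n)"
    using measurable_compose[OF measurable_pair_swap' bmf_measurable[OF 1]] by (simp add: case_prod_unfold)
  show "bmf M (\<lambda>y. \<integral>x. F (x(n := y)) \<partial>iid M n)"
  proof (rule bmfI[where C = C])
    show "(\<lambda>y. \<integral>x. F (x(n := y)) \<partial>iid M n) \<in> borel_measurable M"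
      using sw by (rule I.borel_measurable_lebesgue_integral)
  qed (intro I.abs_integral_le I.bmf_integrable 3 C space_iid_update)
  show A: "(\<integral>x. F x \<partial>iid M (Suc n)) = (\<integral>x. (\<integral>y. F (x(n := y)) \<partial>M) \<partial>iid M n)"
    unfolding lessThan_Suc
    by (rule PM.product_integral_insert) (use S.bmf_integrable[OF F] in \<open>auto simp: lessThan_Suc\<close>)
  show "(\<integral>x. F x \<partial>iid M (Suc n)) = (\<integral>y. (\<integral>x. F (x(n := y)) \<partial>iid M n) \<partial>M)"
    unfolding A by (rule P.Fubini_integral[symmetric]) (use P.P.bmf_integrable[OF 1] in simp)
qed

section \<open>Symmetrization\<close>

text \<open>No ghost sample is needed for one coordinate. The term \<open>A g + g y - E g\<close> is
  the mean of \<open>A g + 2 * g y\<close> and \<open>A g - 2 * E g\<close>; the first is at most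
  \<open>S1 y\<close>, and the second is an integral of \<open>A g - 2 * g x\<close>, hence at most
  the integral of \<open>S2\<close>.\<close>

lemma symmetrization_step:
  fixes A :: "('a \<Rightarrow> real) \<Rightarrow> real"
  assumes M: "prob_space M" and F: "finite F" "F \<noteq> {}" and f: "\<And>f. f \<in> F \<Longrightarrow> bmf M f"
  shows "(\<integral>y. (SUP f\<in>F. A f + (f y - (\<integral>x. f x \<partial>M))) \<partial>M)
    \<le> (\<integral>y. ((SUP f\<in>F. A f + 2 * f y) + (SUP f\<in>F. A f - 2 * f y)) / 2 \<partial>M)"
proof -
  interpret prob_space M by (rule M)
  define S1 where "S1 y = (SUP f\<in>F. A f + 2 * f y)" for y
  define S2 where "S2 y = (SUP f\<in>F. A f - 2 * f y)" for y
  have b1: "bmf M S1" unfolding S1_def[abs_def] by (intro bmf_SUP F bmf_add bmf_const bmf_cmult f)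
  have b2: "bmf M S2" unfolding S2_def[abs_def] by (intro bmf_SUP F bmf_diff bmf_const bmf_cmult f)
  have b0: "bmf M (\<lambda>y. SUP f\<in>F. A f + (f y - (\<integral>x. f x \<partial>M)))"
    by (intro bmf_SUP F bmf_add bmf_diff bmf_const f)
  have u1: "A f + 2 * f y \<le> S1 y" and u2: "A f - 2 * f y \<le> S2 y" if "f \<in> F" for f y
    unfolding S1_def S2_def using F by (auto intro!: cSUP_upper that)
  have "(\<integral>y. (SUP f\<in>F. A f + (f y - (\<integral>x. f x \<partial>M))) \<partial>M) \<le> (\<integral>y. (S1 y + (\<integral>x. S2 x \<partial>M)) / 2 \<partial>M)"
  proof (rule integral_mono)
    show "integrable M (\<lambda>y. SUP f\<in>F. A f + (f y - (\<integral>x. f x \<partial>M)))" by (rule bmf_integrable[OF b0])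
    show "integrable M (\<lambda>y. (S1 y + (\<integral>x. S2 x \<partial>M)) / 2)"
      using bmf_integrable[OF b1] by simp
    fix y
    show "(SUP f\<in>F. A f + (f y - (\<integral>x. f x \<partial>M))) \<le> (S1 y + (\<integral>x. S2 x \<partial>M)) / 2"
    proof (rule cSUP_least[OF F(2)])
      fix g assume g: "g \<in> F"
      have "A g - 2 * (\<integral>x. g x \<partial>M) = (\<integral>x. A g - 2 * g x \<partial>M)"
        using bmf_integrable[OF f[OF g]] by (simp add: prob_space)
      also have "\<dots> \<le> (\<integral>x. S2 x \<partial>M)"
        using bmf_integrable[OF f[OF g]] bmf_integrable[OF b2] by (intro integral_mono u2 g) auto
      finally show "A g + (g y - (\<integral>x. g x \<partial>M)) \<le> (S1 y + (\<integral>x. S2 x \<partial>M)) / 2"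
        using u1[OF g, of y] by argo
    qed
  qed
  also have "\<dots> = (\<integral>y. (S1 y + S2 y) / 2 \<partial>M)"
    using bmf_integrable[OF b1] bmf_integrable[OF b2] by (simp add: prob_space)
  finally show ?thesis by (simp add: S1_def S2_def)
qed

lemma bmf_rademacher:
  assumes F: "finite F" "F \<noteq> {}" and G: "\<And>f. f \<in> F \<Longrightarrow> bmf N (G f)" and h: "\<And>i f. i < n \<Longrightarrow> f \<in> F \<Longrightarrow> bmf N (h i f)"
  shows "bmf N (\<lambda>z. rademacher F (\<lambda>f. G f z) n (\<lambda>i f. h i f z))"
  unfolding rademacher_def by (intro bmf_savg bmf_SUP F bmf_add bmf_sum bmf_cmult G h) auto

theorem symmetrization:
  fixes G :: "('a \<Rightarrow> real) \<Rightarrow> real"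
  assumes M: "prob_space M" and F: "finite F" "F \<noteq> {}" and f: "\<And>f. f \<in> F \<Longrightarrow> bmf M f"
  shows "(\<integral>z. (SUP f\<in>F. G f + (\<Sum>i<n. f (z i) - (\<integral>x. f x \<partial>M))) \<partial>iid M n)
    \<le> (\<integral>z. rademacher F G n (\<lambda>i f. 2 * f (z i)) \<partial>iid M n)"
proof (induction n arbitrary: G)
  case 0
  show ?case by (simp add: rademacher_def)
next
  case (Suc n)
  interpret M: prob_space M by (rule M)
  interpret I: prob_space "iid M n" by (rule prob_space_iid[OF M])
  interpret S: prob_space "iid M (Suc n)" by (rule prob_space_iid[OF M])
  let ?e = "\<lambda>f. \<integral>x. f x \<partial>M"
  define T where "T = (\<lambda>(z :: nat \<Rightarrow> 'a) (f :: 'a \<Rightarrow> real). \<Sum>i<n. f (z i) - ?e f)"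
  define H where "H = (\<lambda>z. ((SUP f\<in>F. G f + T z f + 2 * f (z n)) + (SUP f\<in>F. G f + T z f - 2 * f (z n))) / 2)"
  define R where "R = (\<lambda>z. rademacher F G (Suc n) (\<lambda>i f. 2 * f (z i)))"
  have bc: "bmf (iid M m) (\<lambda>z. f (z i))" if "f \<in> F" "i < m" for f i m
    by (rule bmf_iid_component[OF f[OF that(1)] that(2)])
  have bT: "bmf (iid M m) (\<lambda>z. T z f)" if "f \<in> F" "n \<le> m" for f m
    unfolding T_def using that by (intro bmf_sum bmf_diff bmf_const bc) auto
  have b0: "bmf (iid M (Suc n)) (\<lambda>z. SUP f\<in>F. G f + (\<Sum>i<Suc n. f (z i) - ?e f))"
    by (intro bmf_SUP F bmf_add bmf_const bmf_sum bmf_diff bc) auto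
  have bH: "bmf (iid M (Suc n)) H"
  proof -
    have "bmf (iid M (Suc n)) (\<lambda>z. 1 / 2 * ((SUP f\<in>F. G f + T z f + 2 * f (z n)) + (SUP f\<in>F. G f + T z f - 2 * f (z n))))"
      by (intro bmf_cmult bmf_SUP F bmf_add bmf_diff bmf_const bT bc) auto
    then show ?thesis by (simp add: H_def)
  qed
  have bR: "bmf (iid M (Suc n)) R"
    unfolding R_def by (intro bmf_rademacher F bmf_const bmf_cmult bc) auto
  have Tu: "T (z(n := y)) f = T z f" for z y f
    unfolding T_def by (intro sum.cong) auto
  have "(\<integral>z. (SUP f\<in>F. G f + (\<Sum>i<Suc n. f (z i) - ?e f)) \<partial>iid M (Suc n))
      = (\<integral>z. (\<integral>y. (SUP f\<in>F. G f + T z f + (f y - ?e f)) \<partial>M) \<partial>iid M n)"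
    unfolding iid_integral_Suc[OF M b0]
  proof (intro Bochner_Integration.integral_cong refl)
    fix z y
    have "G f + (\<Sum>i<Suc n. f ((z(n := y)) i) - ?e f) = G f + T z f + (f y - ?e f)" for f
      using Tu[of z y f] by (simp add: T_def)
    then show "(SUP f\<in>F. G f + (\<Sum>i<Suc n. f ((z(n := y)) i) - ?e f)) = (SUP f\<in>F. G f + T z f + (f y - ?e f))"
      by (simp only:)
  qed
  also have "\<dots> \<le> (\<integral>z. (\<integral>y. H (z(n := y)) \<partial>M) \<partial>iid M n)"
  proof (rule integral_mono)
    show "integrable (iid M n) (\<lambda>z. \<integral>y. H (z(n := y)) \<partial>M)"
      by (intro I.bmf_integrable bmf_iid_integral_last M bH)
    have eq: "(SUP f\<in>F. G f + T z f + (f y - ?e f)) = (SUP f\<in>F. G f + (\<Sum>i<Suc n. f ((z(n := y)) i) - ?e f))" for z y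
      using Tu[of z y] by (simp add: T_def add.assoc)
    show "integrable (iid M n) (\<lambda>z. \<integral>y. (SUP f\<in>F. G f + T z f + (f y - ?e f)) \<partial>M)"
      unfolding eq by (intro I.bmf_integrable bmf_iid_integral_last[OF M b0])
    fix z
    show "(\<integral>y. (SUP f\<in>F. G f + T z f + (f y - ?e f)) \<partial>M) \<le> (\<integral>y. H (z(n := y)) \<partial>M)"
      using symmetrization_step[OF M F f, of "\<lambda>f. G f + T z f"] by (simp add: H_def Tu)
  qed
  \<comment> \<open>The last coordinate now carries a sign. Exchanging the integrals freezes it, so
    the induction hypothesis applies to the first \<open>n\<close> coordinates with the offsets
    \<open>G f + 2 * f y\<close> and \<open>G f - 2 * f y\<close>.\<close>
  also have "\<dots> = (\<integral>y. (\<integral>z. H (z(n := y)) \<partial>iid M n) \<partial>M)"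
    unfolding iid_integral_Suc[OF M bH, symmetric] by (rule iid_integral_Suc_rev[OF M bH])
  also have "\<dots> \<le> (\<integral>y. (\<integral>z. R (z(n := y)) \<partial>iid M n) \<partial>M)"
  proof (rule integral_mono)
    show "integrable M (\<lambda>y. \<integral>z. H (z(n := y)) \<partial>iid M n)"
      by (intro M.bmf_integrable bmf_iid_integral_init M bH)
    show "integrable M (\<lambda>y. \<integral>z. R (z(n := y)) \<partial>iid M n)"
      by (intro M.bmf_integrable bmf_iid_integral_init M bR)
    fix y assume y: "y \<in> space M"
    let ?S = "\<lambda>c z. SUP f\<in>F. (G f + c * f y) + T z f"
    let ?R = "\<lambda>c z. rademacher F (\<lambda>f. G f + c * f y) n (\<lambda>i f. 2 * f (z i))"
    have iS: "integrable (iid M n) (?S c)" for c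
      by (intro I.bmf_integrable bmf_SUP F bmf_add bmf_const bT) auto
    have iR: "integrable (iid M n) (?R c)" for c
      by (intro I.bmf_integrable bmf_rademacher F bmf_const bmf_cmult bc) auto
    have "(\<integral>z. H (z(n := y)) \<partial>iid M n) = (\<integral>z. (?S 2 z + ?S (- 2) z) / 2 \<partial>iid M n)"
      by (simp add: H_def Tu algebra_simps)
    also have "\<dots> = ((\<integral>z. ?S 2 z \<partial>iid M n) + (\<integral>z. ?S (- 2) z \<partial>iid M n)) / 2"
      using iS[of 2] iS[of "- 2"] by simp
    also have "\<dots> \<le> ((\<integral>z. ?R 2 z \<partial>iid M n) + (\<integral>z. ?R (- 2) z \<partial>iid M n)) / 2"
      using Suc.IH[of "\<lambda>f. G f + 2 * f y"] Suc.IH[of "\<lambda>f. G f + (- 2) * f y"] unfolding T_def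
      by (intro divide_right_mono add_mono) auto
    also have "\<dots> = (\<integral>z. (?R 2 z + ?R (- 2) z) / 2 \<partial>iid M n)"
      using iR[of 2] iR[of "- 2"] by simp
    also have "\<dots> = (\<integral>z. R (z(n := y)) \<partial>iid M n)"
    proof (intro Bochner_Integration.integral_cong refl)
      fix z
      have "rademacher F G' n (\<lambda>i f. 2 * f ((z(n := y)) i)) = rademacher F G' n (\<lambda>i f. 2 * f (z i))" for G'
        unfolding rademacher_def
        by (intro savg_cong SUP_cong refl arg_cong2[where f = "(+)"] sum.cong) auto
      then show "(?R 2 z + ?R (- 2) z) / 2 = R (z(n := y))"
        unfolding R_def rademacher_Suc by simp
    qed
    finally show "(\<integral>z. H (z(n := y)) \<partial>iid M n) \<le> (\<integral>z. R (z(n := y)) \<partial>iid M n)" .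
  qed
  also have "\<dots> = (\<integral>z. R z \<partial>iid M (Suc n))"
    by (rule iid_integral_Suc_rev[OF M bR, symmetric])
  finally show ?case unfolding R_def .
qed

section \<open>Concentration of functions with bounded differences\<close>

text \<open>The enclosing interval is centred at one value \<open>f x0\<close> and has length
  \<open>2 * c\<close>, which avoids the infimum and supremum of \<open>f\<close> and gives the
  constant 1/2 in place of 1/8.\<close>

lemma (in prob_space) hoeffding_lemma_oscillation:
  assumes f: "f \<in> borel_measurable M" and osc: "\<And>x y. x \<in> space M \<Longrightarrow> y \<in> space M \<Longrightarrow> \<bar>f x - f y\<bar> \<le> c"
    and s: "0 < s"
  shows "(\<integral>\<^sup>+x. ennreal (exp (s * (f x - expectation f))) \<partial>M) \<le> ennreal (exp (s\<^sup>2 * c\<^sup>2 / 2))"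
proof -
  obtain x0 where x0: "x0 \<in> space M" using not_empty by blast
  interpret interval_bounded_random_variable M f "f x0 - c" "f x0 + c"
  proof
    show "AE x in M. f x \<in> {f x0 - c..f x0 + c}"
    proof (rule AE_I2)
      fix x assume "x \<in> space M"
      from osc[OF this x0] show "f x \<in> {f x0 - c..f x0 + c}" by (auto simp: abs_le_iff)
    qed
  qed (rule f)
  have "(s\<^sup>2 * (f x0 + c - (f x0 - c))\<^sup>2) / 8 = s\<^sup>2 * c\<^sup>2 / 2"
    by (simp add: power2_eq_square)
  then show ?thesis using Hoeffdings_lemma_nn_integral[OF s] by (simp add: mult.commute)
qed

text \<open>McDiarmid's argument by induction: integrating out the last coordinate gives
  \<open>h\<close>, which keeps bounded differences, and the fluctuation of \<open>g\<close> around
  \<open>h\<close> is handled section by section by Hoeffding's lemma.\<close>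

lemma bounded_differences_mgf:
  assumes M: "prob_space M" and g: "bmf (iid M n) g"
    and bd: "\<And>x i y. x \<in> space (iid M n) \<Longrightarrow> i < n \<Longrightarrow> y \<in> space M \<Longrightarrow> \<bar>g (x(i := y)) - g x\<bar> \<le> c"
    and s: "0 < s"
  shows "(\<integral>\<^sup>+x. ennreal (exp (s * (g x - (\<integral>x. g x \<partial>iid M n)))) \<partial>iid M n) \<le> ennreal (exp (real n * (s\<^sup>2 * c\<^sup>2 / 2)))"
  using g bd
proof (induction n arbitrary: g)
  case 0
  show ?case by (simp add: PiM_empty nn_integral_count_space_finite lebesgue_integral_count_space_finite)
next
  case (Suc n)
  interpret M: prob_space M by (rule M)
  interpret I: prob_space "iid M n" by (rule prob_space_iid[OF M])
  interpret PM: product_sigma_finite "\<lambda>_. M" by standard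
  define h where "h = (\<lambda>x. \<integral>y. g (x(n := y)) \<partial>M)"
  define E where "E = (\<integral>x. g x \<partial>iid M (Suc n))"
  have h: "bmf (iid M n) h" unfolding h_def by (rule bmf_iid_integral_last[OF M Suc.prems(1)])
  have Eh: "E = (\<integral>x. h x \<partial>iid M n)" unfolding E_def h_def by (rule iid_integral_Suc[OF M Suc.prems(1)])
  have sec: "bmf M (\<lambda>y. g (x(n := y)))" if "x \<in> space (iid M n)" for x
    by (rule bmf_iid_section_last[OF M Suc.prems(1) that])
  have gm[measurable]: "g \<in> borel_measurable (iid M (Suc n))" by (rule bmf_measurable[OF Suc.prems(1)])
  have upd: "x(i := y) \<in> space (iid M m)" if "x \<in> space (iid M m)" "i < m" "y \<in> space M" for x i y m
    using that by (auto simp: space_PiM PiE_def extensional_def Pi_def)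
  have hbd: "\<bar>h (x(i := y)) - h x\<bar> \<le> c" if x: "x \<in> space (iid M n)" and i: "i < n" and y: "y \<in> space M" for x i y
  proof -
    have x': "x(i := y) \<in> space (iid M n)" by (rule upd[OF x i y])
    have "h (x(i := y)) - h x = (\<integral>v. g ((x(i := y))(n := v)) - g (x(n := v)) \<partial>M)"
      unfolding h_def using M.bmf_integrable[OF sec[OF x]] M.bmf_integrable[OF sec[OF x']] by simp
    also have "\<bar>\<dots>\<bar> \<le> c"
    proof (rule M.abs_integral_le)
      show "integrable M (\<lambda>v. g ((x(i := y))(n := v)) - g (x(n := v)))"
        using M.bmf_integrable[OF sec[OF x]] M.bmf_integrable[OF sec[OF x']] by simp
      fix v assume v: "v \<in> space M"
      have eq: "(x(i := y))(n := v) = (x(n := v))(i := y)" using i by (intro fun_upd_twist) auto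
      show "\<bar>g ((x(i := y))(n := v)) - g (x(n := v))\<bar> \<le> c"
        unfolding eq by (rule Suc.prems(2)[OF space_iid_update[OF x v] _ y]) (use i in simp)
    qed
    finally show ?thesis .
  qed
  have "(\<integral>\<^sup>+x. ennreal (exp (s * (g x - E))) \<partial>iid M (Suc n))
      = (\<integral>\<^sup>+x. (\<integral>\<^sup>+y. ennreal (exp (s * (g (x(n := y)) - E))) \<partial>M) \<partial>iid M n)"
    unfolding lessThan_Suc
    by (subst PM.product_nn_integral_insert) (use gm in \<open>auto simp: lessThan_Suc\<close>)
  also have "\<dots> \<le> (\<integral>\<^sup>+x. ennreal (exp (s\<^sup>2 * c\<^sup>2 / 2)) * ennreal (exp (s * (h x - E))) \<partial>iid M n)"
  proof (rule nn_integral_mono)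
    fix x assume x: "x \<in> space (iid M n)"
    have m[measurable]: "(\<lambda>y. g (x(n := y))) \<in> borel_measurable M" by (rule bmf_measurable[OF sec[OF x]])
    have "(\<integral>\<^sup>+y. ennreal (exp (s * (g (x(n := y)) - E))) \<partial>M)
      = (\<integral>\<^sup>+y. ennreal (exp (s * (g (x(n := y)) - h x))) * ennreal (exp (s * (h x - E))) \<partial>M)"
      by (intro nn_integral_cong) (simp add: ennreal_mult'[symmetric] exp_add[symmetric] algebra_simps)
    also have "\<dots> = (\<integral>\<^sup>+y. ennreal (exp (s * (g (x(n := y)) - h x))) \<partial>M) * ennreal (exp (s * (h x - E)))"
      by (rule nn_integral_multc) simp
    also have "\<dots> \<le> ennreal (exp (s\<^sup>2 * c\<^sup>2 / 2)) * ennreal (exp (s * (h x - E)))"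
    proof (rule mult_right_mono)
      show "(\<integral>\<^sup>+y. ennreal (exp (s * (g (x(n := y)) - h x))) \<partial>M) \<le> ennreal (exp (s\<^sup>2 * c\<^sup>2 / 2))"
        unfolding h_def
      proof (rule M.hoeffding_lemma_oscillation[OF m _ s])
        fix u v assume uv: "u \<in> space M" "v \<in> space M"
        show "\<bar>g (x(n := u)) - g (x(n := v))\<bar> \<le> c"
          using Suc.prems(2)[OF space_iid_update[OF x uv(2)] _ uv(1), of n] unfolding fun_upd_upd by blast
      qed
    qed simp
    finally show "(\<integral>\<^sup>+y. ennreal (exp (s * (g (x(n := y)) - E))) \<partial>M)
      \<le> ennreal (exp (s\<^sup>2 * c\<^sup>2 / 2)) * ennreal (exp (s * (h x - E)))" .
  qed
  also have "\<dots> = ennreal (exp (s\<^sup>2 * c\<^sup>2 / 2)) * (\<integral>\<^sup>+x. ennreal (exp (s * (h x - E))) \<partial>iid M n)"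
    using bmf_measurable[OF h] by (intro nn_integral_cmult) auto
  also have "\<dots> \<le> ennreal (exp (s\<^sup>2 * c\<^sup>2 / 2)) * ennreal (exp (real n * (s\<^sup>2 * c\<^sup>2 / 2)))"
    unfolding Eh by (intro mult_left_mono Suc.IH[OF h hbd]) auto
  also have "\<dots> = ennreal (exp (real (Suc n) * (s\<^sup>2 * c\<^sup>2 / 2)))"
    by (simp add: ennreal_mult'[symmetric] exp_add[symmetric] algebra_simps)
  finally show ?case unfolding E_def .
qed

theorem bounded_differences_tail:
  assumes M: "prob_space M" and g: "bmf (iid M n) g"
    and bd: "\<And>x i y. x \<in> space (iid M n) \<Longrightarrow> i < n \<Longrightarrow> y \<in> space M \<Longrightarrow> \<bar>g (x(i := y)) - g x\<bar> \<le> 2"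
    and n: "0 < n" and u: "0 < u"
  shows "measure (iid M n) {x \<in> space (iid M n). (\<integral>x. g x \<partial>iid M n) + u \<le> g x} \<le> exp (- u\<^sup>2 / (8 * real n))"
proof -
  interpret I: prob_space "iid M n" by (rule prob_space_iid[OF M])
  \<comment> \<open>The minimiser of -s u + 2 n s^2, the exponent obtained from differences at most
    2.\<close>
  define s where "s = u / (4 * real n)"
  have s: "0 < s" using n u by (simp add: s_def)
  define e where "e = (\<integral>x. g x \<partial>iid M n)"
  have gm[measurable]: "g \<in> borel_measurable (iid M n)" by (rule bmf_measurable[OF g])
  have "ennreal (measure (iid M n) {x \<in> space (iid M n). u \<le> g x - e})
      = emeasure (iid M n) {x \<in> space (iid M n). u \<le> g x - e}"
    by (simp add: I.emeasure_eq_measure)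
  also have "\<dots> \<le> ennreal (exp (- s * u)) * (\<integral>\<^sup>+x. ennreal (exp (s * (g x - e))) * indicator (space (iid M n)) x \<partial>iid M n)"
    by (rule Chernoff_ineq_nn_integral_ge[OF s]) auto
  also have "(\<integral>\<^sup>+x. ennreal (exp (s * (g x - e))) * indicator (space (iid M n)) x \<partial>iid M n)
      = (\<integral>\<^sup>+x. ennreal (exp (s * (g x - e))) \<partial>iid M n)"
    by (intro nn_integral_cong) auto
  also have "ennreal (exp (- s * u)) * \<dots> \<le> ennreal (exp (- s * u)) * ennreal (exp (real n * (s\<^sup>2 * 2\<^sup>2 / 2)))"
    unfolding e_def by (intro mult_left_mono bounded_differences_mgf[OF M g bd s]) auto
  also have "\<dots> = ennreal (exp (- s * u + real n * (s\<^sup>2 * 2\<^sup>2 / 2)))"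
    by (simp only: exp_add ennreal_mult' exp_ge_zero)
  also have "- s * u + real n * (s\<^sup>2 * 2\<^sup>2 / 2) = - u\<^sup>2 / (8 * real n)"
    using n by (simp add: s_def field_simps power2_eq_square)
  finally show ?thesis
    by (subst (asm) ennreal_le_iff) (simp_all add: e_def algebra_simps)
qed

section \<open>Transfer between product measures\<close>

text \<open>The coordinates are exchanged one at a time. Averaging \<open>g\<close> over the others
  preserves its modulus \<open>d\<close> in the remaining coordinate, so each exchange costs at most
  \<open>\<kappa>\<close>.\<close>

lemma iid_transfer:
  assumes P: "prob_space P" and Q: "prob_space Q" and sets: "sets P = sets Q"
    and tr: "\<And>h. bmf Q h \<Longrightarrow> (\<And>y y'. y \<in> space Q \<Longrightarrow> y' \<in> space Q \<Longrightarrow> \<bar>h y - h y'\<bar> \<le> d y y') \<Longrightarrow>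
      (\<integral>y. h y \<partial>P) \<le> (\<integral>y. h y \<partial>Q) + \<kappa>"
    and g: "bmf (iid Q n) g"
    and lip: "\<And>x i y y'. x \<in> space (iid Q n) \<Longrightarrow> i < n \<Longrightarrow> y \<in> space Q \<Longrightarrow> y' \<in> space Q \<Longrightarrow>
      \<bar>g (x(i := y)) - g (x(i := y'))\<bar> \<le> d y y'"
  shows "(\<integral>x. g x \<partial>iid P n) \<le> (\<integral>x. g x \<partial>iid Q n) + real n * \<kappa>"
  using g lip
proof (induction n arbitrary: g)
  case 0
  show ?case by (simp add: PiM_empty lebesgue_integral_count_space_finite)
next
  case (Suc n)
  interpret P: prob_space P by (rule P)
  interpret Q: prob_space Q by (rule Q)
  interpret QI: prob_space "iid Q n" by (rule prob_space_iid[OF Q])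
  have sp: "space P = space Q" using sets by (rule sets_eq_imp_space_eq)
  have bmf_iff: "bmf P h \<longleftrightarrow> bmf Q h" for h :: "'a \<Rightarrow> real"
    unfolding bmf_def sp by (simp add: measurable_cong_sets[OF sets refl])
  have si: "sets (iid P m) = sets (iid Q m)" for m by (intro sets_PiM_cong sets refl)
  have bmf_iid_iff: "bmf (iid P m) h \<longleftrightarrow> bmf (iid Q m) h" for m and h :: "(nat \<Rightarrow> 'a) \<Rightarrow> real"
    unfolding bmf_def sets_eq_imp_space_eq[OF si] by (simp add: measurable_cong_sets[OF si refl])
  have gP: "bmf (iid P (Suc n)) g" using Suc.prems(1) by (simp add: bmf_iid_iff)
  define h where "h = (\<lambda>y. \<integral>x. g (x(n := y)) \<partial>iid Q n)"
  have h: "bmf Q h" unfolding h_def by (rule bmf_iid_integral_init[OF Q Suc.prems(1)])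
  have sec: "bmf (iid Q n) (\<lambda>x. g (x(n := y)))" if "y \<in> space Q" for y
    by (rule bmf_iid_section_init[OF Q Suc.prems(1) that])
  have "(\<integral>x. g x \<partial>iid P (Suc n)) = (\<integral>y. (\<integral>x. g (x(n := y)) \<partial>iid P n) \<partial>P)"
    by (rule iid_integral_Suc_rev[OF P gP])
  also have "\<dots> \<le> (\<integral>y. h y + real n * \<kappa> \<partial>P)"
  proof (rule integral_mono)
    show "integrable P (\<lambda>y. \<integral>x. g (x(n := y)) \<partial>iid P n)"
      by (intro P.bmf_integrable bmf_iid_integral_init P gP)
    show "integrable P (\<lambda>y. h y + real n * \<kappa>)"
      using P.bmf_integrable[of h] h bmf_iff by simp
    fix y assume "y \<in> space P"
    then have y: "y \<in> space Q" by (simp add: sp)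
    show "(\<integral>x. g (x(n := y)) \<partial>iid P n) \<le> h y + real n * \<kappa>"
      unfolding h_def
    proof (rule Suc.IH[OF sec[OF y]])
      fix x i u v assume x: "x \<in> space (iid Q n)" and i: "i < n" and uv: "u \<in> space Q" "v \<in> space Q"
      have eq: "(x(i := w))(n := y) = (x(n := y))(i := w)" for w using i by (intro fun_upd_twist) auto
      show "\<bar>g ((x(i := u))(n := y)) - g ((x(i := v))(n := y))\<bar> \<le> d u v"
        unfolding eq by (rule Suc.prems(2)[OF space_iid_update[OF x y] _ uv]) (use i in simp)
    qed
  qed
  also have "\<dots> = (\<integral>y. h y \<partial>P) + real n * \<kappa>"
    using P.bmf_integrable[of h] h bmf_iff by (simp add: P.prob_space)
  also have "(\<integral>y. h y \<partial>P) \<le> (\<integral>y. h y \<partial>Q) + \<kappa>"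
  proof (rule tr[OF h])
    fix y y' assume y: "y \<in> space Q" "y' \<in> space Q"
    have "h y - h y' = (\<integral>x. g (x(n := y)) - g (x(n := y')) \<partial>iid Q n)"
      unfolding h_def using QI.bmf_integrable[OF sec[OF y(1)]] QI.bmf_integrable[OF sec[OF y(2)]] by simp
    also have "\<bar>\<dots>\<bar> \<le> d y y'"
    proof (rule QI.abs_integral_le)
      show "integrable (iid Q n) (\<lambda>x. g (x(n := y)) - g (x(n := y')))"
        using QI.bmf_integrable[OF sec[OF y(1)]] QI.bmf_integrable[OF sec[OF y(2)]] by simp
      fix x assume x: "x \<in> space (iid Q n)"
      show "\<bar>g (x(n := y)) - g (x(n := y'))\<bar> \<le> d y y'"
        using Suc.prems(2)[OF space_iid_update[OF x y(1)] _ y, of n] unfolding fun_upd_upd by blast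
    qed
    finally show "\<bar>h y - h y'\<bar> \<le> d y y'" .
  qed
  also have "(\<integral>y. h y \<partial>Q) = (\<integral>x. g x \<partial>iid Q (Suc n))"
    unfolding h_def by (rule iid_integral_Suc_rev[OF Q Suc.prems(1), symmetric])
  finally show ?case by (simp add: algebra_simps)
qed

text \<open>The easy half of Kantorovich duality. The infimum over couplings need not be known to be
  attained, so a coupling of cost below \<open>\<epsilon> + \<eta>\<close> is used.\<close>

lemma wasserstein1_transfer:
  assumes W: "wasserstein1 p P Q \<le> ennreal \<epsilon>" and \<epsilon>: "0 \<le> \<epsilon>" and \<eta>: "0 < \<eta>" and P: "prob_space P"
    and sets: "sets P = sets (Rp p)" "sets Q = sets (Rp p)"
    and h: "bmf Q h" and c: "0 \<le> c"
    and lip: "\<And>y y'. y \<in> space Q \<Longrightarrow> y' \<in> space Q \<Longrightarrow> \<bar>h y - h y'\<bar> \<le> c * enorm p (\<lambda>i. y i - y' i)"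
  shows "(\<integral>y. h y \<partial>P) \<le> (\<integral>y. h y \<partial>Q) + c * (\<epsilon> + \<eta>)"
proof -
  have "wasserstein1 p P Q < ennreal (\<epsilon> + \<eta>)"
    using W \<epsilon> \<eta> by (intro le_less_trans[OF W]) (simp add: ennreal_less_iff)
  then obtain \<pi> where \<pi>: "\<pi> \<in> couplings p P Q"
    and cost: "(\<integral>\<^sup>+ z. ennreal (enorm p (\<lambda>i. fst z i - snd z i)) \<partial>\<pi>) < ennreal (\<epsilon> + \<eta>)"
    unfolding wasserstein1_def by (auto simp: INF_less_iff)
  have s\<pi>: "sets \<pi> = sets (Rp p \<Otimes>\<^sub>M Rp p)" and dP: "distr \<pi> (Rp p) fst = P" and dQ: "distr \<pi> (Rp p) snd = Q"
    using \<pi> by (auto simp: couplings_def)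
  have sp: "space P = space (Rp p)" "space Q = space (Rp p)" "space \<pi> = space (Rp p) \<times> space (Rp p)"
    using sets_eq_imp_space_eq[OF sets(1)] sets_eq_imp_space_eq[OF sets(2)] sets_eq_imp_space_eq[OF s\<pi>]
    by (auto simp: space_pair_measure)
  have m: "fst \<in> measurable \<pi> (Rp p)" "snd \<in> measurable \<pi> (Rp p)"
    by (simp_all add: measurable_cong_sets[OF s\<pi> refl])
  have hm: "h \<in> borel_measurable (Rp p)"
    using bmf_measurable[OF h] by (simp add: measurable_cong_sets[OF sets(2) refl])
  have "prob_space \<pi>"
  proof
    have "fst -` space (Rp p) \<inter> space \<pi> = space \<pi>" by (auto simp: sp)
    then have "emeasure \<pi> (space \<pi>) = emeasure (distr \<pi> (Rp p) fst) (space (Rp p))"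
      using m by (simp add: emeasure_distr)
    then show "emeasure \<pi> (space \<pi>) = 1"
      using prob_space.emeasure_space_1[OF P] by (simp add: dP sp)
  qed
  then interpret prob_space \<pi> .
  have b\<pi>: "bmf \<pi> (\<lambda>z. h (fst z))" "bmf \<pi> (\<lambda>z. h (snd z))"
  proof -
    have b: "bmf (Rp p) h" using h by (simp add: bmf_def sp hm)
    show "bmf \<pi> (\<lambda>z. h (fst z))" by (rule bmf_compose[OF b m(1)])
    show "bmf \<pi> (\<lambda>z. h (snd z))" by (rule bmf_compose[OF b m(2)])
  qed
  have em: "(\<lambda>z. enorm p (\<lambda>i. fst z i - snd z i)) \<in> borel_measurable \<pi>"
    unfolding enorm_def measurable_cong_sets[OF s\<pi> refl] Rp_def by measurable
  have ei: "integrable \<pi> (\<lambda>z. enorm p (\<lambda>i. fst z i - snd z i))"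
    using em cost enorm_nonneg by (intro integrableI_nonneg) (auto intro: order.strict_trans ennreal_less_top)
  have ele: "(\<integral>z. enorm p (\<lambda>i. fst z i - snd z i) \<partial>\<pi>) \<le> \<epsilon> + \<eta>"
  proof -
    have "ennreal (\<integral>z. enorm p (\<lambda>i. fst z i - snd z i) \<partial>\<pi>) = (\<integral>\<^sup>+ z. ennreal (enorm p (\<lambda>i. fst z i - snd z i)) \<partial>\<pi>)"
      by (rule nn_integral_eq_integral[symmetric, OF ei]) (simp add: enorm_nonneg)
    also have "\<dots> \<le> ennreal (\<epsilon> + \<eta>)" using cost by simp
    finally show ?thesis by (subst (asm) ennreal_le_iff) (use \<epsilon> \<eta> in auto)
  qed
  have "(\<integral>y. h y \<partial>P) - (\<integral>y. h y \<partial>Q) = (\<integral>z. h (fst z) \<partial>\<pi>) - (\<integral>z. h (snd z) \<partial>\<pi>)"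
    using integral_distr[OF m(1) hm] integral_distr[OF m(2) hm] by (simp add: dP dQ)
  also have "\<dots> = (\<integral>z. h (fst z) - h (snd z) \<partial>\<pi>)"
    using bmf_integrable[OF b\<pi>(1)] bmf_integrable[OF b\<pi>(2)] by simp
  also have "\<dots> \<le> (\<integral>z. c * enorm p (\<lambda>i. fst z i - snd z i) \<partial>\<pi>)"
  proof (rule integral_mono)
    show "integrable \<pi> (\<lambda>z. h (fst z) - h (snd z))"
      using bmf_integrable[OF b\<pi>(1)] bmf_integrable[OF b\<pi>(2)] by simp
    show "integrable \<pi> (\<lambda>z. c * enorm p (\<lambda>i. fst z i - snd z i))" using ei by simp
    fix z assume "z \<in> space \<pi>"
    then show "h (fst z) - h (snd z) \<le> c * enorm p (\<lambda>i. fst z i - snd z i)"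
      using lip[of "fst z" "snd z"] by (auto simp: sp)
  qed
  also have "\<dots> \<le> c * (\<epsilon> + \<eta>)" using ele c ei by (auto intro: mult_left_mono)
  finally show ?thesis by simp
qed

section \<open>Gaussian product measures\<close>

abbreviation normal1 :: "real \<Rightarrow> real measure" where
  "normal1 m \<equiv> density lborel (normal_density m 1)"

lemma prob_space_normal1: "prob_space (normal1 m)"
  by (rule prob_space_normal_density) simp

lemma measure_normal1_UNIV: "measure (normal1 m) UNIV = 1"
  using prob_space.prob_space[OF prob_space_normal1, of m] by simp

lemma prob_space_gauss: "prob_space (gauss p \<theta>)"
  unfolding gauss_def by (rule prob_space_PiM) (rule prob_space_normal1)

lemma sets_gauss: "sets (gauss p \<theta>) = sets (Rp p)"
  unfolding gauss_def Rp_def by (rule sets_PiM_cong) auto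

lemma space_gauss: "space (gauss p \<theta>) = space (Rp p)"
  by (rule sets_eq_imp_space_eq[OF sets_gauss])

lemma measurable_gauss_iff: "f \<in> borel_measurable (gauss p \<theta>) \<longleftrightarrow> f \<in> borel_measurable (Rp p)"
  by (simp add: measurable_cong_sets[OF sets_gauss refl])

lemma distr_gauss_component:
  assumes "i < p"
  shows "distr (gauss p \<theta>) borel (\<lambda>x. x i) = normal1 (\<theta> i)"
proof -
  have "distr (gauss p \<theta>) borel (\<lambda>x. x i) = distr (gauss p \<theta>) (normal1 (\<theta> i)) (\<lambda>x. x i)"
    by (rule distr_cong) auto
  then show ?thesis
    unfolding gauss_def using distr_PiM_component[of "{..<p}" "\<lambda>i. normal1 (\<theta> i)" i] assms prob_space_normal1
    by simp
qed

lemma measurable_gauss_component: "i < p \<Longrightarrow> (\<lambda>x. x i) \<in> borel_measurable (gauss p \<theta>)"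
  unfolding measurable_gauss_iff Rp_def by (rule measurable_component_singleton) simp

lemma distributed_gauss_component:
  assumes "i < p"
  shows "distributed (gauss p \<theta>) lborel (\<lambda>x. x i) (normal_density (\<theta> i) 1)"
proof -
  have "distr (gauss p \<theta>) lborel (\<lambda>x. x i) = distr (gauss p \<theta>) borel (\<lambda>x. x i)"
    by (rule distr_cong) auto
  then show ?thesis
    unfolding distributed_def using distr_gauss_component[OF assms] measurable_gauss_component[OF assms]
    by (simp add: measurable_lborel1)
qed

lemma gauss_moment:
  assumes i: "i < p"
  shows "integrable (gauss p \<theta>) (\<lambda>x. (x i - \<theta> i) ^ k)"
    and "(\<integral>x. (x i - \<theta> i) ^ (2 * m) \<partial>gauss p \<theta>) = fact (2 * m) / (2 ^ m * fact m)"
proof -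
  interpret prob_space "gauss p \<theta>" by (rule prob_space_gauss)
  note D = distributed_gauss_component[OF i, of \<theta>]
  show "integrable (gauss p \<theta>) (\<lambda>x. (x i - \<theta> i) ^ k)"
    using distributed_integrable[OF D, of "\<lambda>y. (y - \<theta> i) ^ k"] integrable_normal_moment[of 1 "\<theta> i" k] by simp
  show "(\<integral>x. (x i - \<theta> i) ^ (2 * m) \<partial>gauss p \<theta>) = fact (2 * m) / (2 ^ m * fact m)"
    using distributed_integral[OF D, of "\<lambda>y. (y - \<theta> i) ^ (2 * m)"] integral_normal_moment_even[of 1 "\<theta> i" m] by simp
qed

lemma gauss_enorm_power2:
  "integrable (gauss p \<theta>) (\<lambda>x. (enorm p (\<lambda>i. x i - \<theta> i))\<^sup>2)"
  "(\<integral>x. (enorm p (\<lambda>i. x i - \<theta> i))\<^sup>2 \<partial>gauss p \<theta>) = real p"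
proof -
  show "integrable (gauss p \<theta>) (\<lambda>x. (enorm p (\<lambda>i. x i - \<theta> i))\<^sup>2)"
    unfolding enorm_power2 by (rule Bochner_Integration.integrable_sum) (simp add: gauss_moment)
  have "(\<integral>x. (enorm p (\<lambda>i. x i - \<theta> i))\<^sup>2 \<partial>gauss p \<theta>) = (\<Sum>i<p. \<integral>x. (x i - \<theta> i)\<^sup>2 \<partial>gauss p \<theta>)"
    unfolding enorm_power2 by (rule Bochner_Integration.integral_sum) (simp add: gauss_moment)
  also have "\<dots> = (\<Sum>i<p. 1)"
    using gauss_moment(2)[of _ p \<theta> 1] by (intro sum.cong) auto
  finally show "(\<integral>x. (enorm p (\<lambda>i. x i - \<theta> i))\<^sup>2 \<partial>gauss p \<theta>) = real p" by simp
qed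

text \<open>Cauchy-Schwarz gives (sum of a_i^2)^2 <= p * (sum of a_i^4), and the fourth moment of a
  standard normal variable is 3. Only the order p^2 matters later.\<close>

lemma gauss_enorm_power4:
  "integrable (gauss p \<theta>) (\<lambda>x. ((enorm p (\<lambda>i. x i - \<theta> i))\<^sup>2)\<^sup>2)"
  "(\<integral>x. ((enorm p (\<lambda>i. x i - \<theta> i))\<^sup>2)\<^sup>2 \<partial>gauss p \<theta>) \<le> 3 * (real p)\<^sup>2"
proof -
  have le: "((enorm p (\<lambda>i. x i - \<theta> i))\<^sup>2)\<^sup>2 \<le> (\<Sum>i<p. (x i - \<theta> i) ^ 4) * real p" for x
    unfolding enorm_power2 using sum_squared_le_sum_of_squares[of "\<lambda>i. (x i - \<theta> i)\<^sup>2" "{..<p}"]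
    by (simp flip: power_mult)
  have i4: "integrable (gauss p \<theta>) (\<lambda>x. (\<Sum>i<p. (x i - \<theta> i) ^ 4) * real p)"
    by (intro integrable_mult_left Bochner_Integration.integrable_sum) (simp add: gauss_moment)
  show i: "integrable (gauss p \<theta>) (\<lambda>x. ((enorm p (\<lambda>i. x i - \<theta> i))\<^sup>2)\<^sup>2)"
  proof (rule Bochner_Integration.integrable_bound[OF i4])
    show "(\<lambda>x. ((enorm p (\<lambda>i. x i - \<theta> i))\<^sup>2)\<^sup>2) \<in> borel_measurable (gauss p \<theta>)"
      using borel_measurable_integrable[OF gauss_enorm_power2(1)[of p \<theta>]] by (rule borel_measurable_power)
    have "norm (((enorm p (\<lambda>i. x i - \<theta> i))\<^sup>2)\<^sup>2) \<le> norm ((\<Sum>i<p. (x i - \<theta> i) ^ 4) * real p)" for x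
      using le[of x] by (simp add: abs_mult sum_nonneg)
    then show "AE x in gauss p \<theta>. norm (((enorm p (\<lambda>i. x i - \<theta> i))\<^sup>2)\<^sup>2) \<le> norm ((\<Sum>i<p. (x i - \<theta> i) ^ 4) * real p)"
      by simp
  qed
  have "(\<integral>x. ((enorm p (\<lambda>i. x i - \<theta> i))\<^sup>2)\<^sup>2 \<partial>gauss p \<theta>) \<le> (\<integral>x. (\<Sum>i<p. (x i - \<theta> i) ^ 4) * real p \<partial>gauss p \<theta>)"
    by (rule integral_mono[OF i i4 le])
  also have "\<dots> = (\<Sum>i<p. \<integral>x. (x i - \<theta> i) ^ 4 \<partial>gauss p \<theta>) * real p"
    by (simp add: gauss_moment)
  also have "\<dots> = (\<Sum>i<p. 3) * real p"
    using gauss_moment(2)[of _ p \<theta> 2] by (intro arg_cong2[where f = times] sum.cong refl) (simp add: fact_numeral)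
  finally show "(\<integral>x. ((enorm p (\<lambda>i. x i - \<theta> i))\<^sup>2)\<^sup>2 \<partial>gauss p \<theta>) \<le> 3 * (real p)\<^sup>2"
    by (simp add: power2_eq_square)
qed

lemma gauss_indep_components:
  assumes I: "I \<subseteq> {..<p}" "I \<noteq> {}"
  shows "prob_space.indep_vars (gauss p \<theta>) (\<lambda>_. borel) (\<lambda>i x. x i) I"
proof -
  interpret prob_space "gauss p \<theta>" by (rule prob_space_gauss)
  have ne: "{..<p} \<noteq> {}" using I by auto
  have "indep_vars (\<lambda>_. borel) (\<lambda>i x. x i) {..<p}"
  proof (subst indep_vars_iff_distr_eq_PiM'[OF ne])
    show "random_variable borel (\<lambda>x. x i)" if "i \<in> {..<p}" for i
      using that by (simp add: measurable_gauss_component)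
    have "distr (gauss p \<theta>) (\<Pi>\<^sub>M i\<in>{..<p}. borel) (\<lambda>x. \<lambda>i\<in>{..<p}. x i) = distr (gauss p \<theta>) (gauss p \<theta>) (\<lambda>x. x)"
    proof (rule distr_cong)
      show "sets (\<Pi>\<^sub>M i\<in>{..<p}. borel) = sets (gauss p \<theta>)" by (simp add: sets_gauss Rp_def)
      fix x assume "x \<in> space (gauss p \<theta>)"
      then show "(\<lambda>i\<in>{..<p}. x i) = x" unfolding gauss_def space_PiM by (auto simp: PiE_def extensional_restrict)
    qed simp
    also have "\<dots> = (\<Pi>\<^sub>M i\<in>{..<p}. normal1 (\<theta> i))" by (simp add: distr_id gauss_def)
    also have "\<dots> = (\<Pi>\<^sub>M i\<in>{..<p}. distr (gauss p \<theta>) borel (\<lambda>x. x i))"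
      by (rule PiM_cong) (simp_all add: distr_gauss_component)
    finally show "distr (gauss p \<theta>) (\<Pi>\<^sub>M i\<in>{..<p}. borel) (\<lambda>x. \<lambda>i\<in>{..<p}. x i)
      = (\<Pi>\<^sub>M i\<in>{..<p}. distr (gauss p \<theta>) borel (\<lambda>x. x i))" .
  qed
  then show ?thesis using I(1) by (rule indep_vars_subset)
qed

lemma distributed_gauss_linear:
  assumes w: "0 < enorm p w"
  shows "distributed (gauss p \<theta>) lborel (\<lambda>x. \<Sum>i<p. w i * x i) (normal_density (\<Sum>i<p. w i * \<theta> i) (enorm p w))"
proof -
  interpret prob_space "gauss p \<theta>" by (rule prob_space_gauss)
  \<comment> \<open>Coordinates of zero weight are removed because a constant has no density, while
    the rule for sums of independent normals asks for positive deviations.\<close>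
  define I where "I = {i. i < p \<and> w i \<noteq> 0}"
  have I: "I \<subseteq> {..<p}" "finite I" by (auto simp: I_def)
  have sumI: "(\<Sum>i<p. g i) = (\<Sum>i\<in>I. g i)" if "\<And>i. w i = 0 \<Longrightarrow> g i = 0" for g :: "nat \<Rightarrow> real"
    by (rule sum.mono_neutral_right) (auto simp: I_def that)
  have ne: "I \<noteq> {}"
  proof
    assume "I = {}"
    then have "enorm p w = 0" using sumI[of "\<lambda>i. (w i)\<^sup>2"] by (simp add: enorm_def)
    then show False using w by simp
  qed
  have "distributed (gauss p \<theta>) lborel (\<lambda>x. \<Sum>i\<in>I. w i * x i)
      (normal_density (\<Sum>i\<in>I. w i * \<theta> i) (sqrt (\<Sum>i\<in>I. (\<bar>w i\<bar> * 1)\<^sup>2)))"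
  proof (rule sum_indep_normal[OF I(2) ne])
    show "indep_vars (\<lambda>i. borel) (\<lambda>i x. w i * x i) I"
      using indep_vars_compose2[OF gauss_indep_components[OF I(1) ne, of \<theta>], of "\<lambda>i y. w i * y" "\<lambda>_. borel"] by simp
    fix i assume i: "i \<in> I"
    then show "0 < \<bar>w i\<bar> * 1" by (simp add: I_def)
    show "distributed (gauss p \<theta>) lborel (\<lambda>x. w i * x i) (normal_density (w i * \<theta> i) (\<bar>w i\<bar> * 1))"
      using normal_density_affine[OF distributed_gauss_component[of i p \<theta>], of "w i" 0] i by (simp add: I_def)
  qed
  then show ?thesis
    by (simp add: sumI enorm_def)
qed

section \<open>Gaussian means of a single sigmoid\<close>

definition gsig :: "real \<Rightarrow> real \<Rightarrow> real" where
  "gsig s m = (\<integral>u. sigmoid (s * u + m) \<partial>normal1 0)"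

lemma bmf_sigmoid:
  assumes "f \<in> borel_measurable M"
  shows "bmf M (\<lambda>x. sigmoid (f x))"
  by (rule bmfI[where C = 1])
    (use measurable_compose[OF assms borel_measurable_sigmoid] in
      \<open>auto simp: abs_of_pos[OF sigmoid_pos] less_imp_le[OF sigmoid_less_one]\<close>)

lemma gsig_integrable: "integrable (normal1 0) (\<lambda>u. sigmoid (s * u + m))"
  by (intro prob_space.bmf_integrable prob_space_normal1 bmf_sigmoid) simp

text \<open>A linear form of a Gaussian vector is Gaussian, so the mean of a neuron depends only on
  the norm of its weights and its argument at the centre. Everything about the test discriminators
  becomes one-dimensional. Zero weights are separate, the linear form then being constant.\<close>

lemma gauss_integral_sigmoid:
  "(\<integral>x. sigmoid ((\<Sum>i<p. w i * x i) + b) \<partial>gauss p \<theta>) = gsig (enorm p w) ((\<Sum>i<p. w i * \<theta> i) + b)"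
proof (cases "0 < enorm p w")
  case True
  interpret prob_space "gauss p \<theta>" by (rule prob_space_gauss)
  let ?s = "enorm p w" and ?m = "\<Sum>i<p. w i * \<theta> i"
  define Y where "Y = (\<lambda>x. ((\<Sum>i<p. w i * x i) - ?m) / ?s)"
  have D: "distributed (gauss p \<theta>) lborel Y std_normal_density"
    unfolding Y_def normal_standard_normal_convert[OF True, symmetric] by (rule distributed_gauss_linear[OF True])
  have Ym: "Y \<in> borel_measurable (gauss p \<theta>)" and "distr (gauss p \<theta>) lborel Y = normal1 0"
    using D by (auto simp: distributed_def)
  then have dY: "distr (gauss p \<theta>) borel Y = normal1 0"
    by (metis distr_cong sets_lborel)
  have "(\<integral>x. sigmoid ((\<Sum>i<p. w i * x i) + b) \<partial>gauss p \<theta>) = (\<integral>x. sigmoid (?s * Y x + (?m + b)) \<partial>gauss p \<theta>)"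
    using True by (simp add: Y_def)
  also have "\<dots> = (\<integral>u. sigmoid (?s * u + (?m + b)) \<partial>distr (gauss p \<theta>) borel Y)"
    by (rule integral_distr[OF Ym, symmetric]) simp
  finally show ?thesis by (simp add: dY gsig_def)
next
  case False
  then have 0: "enorm p w = 0" using enorm_nonneg[of p w] by simp
  then have "\<forall>i<p. w i = 0" by (simp add: enorm_def sum_nonneg_eq_0_iff)
  then show ?thesis
    by (simp add: gsig_def 0 prob_space.prob_space[OF prob_space_gauss] measure_normal1_UNIV)
qed

lemma gsig_mono: "m \<le> m' \<Longrightarrow> gsig s m \<le> gsig s m'"
  unfolding gsig_def by (intro integral_mono gsig_integrable sigmoid_mono) auto

lemma normal1_reflect:
  assumes [measurable]: "f \<in> borel_measurable borel"
  shows "(\<integral>u. f (- u) \<partial>normal1 0) = (\<integral>u. (f u :: real) \<partial>normal1 0)"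
proof -
  have "(\<integral>u. f u \<partial>normal1 0) = (\<integral>u. std_normal_density u * f u \<partial>lborel)"
    by (subst integral_density) auto
  also have "\<dots> = (\<integral>u. std_normal_density (- u) * f (- u) \<partial>lborel)"
    by (subst lborel_integral_real_affine[where c = "- 1" and t = 0]) auto
  also have "\<dots> = (\<integral>u. f (- u) \<partial>normal1 0)"
    by (subst integral_density) (auto simp: normal_density_def)
  finally show ?thesis by simp
qed

lemma gsig_minus: "gsig s (- m) = 1 - gsig s m"
proof -
  have "gsig s (- m) = (\<integral>u. sigmoid (- (s * (- u) + m)) \<partial>normal1 0)"
    by (simp add: gsig_def)
  also have "\<dots> = (\<integral>u. 1 - sigmoid (s * (- u) + m) \<partial>normal1 0)" by (simp only: sigmoid_minus)
  also have "\<dots> = (\<integral>u. 1 - sigmoid (s * u + m) \<partial>normal1 0)"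
    by (rule normal1_reflect) simp
  also have "\<dots> = 1 - gsig s m"
    using Bochner_Integration.integral_diff[OF _ gsig_integrable, of "\<lambda>_. 1" s m]
      prob_space.prob_space[OF prob_space_normal1, of 0] prob_space.bmf_integrable[OF prob_space_normal1 bmf_const]
    by (simp add: gsig_def)
  finally show ?thesis .
qed

lemma gsig_zero: "gsig s 0 = 1 / 2"
  using gsig_minus[of s 0] by simp

text \<open>Strict positivity is asked only away from 0, since the convexity inequality to which it
  is applied degenerates there.\<close>

lemma normal1_integral_pos:
  assumes i: "integrable (normal1 0) f" and pos: "\<And>u. u \<noteq> 0 \<Longrightarrow> 0 < f u" and nn: "0 \<le> f 0"
  shows "0 < (\<integral>u. (f u :: real) \<partial>normal1 0)"
proof -
  interpret prob_space "normal1 0" by (rule prob_space_normal1)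
  have nn': "0 \<le> f u" for u using pos[of u] nn by (cases "u = 0") auto
  have "AE u in normal1 0. u \<noteq> 0"
    using AE_lborel_singleton[of "0 :: real"] by (subst AE_density) auto
  moreover have "\<not> (AE u in normal1 0. f u = 0)" if "AE u in normal1 0. u \<noteq> 0"
  proof
    assume "AE u in normal1 0. f u = 0"
    with that have "AE u in normal1 0. False"
    proof eventually_elim
      case (elim u)
      then show ?case using pos[of u] by simp
    qed
    then show False by simp
  qed
  ultimately have "(\<integral>u. f u \<partial>normal1 0) \<noteq> 0"
    using integral_nonneg_eq_0_iff_AE[OF i] nn' by simp
  moreover have "0 \<le> (\<integral>u. f u \<partial>normal1 0)" using nn' by simp
  ultimately show ?thesis by simp
qed

text \<open>The sigmoid is not convex, but its averages over pairs symmetric about -1 still exceed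
  its value at -1. With x = exp u and E = e the difference factors into (x - 1)^2 times positive
  terms.\<close>

lemma sigmoid_strict_convexity:
  assumes "u \<noteq> 0"
  shows "2 * sigmoid (- 1) < sigmoid (u - 1) + sigmoid (- u - 1)"
proof -
  define E :: real where "E = exp 1"
  define x where "x = exp u"
  have E: "1 < E" by (simp add: E_def)
  have x: "0 < x" "x \<noteq> 1" using assms by (auto simp: x_def)
  have e: "sigmoid (- 1) = 1 / (1 + E)" "sigmoid (u - 1) = x / (x + E)" "sigmoid (- u - 1) = 1 / (1 + x * E)"
    using E x by (simp_all add: sigmoid_def E_def x_def exp_diff exp_minus exp_add field_simps)
  have "0 < E * (E - 1) * (x - 1)\<^sup>2 / ((x + E) * (1 + x * E) * (1 + E))"
    using E x by (intro divide_pos_pos mult_pos_pos add_pos_pos) auto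
  also have "\<dots> = x / (x + E) + 1 / (1 + x * E) - 2 * (1 / (1 + E))"
  proof -
    have "x + E \<noteq> 0" "1 + x * E \<noteq> 0" "1 + E \<noteq> 0" using E x by (auto simp: add_pos_pos less_imp_neq[symmetric])
    then show ?thesis by (simp add: divide_simps) (simp add: algebra_simps power2_eq_square)
  qed
  finally show ?thesis unfolding e by simp
qed

text \<open>The symmetry of the normal law pairs \<open>u\<close> with \<open>-u\<close>, which
  reduces the claim to the symmetric averages of the preceding inequality.\<close>

lemma gsig_gap: "sigmoid (- 1) < gsig 1 (- 1)"
proof -
  interpret prob_space "normal1 0" by (rule prob_space_normal1)
  let ?f = "\<lambda>u. sigmoid (1 * u + - 1) + sigmoid ((- 1) * u + - 1) - 2 * sigmoid (- 1)"
  have i: "integrable (normal1 0) (\<lambda>u. sigmoid (s * u + m))" for s m by (rule gsig_integrable)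
  have "0 < (\<integral>u. ?f u \<partial>normal1 0)"
  proof (rule normal1_integral_pos)
    show "integrable (normal1 0) ?f"
      by (intro Bochner_Integration.integrable_diff Bochner_Integration.integrable_add i) simp
    show "0 < ?f u" if "u \<noteq> 0" for u using sigmoid_strict_convexity[OF that] by simp
  qed simp
  also have "\<dots> = gsig 1 (- 1) + gsig (- 1) (- 1) - 2 * sigmoid (- 1)"
    unfolding gsig_def using i[of 1 "- 1"] i[of "- 1" "- 1"] by (simp add: measure_normal1_UNIV)
  also have "gsig (- 1) (- 1) = gsig 1 (- 1)"
    using normal1_reflect[of "\<lambda>u. sigmoid (1 * u + - 1)"] by (simp add: gsig_def)
  finally show ?thesis by simp
qed

lemma gsig_nonneg: "0 \<le> gsig s m"
  unfolding gsig_def by (intro integral_nonneg_AE AE_I2) (rule less_imp_le[OF sigmoid_pos])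

lemma gsig_le_one: "gsig s m \<le> 1"
  using gsig_nonneg[of s "- m"] by (simp add: gsig_minus)

text \<open>Dominated convergence suffices: the size of \<open>M\<close> enters only the final
  constant, which may depend on \<open>B\<close> in any way.\<close>

lemma gsig_vanishes:
  assumes "0 < \<eta>"
  shows "\<exists>M>0. gsig s (- M) \<le> \<eta>"
proof -
  interpret prob_space "normal1 0" by (rule prob_space_normal1)
  have le: "sigmoid v \<le> exp v" for v
  proof -
    have "sigmoid v \<le> 1 / exp (- v)" unfolding sigmoid_def by (intro divide_left_mono) (auto intro!: mult_pos_pos add_pos_pos)
    then show ?thesis by (simp add: exp_minus inverse_eq_divide)
  qed
  have "(\<lambda>k. \<integral>u. sigmoid (s * u + - real k) \<partial>normal1 0) \<longlonglongrightarrow> (\<integral>u. 0 \<partial>normal1 0)"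
  proof (rule integral_dominated_convergence[where w = "\<lambda>_. 1"])
    show "AE u in normal1 0. (\<lambda>k. sigmoid (s * u + - real k)) \<longlonglongrightarrow> 0"
    proof (rule AE_I2)
      fix u
      have e: "(\<lambda>k. exp (s * u + - real k)) \<longlonglongrightarrow> 0"
      proof -
        have "exp (s * u + - real k) = exp (s * u) * exp (- 1) ^ k" for k
          by (simp add: exp_of_nat_mult[symmetric] flip: exp_add)
        moreover have "(\<lambda>k. exp (s * u) * exp (- 1 :: real) ^ k) \<longlonglongrightarrow> 0"
          by (intro tendsto_mult_right_zero LIMSEQ_power_zero) simp
        ultimately show ?thesis by simp
      qed
      show "(\<lambda>k. sigmoid (s * u + - real k)) \<longlonglongrightarrow> 0"
        by (rule tendsto_sandwich[OF _ _ tendsto_const e]) (auto intro!: always_eventually less_imp_le[OF sigmoid_pos] le)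
    qed
    show "AE u in normal1 0. norm (sigmoid (s * u + - real k)) \<le> 1" for k
      by (auto simp: abs_of_pos[OF sigmoid_pos] less_imp_le[OF sigmoid_less_one])
  qed (auto intro: borel_measurable_integrable gsig_integrable)
  then have "(\<lambda>k. gsig s (- real k)) \<longlonglongrightarrow> 0" by (simp add: gsig_def)
  then have "eventually (\<lambda>k. gsig s (- real k) < \<eta>) sequentially" using assms by (rule order_tendstoD)
  then obtain N where N: "\<And>k. k \<ge> N \<Longrightarrow> gsig s (- real k) < \<eta>" by (auto simp: eventually_sequentially)
  show ?thesis using N[of "Suc N"] by (intro exI[of _ "real (Suc N)"]) auto
qed

text \<open>At an intermediate point z of the mean value theorem |z| <= |v| + 1, so both factors of
  the derivative are at least \<open>sigmoid (- (\<bar>v\<bar> + 1))\<close>. The bound is linear in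
  \<open>m\<close> with a coefficient depending on \<open>v\<close> alone, ready to be
  integrated.\<close>

lemma sigmoid_increment_ge:
  assumes m: "0 \<le> m" "m \<le> 1"
  shows "m * (sigmoid (- (\<bar>v\<bar> + 1)))\<^sup>2 \<le> sigmoid (v + m) - sigmoid v"
proof (cases "m = 0")
  case False
  then have "v < v + m" using m by simp
  from MVT2[OF this DERIV_sigmoid] obtain z where z: "v < z" "z < v + m"
    and eq: "sigmoid (v + m) - sigmoid v = m * (sigmoid z * (1 - sigmoid z))" by auto
  have a: "sigmoid (- (\<bar>v\<bar> + 1)) \<le> sigmoid z" using z m by (intro sigmoid_mono) auto
  have b: "sigmoid (- (\<bar>v\<bar> + 1)) \<le> 1 - sigmoid z"
    unfolding sigmoid_minus[symmetric] using z m by (intro sigmoid_mono) auto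
  have "(sigmoid (- (\<bar>v\<bar> + 1)))\<^sup>2 \<le> sigmoid z * (1 - sigmoid z)"
    unfolding power2_eq_square using a b sigmoid_pos less_imp_le[OF sigmoid_pos[of z]] less_imp_le[OF sigmoid_pos[of "- (\<bar>v\<bar> + 1)"]]
    by (intro mult_mono) auto
  then show ?thesis unfolding eq using m by (intro mult_left_mono) auto
qed simp

text \<open>This inverts the witness inequality: a small excess of the mean over 1/2 forces a small
  \<open>m\<close>. The truncation at 1 is forced by the boundedness of \<open>gsig\<close>, and
  \<open>d\<close> depends on \<open>s\<close> only.\<close>

lemma gsig_increment:
  "\<exists>d>0. \<forall>m\<ge>0. d * min m 1 \<le> gsig s m - 1 / 2"
proof -
  interpret prob_space "normal1 0" by (rule prob_space_normal1)
  define q where "q = (\<lambda>u. (sigmoid (- (\<bar>s * u\<bar> + 1)))\<^sup>2)"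
  define d where "d = (\<integral>u. q u \<partial>normal1 0)"
  have "bmf (normal1 0) q"
  proof (rule bmfI[where C = 1])
    show "q \<in> borel_measurable (normal1 0)" unfolding q_def by measurable
    show "\<bar>q u\<bar> \<le> 1" for u
      using sigmoid_pos[of "- (\<bar>s * u\<bar> + 1)"] sigmoid_less_one[of "- (\<bar>s * u\<bar> + 1)"]
      by (simp add: q_def power_le_one)
  qed
  then have iq: "integrable (normal1 0) q" by (rule bmf_integrable)
  have "0 < d" unfolding d_def
    by (rule normal1_integral_pos[OF iq]) (use sigmoid_pos in \<open>auto simp: q_def less_imp_neq[symmetric]\<close>)
  moreover have "d * min m 1 \<le> gsig s m - 1 / 2" if "0 \<le> m" for m
  proof -
    have "d * min m 1 = (\<integral>u. q u * min m 1 \<partial>normal1 0)" using iq by (simp add: d_def)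
    also have "\<dots> \<le> (\<integral>u. sigmoid (s * u + min m 1) - sigmoid (s * u + 0) \<partial>normal1 0)"
    proof (rule integral_mono)
      show "integrable (normal1 0) (\<lambda>u. q u * min m 1)" using iq by simp
      show "integrable (normal1 0) (\<lambda>u. sigmoid (s * u + min m 1) - sigmoid (s * u + 0))"
        by (intro Bochner_Integration.integrable_diff gsig_integrable)
      show "q u * min m 1 \<le> sigmoid (s * u + min m 1) - sigmoid (s * u + 0)" for u
        using sigmoid_increment_ge[of "min m 1" "s * u"] that by (simp add: q_def mult.commute)
    qed
    also have "\<dots> = gsig s (min m 1) - gsig s 0"
      unfolding gsig_def by (intro Bochner_Integration.integral_diff gsig_integrable)
    also have "\<dots> \<le> gsig s m - 1 / 2" unfolding gsig_zero using gsig_mono[of "min m 1" m s] by simp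
    finally show ?thesis .
  qed
  ultimately show ?thesis by blast
qed

section \<open>Uniform deviation over the discriminator class\<close>

lemma iid_component_integral:
  assumes M: "prob_space M" and f: "integrable M (f :: 'a \<Rightarrow> real)" and i: "i < n"
  shows "integrable (iid M n) (\<lambda>x. f (x i))" "(\<integral>x. f (x i) \<partial>iid M n) = (\<integral>y. f y \<partial>M)"
proof -
  have d: "distr (iid M n) M (\<lambda>x. x i) = M"
    using distr_PiM_component[of "{..<n}" "\<lambda>_. M" i] M i by simp
  have m: "(\<lambda>x. x i) \<in> measurable (iid M n) M" using i by simp
  have fm: "f \<in> borel_measurable M" using f by simp
  show "integrable (iid M n) (\<lambda>x. f (x i))"
    using integrable_distr_eq[OF m fm] f by (simp add: d)
  show "(\<integral>x. f (x i) \<partial>iid M n) = (\<integral>y. f y \<partial>M)"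
    using integral_distr[OF m fm] by (simp add: d)
qed

lemma iid_sum_integral:
  assumes M: "prob_space M" and f: "integrable M (f :: 'a \<Rightarrow> real)"
  shows "integrable (iid M n) (\<lambda>x. \<Sum>i<n. f (x i))" "(\<integral>x. (\<Sum>i<n. f (x i)) \<partial>iid M n) = real n * (\<integral>y. f y \<partial>M)"
proof -
  note c = iid_component_integral[OF M f]
  show "integrable (iid M n) (\<lambda>x. \<Sum>i<n. f (x i))"
    by (rule Bochner_Integration.integrable_sum) (simp add: c)
  have "(\<integral>x. (\<Sum>i<n. f (x i)) \<partial>iid M n) = (\<Sum>i<n. \<integral>x. f (x i) \<partial>iid M n)"
    by (rule Bochner_Integration.integral_sum) (simp add: c)
  then show "(\<integral>x. (\<Sum>i<n. f (x i)) \<partial>iid M n) = real n * (\<integral>y. f y \<partial>M)" by (simp add: c)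
qed

text \<open>This is the squared weight of the arctan component on the scale sqrt(p). Its expansion
  contributes 1, 2 and at most 3, so it does not grow with the dimension.\<close>

lemma gauss_weight_integral:
  fixes \<theta> :: "nat \<Rightarrow> real"
  assumes p: "1 \<le> p"
  defines "b \<equiv> \<lambda>x. (1 + (enorm p (\<lambda>i. x i - \<theta> i))\<^sup>2 / real p)\<^sup>2"
  shows "integrable (gauss p \<theta>) b" "(\<integral>x. b x \<partial>gauss p \<theta>) \<le> 6"
proof -
  interpret prob_space "gauss p \<theta>" by (rule prob_space_gauss)
  let ?a = "\<lambda>x. (enorm p (\<lambda>i. x i - \<theta> i))\<^sup>2"
  have eq: "b = (\<lambda>x. 1 + (2 / real p) * ?a x + (1 / (real p)\<^sup>2) * (?a x)\<^sup>2)"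
    using p by (auto simp: b_def fun_eq_iff power2_eq_square field_simps)
  note i = gauss_enorm_power2(1)[of p \<theta>] gauss_enorm_power4(1)[of p \<theta>]
  show "integrable (gauss p \<theta>) b"
    unfolding eq by (intro Bochner_Integration.integrable_add integrable_mult_right i) simp
  have "(\<integral>x. b x \<partial>gauss p \<theta>) = 1 + 2 / real p * real p + 1 / (real p)\<^sup>2 * (\<integral>x. (?a x)\<^sup>2 \<partial>gauss p \<theta>)"
    unfolding eq using i by (simp add: prob_space gauss_enorm_power2(2))
  also have "\<dots> \<le> 1 + 2 / real p * real p + 1 / (real p)\<^sup>2 * (3 * (real p)\<^sup>2)"
    by (intro add_left_mono mult_left_mono gauss_enorm_power4(2)) simp
  also have "\<dots> = 6" using p by simp
  finally show "(\<integral>x. b x \<partial>gauss p \<theta>) \<le> 6" .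
qed

lemma rademacher_subclass_le:
  assumes F: "F \<noteq> {}" "F \<subseteq> D" and b: "\<And>f x. f \<in> D \<Longrightarrow> \<bar>f x\<bar> \<le> 1"
  shows "rademacher F (\<lambda>_. 0) n (\<lambda>i f. 2 * f (z i)) \<le> 2 * class_rademacher D n z"
  unfolding rademacher_def class_rademacher_def savg_cmult[symmetric] add_0
proof (rule savg_mono, rule cSUP_least[OF F(1)])
  fix s f assume f: "f \<in> F"
  have "(\<Sum>i<n. s i * f (z i)) \<le> (SUP f\<in>D. \<Sum>i<n. s i * f (z i))"
  proof (rule cSUP_upper)
    show "f \<in> D" using f F by blast
    show "bdd_above ((\<lambda>f. \<Sum>i<n. s i * f (z i)) ` D)"
      by (rule bdd_above_sign_sum, rule bounded_image_of_bound[where M = 1], rule b)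
  qed
  moreover have "(\<Sum>i<n. s i * (2 * f (z i))) = 2 * (\<Sum>i<n. s i * f (z i))"
    by (simp add: sum_distrib_left mult_ac)
  ultimately show "(\<Sum>i<n. s i * (2 * f (z i))) \<le> 2 * (SUP f\<in>D. \<Sum>i<n. s i * f (z i))" by simp
qed

lemma bmf_Dnet:
  assumes "f \<in> Dnet p B L" "sets M = sets (Rp p)"
  shows "bmf M f"
  by (rule bmfI[where C = 1])
    (use Dnet_measurable[OF assms(1)] Dnet_abs_le[OF assms(1)] in \<open>simp_all add: measurable_cong_sets[OF assms(2) refl]\<close>)

lemma gauss_expected_deviation:
  fixes p n m :: nat
  assumes B: "0 < B" and p: "1 \<le> p" and n: "1 \<le> n" and F: "finite F" "F \<noteq> {}" "F \<subseteq> Dnet p B (Suc (Suc m))"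
  shows "(\<integral>z. (SUP f\<in>F. \<Sum>i<n. f (z i) - (\<integral>x. f x \<partial>gauss p \<theta>)) \<partial>iid (gauss p \<theta>) n)
    \<le> 2 * (2 ^ m * (29 * (1 + B) * (sqrt n * sqrt p)))"
proof -
  let ?Q = "gauss p \<theta>"
  note Q = prob_space_gauss[of p \<theta>]
  interpret Q: prob_space ?Q by (rule Q)
  interpret I: prob_space "iid ?Q n" by (rule prob_space_iid[OF Q])
  define r where "r = sqrt (real n)"
  define t where "t = sqrt (real p)"
  have r: "0 < r" "r\<^sup>2 = real n" using n by (auto simp: r_def)
  have t: "1 \<le> t" "t\<^sup>2 = real p" using p by (auto simp: t_def)
  \<comment> \<open>The two summands give the two requirements \<open>1 \<le> l\<close> and
    \<open>B * t \<le> l\<close>. The free parameters are taken as \<open>K1 = r\<close> and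
    \<open>K2 = r * t\<close>, the orders of the respective signed sums.\<close>
  define l where "l = 1 + B * t"
  have Bt: "0 \<le> B * t" using B t by simp
  have l1: "1 \<le> l" using Bt by (simp add: l_def)
  define a where "a = (\<lambda>x. (enorm p (\<lambda>i. x i - \<theta> i))\<^sup>2)"
  define b where "b = (\<lambda>x. (1 + a x / real p)\<^sup>2)"
  have ia: "integrable ?Q a" and Ia: "(\<integral>x. a x \<partial>?Q) = real p"
    unfolding a_def by (rule gauss_enorm_power2)+
  have ib: "integrable ?Q b" and Ib: "(\<integral>x. b x \<partial>?Q) \<le> 6"
    unfolding b_def a_def using gauss_weight_integral[OF p, of \<theta>] by auto
  define R where "R = (\<lambda>z. 2 * (2 ^ m * ((r + real n / (4 * r)) / 2
    + (B / 4 * (r * t + (\<Sum>i<n. a (z i)) / (r * t)) + pi * l * (r + (\<Sum>i<n. b (z i)) / r)))))"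
  have le: "rademacher F (\<lambda>_. 0) n (\<lambda>i f. 2 * f (z i)) \<le> R z" for z
  proof -
    have "rademacher F (\<lambda>_. 0) n (\<lambda>i f. 2 * f (z i)) \<le> 2 * class_rademacher (Dnet p B (Suc (Suc m))) n z"
      by (rule rademacher_subclass_le[OF F(2,3)]) (rule Dnet_abs_le)
    also have "\<dots> \<le> 2 * (2 ^ m * ((r + real n / (4 * r)) / 2
    + (B / 4 * (r * t + (\<Sum>i<n. (enorm p (\<lambda>k. z i k - \<theta> k))\<^sup>2) / (r * t))
      + pi * l * (r + (\<Sum>i<n. (1 + (B * enorm p (\<lambda>k. z i k - \<theta> k) / l)\<^sup>2)\<^sup>2) / r))))"
      by (rule mult_left_mono[OF class_rademacher_Dnet_bound[OF less_imp_le[OF B] l1 r(1) _ refl]]) (use r t in auto)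
    also have "\<dots> \<le> R z"
    proof -
      have "(1 + (B * enorm p (\<lambda>k. z i k - \<theta> k) / l)\<^sup>2)\<^sup>2 \<le> b (z i)" for i
      proof -
        let ?e = "enorm p (\<lambda>k. z i k - \<theta> k)"
        have e0: "0 \<le> ?e" by (rule enorm_nonneg)
        have "B * ?e / l \<le> ?e / t"
        proof -
          have "B * ?e * t \<le> ?e * l" using e0 by (simp add: l_def algebra_simps)
          then show ?thesis using l1 t by (simp add: divide_simps)
        qed
        then have "(B * ?e / l)\<^sup>2 \<le> (?e / t)\<^sup>2"
          using B e0 l1 by (intro power_mono divide_nonneg_nonneg mult_nonneg_nonneg) auto
        also have "\<dots> = a (z i) / real p" by (simp add: a_def power_divide t)
        finally show ?thesis unfolding b_def by (intro power_mono) auto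
      qed
      then have "(\<Sum>i<n. (1 + (B * enorm p (\<lambda>k. z i k - \<theta> k) / l)\<^sup>2)\<^sup>2) \<le> (\<Sum>i<n. b (z i))"
        by (rule sum_mono)
      then show ?thesis
        unfolding R_def a_def using r l1 by (intro mult_left_mono add_left_mono divide_right_mono) auto
    qed
    finally show ?thesis .
  qed
  note sa = iid_sum_integral[OF Q ia, of n] and sb = iid_sum_integral[OF Q ib, of n]
  have iR: "integrable (iid ?Q n) R"
    unfolding R_def using sa(1) sb(1) by (intro integrable_mult_right Bochner_Integration.integrable_add integrable_divide) auto
  have bF: "bmf ?Q f" if "f \<in> F" for f using F(3) that by (intro bmf_Dnet[OF _ sets_gauss]) auto
  have "(\<integral>z. (SUP f\<in>F. 0 + (\<Sum>i<n. f (z i) - (\<integral>x. f x \<partial>?Q))) \<partial>iid ?Q n)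
      \<le> (\<integral>z. rademacher F (\<lambda>_. 0) n (\<lambda>i f. 2 * f (z i)) \<partial>iid ?Q n)"
    by (rule symmetrization[OF Q F(1,2) bF])
  also have "\<dots> \<le> (\<integral>z. R z \<partial>iid ?Q n)"
  proof (rule integral_mono[OF _ iR le])
    show "integrable (iid ?Q n) (\<lambda>z. rademacher F (\<lambda>_. 0) n (\<lambda>i f. 2 * f (z i)))"
      by (intro I.bmf_integrable bmf_rademacher F bmf_const bmf_cmult bmf_iid_component bF)
  qed
  also have "\<dots> = 2 * (2 ^ m * ((r + real n / (4 * r)) / 2
    + (B / 4 * (r * t + real n * real p / (r * t)) + pi * l * (r + real n * (\<integral>x. b x \<partial>?Q) / r))))"
    unfolding R_def using sa sb by (simp add: I.prob_space Ia)
  also have "\<dots> \<le> 2 * (2 ^ m * (29 * (1 + B) * (r * t)))"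
  \<comment> \<open>The constant is 29 = 1 + 4 * 7: the constant and linear parts together give
    \<open>1 + B\<close>, pi is below 4, and 7 = 1 + 6 comes from the expected weight.\<close>
  proof -
    have "(r + real n / (4 * r)) / 2 = 5 / 8 * r"
      using r(1) by (simp add: r(2)[symmetric] power2_eq_square)
    also have "\<dots> \<le> r * t" using r t by (auto intro: order_trans[OF _ mult_left_mono[of 1 t r]])
    finally have 1: "(r + real n / (4 * r)) / 2 \<le> r * t" .
    have "real n * real p / (r * t) = r * t"
      using r(1) t(1) by (simp add: r(2)[symmetric] t(2)[symmetric] power2_eq_square)
    then have 2: "B / 4 * (r * t + real n * real p / (r * t)) \<le> B * (r * t)"
      using B r t by simp
    have "real n * (\<integral>x. b x \<partial>?Q) / r \<le> real n * 6 / r"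
      using r Ib by (intro divide_right_mono mult_left_mono) auto
    also have "\<dots> = 6 * r" using r(1) by (simp add: r(2)[symmetric] power2_eq_square)
    finally have 3: "r + real n * (\<integral>x. b x \<partial>?Q) / r \<le> 7 * r" by simp
    have 4: "l \<le> (1 + B) * t" using t B by (simp add: l_def algebra_simps)
    have "pi * l * (r + real n * (\<integral>x. b x \<partial>?Q) / r) \<le> 4 * ((1 + B) * t) * (7 * r)"
      using 3 4 pi_less_4 l1 r B t
      by (intro mult_mono) (auto intro!: add_nonneg_nonneg divide_nonneg_nonneg mult_nonneg_nonneg integral_nonneg_AE simp: b_def)
    then have 5: "pi * l * (r + real n * (\<integral>x. b x \<partial>?Q) / r) \<le> 28 * (1 + B) * (r * t)"
      by (simp add: mult_ac)
    have "x \<le> q \<Longrightarrow> y \<le> B * q \<Longrightarrow> z \<le> 28 * (1 + B) * q \<Longrightarrow> x + (y + z) \<le> 29 * (1 + B) * q" for x y z q :: real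
      by (simp add: algebra_simps)
    from this[OF 1 2 5] show ?thesis by (intro mult_left_mono) auto
  qed
  finally show ?thesis by (simp add: r_def t_def)
qed

lemma abs_cSUP_diff_le:
  fixes h h' :: "'a \<Rightarrow> real"
  assumes F: "finite F" "F \<noteq> {}" and le: "\<And>f. f \<in> F \<Longrightarrow> \<bar>h f - h' f\<bar> \<le> C"
  shows "\<bar>(SUP f\<in>F. h f) - (SUP f\<in>F. h' f)\<bar> \<le> C"
proof -
  have "(SUP f\<in>F. u f) \<le> (SUP f\<in>F. v f) + C" if "\<And>f. f \<in> F \<Longrightarrow> u f \<le> v f + C" for u v :: "'a \<Rightarrow> real"
  proof (rule cSUP_least[OF F(2)])
    fix f assume f: "f \<in> F"
    have "v f \<le> (SUP f\<in>F. v f)" using F f by (intro cSUP_upper) auto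
    then show "u f \<le> (SUP f\<in>F. v f) + C" using that[OF f] by simp
  qed
  from this[of h h'] this[of h' h] show ?thesis using le by (fastforce simp: abs_le_iff)
qed

lemma sum_update_diff:
  fixes f :: "'a \<Rightarrow> real" and i n :: nat
  assumes "i < n"
  shows "(\<Sum>j<n. f ((x(i := y)) j) - e) - (\<Sum>j<n. f ((x(i := y')) j) - e) = f y - f y'"
proof -
  have "(\<Sum>j<n. f ((x(i := y)) j) - e) - (\<Sum>j<n. f ((x(i := y')) j) - e) = (\<Sum>j<n. if j = i then f y - f y' else 0)"
    unfolding sum_subtractf[symmetric] by (rule sum.cong) auto
  also have "\<dots> = f y - f y'" using assms by simp
  finally show ?thesis .
qed

section \<open>Concentration over finite and countable subclasses\<close>

context
  fixes p n m :: nat and B \<epsilon> :: real and \<theta> :: "nat \<Rightarrow> real" and P :: "(nat \<Rightarrow> real) measure"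
  assumes B: "0 < B" and p: "1 \<le> p" and n: "1 \<le> n" and \<epsilon>: "0 \<le> \<epsilon>"
    and P: "prob_space P" and sP: "sets P = sets (Rp p)"
    and W: "wasserstein1 p P (gauss p \<theta>) \<le> ennreal \<epsilon>"
begin

definition centred_sum :: "((nat \<Rightarrow> real) \<Rightarrow> real) \<Rightarrow> (nat \<Rightarrow> nat \<Rightarrow> real) \<Rightarrow> real" where
  "centred_sum f X = (\<Sum>i<n. f (X i) - (\<integral>x. f x \<partial>gauss p \<theta>))"

text \<open>The scale is that of sums, not means. The terms are the Gaussian expected supremum, the
  cost of transferring \<open>n\<close> coordinates, and the fluctuation u with u^2 / (8 n) = 2 (p +
  n \<epsilon>^2).\<close>

definition deviation_bound :: real where
  "deviation_bound = 2 * (2 ^ m * (29 * (1 + B) * (sqrt n * sqrt p))) + real n * (B / 4 * \<epsilon>)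
    + 4 * sqrt (real n * (real p + real n * \<epsilon>\<^sup>2))"

lemma bmf_centred_sum:
  assumes "f \<in> Dnet p B (Suc (Suc m))"
  shows "bmf (iid P n) (centred_sum f)"
  unfolding centred_sum_def
  by (intro bmf_sum bmf_diff bmf_const bmf_iid_component bmf_Dnet[OF assms sP]) auto

lemma finite_class_deviation:
  assumes F: "finite F" "F \<noteq> {}" "F \<subseteq> Dnet p B (Suc (Suc m))"
  shows "measure (iid P n) {X \<in> space (iid P n). \<exists>f\<in>F. deviation_bound < centred_sum f X}
    \<le> exp (- (2 * (real p + real n * \<epsilon>\<^sup>2)))"
proof -
  let ?Q = "gauss p \<theta>"
  note Q = prob_space_gauss[of p \<theta>]
  interpret I: prob_space "iid P n" by (rule prob_space_iid[OF P])
  define g where "g = (\<lambda>X. SUP f\<in>F. centred_sum f X)"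
  define E where "E = (\<integral>X. g X \<partial>iid P n)"
  define T where "T = real p + real n * \<epsilon>\<^sup>2"
  define u where "u = 4 * sqrt (real n * T)"
  have T: "0 < T" using p n by (simp add: T_def add_pos_nonneg)
  have u: "0 < u" using T n by (simp add: u_def)
  have Fd: "f \<in> Dnet p B (Suc (Suc m))" if "f \<in> F" for f using F that by blast
  have gP: "bmf (iid P n) g" unfolding g_def by (intro bmf_SUP F bmf_centred_sum Fd)
  have gQ: "bmf (iid ?Q n) g"
    unfolding g_def centred_sum_def
    by (intro bmf_SUP F bmf_sum bmf_diff bmf_const bmf_iid_component bmf_Dnet[OF Fd sets_gauss]) auto
  have upd: "\<bar>g (x(i := y)) - g (x(i := y'))\<bar> \<le> C"
    if "i < n" "\<And>f. f \<in> F \<Longrightarrow> \<bar>f y - f y'\<bar> \<le> C" for x i y y' C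
    unfolding g_def
  proof (rule abs_cSUP_diff_le[OF F(1,2)])
    fix f assume "f \<in> F"
    then show "\<bar>centred_sum f (x(i := y)) - centred_sum f (x(i := y'))\<bar> \<le> C"
      unfolding centred_sum_def sum_update_diff[OF that(1)] by (rule that(2))
  qed
  have "E \<le> (\<integral>X. g X \<partial>iid ?Q n) + real n * (B / 4 * \<epsilon>)"
  proof (rule field_le_epsilon)
    fix e :: real assume e: "0 < e"
    \<comment> \<open>Over all \<open>n\<close> coordinates the slack of the near-optimal coupling
      then costs exactly \<open>e\<close>.\<close>
    define \<eta> where "\<eta> = e / (real n * (B / 4))"
    have \<eta>: "0 < \<eta>" using e B n by (simp add: \<eta>_def)
    have "E \<le> (\<integral>X. g X \<partial>iid ?Q n) + real n * (B / 4 * (\<epsilon> + \<eta>))"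
      unfolding E_def
    proof (rule iid_transfer[OF P Q, where d = "\<lambda>y y'. B / 4 * enorm p (\<lambda>i. y i - y' i)"])
      show "sets P = sets ?Q" by (simp add: sP sets_gauss)
      show "(\<integral>y. h y \<partial>P) \<le> (\<integral>y. h y \<partial>?Q) + B / 4 * (\<epsilon> + \<eta>)"
        if "bmf ?Q h" "\<And>y y'. y \<in> space ?Q \<Longrightarrow> y' \<in> space ?Q \<Longrightarrow> \<bar>h y - h y'\<bar> \<le> B / 4 * enorm p (\<lambda>i. y i - y' i)" for h
        by (rule wasserstein1_transfer[OF W \<epsilon> \<eta> P sP sets_gauss that(1) _ that(2)]) (use B in auto)
      show "bmf (iid ?Q n) g" by (rule gQ)
      show "\<bar>g (x(i := y)) - g (x(i := y'))\<bar> \<le> B / 4 * enorm p (\<lambda>i. y i - y' i)" if "i < n" for x i y y'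
        by (rule upd[OF that Dnet_lipschitz[OF Fd less_imp_le[OF B]]])
    qed
    also have "real n * (B / 4 * (\<epsilon> + \<eta>)) = real n * (B / 4 * \<epsilon>) + e"
      using B n by (simp add: \<eta>_def field_simps)
    finally show "E \<le> (\<integral>X. g X \<partial>iid ?Q n) + real n * (B / 4 * \<epsilon>) + e" by simp
  qed
  moreover have "(\<integral>X. g X \<partial>iid ?Q n) \<le> 2 * (2 ^ m * (29 * (1 + B) * (sqrt n * sqrt p)))"
    unfolding g_def centred_sum_def by (rule gauss_expected_deviation[OF B p n F])
  ultimately have E: "E + u \<le> deviation_bound"
    by (simp add: deviation_bound_def u_def T_def)
  have gm: "g \<in> borel_measurable (iid P n)" by (rule bmf_measurable[OF gP])
  have "measure (iid P n) {X \<in> space (iid P n). \<exists>f\<in>F. deviation_bound < centred_sum f X}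
      \<le> measure (iid P n) {X \<in> space (iid P n). E + u \<le> g X}"
  proof (rule I.finite_measure_mono)
    show "{X \<in> space (iid P n). E + u \<le> g X} \<in> sets (iid P n)"
      using gm by measurable
    show "{X \<in> space (iid P n). \<exists>f\<in>F. deviation_bound < centred_sum f X} \<subseteq> {X \<in> space (iid P n). E + u \<le> g X}"
    proof safe
      fix X f assume f: "f \<in> F" "deviation_bound < centred_sum f X"
      have "centred_sum f X \<le> g X" unfolding g_def using F f by (intro cSUP_upper) auto
      then show "E + u \<le> g X" using E f by linarith
    qed
  qed
  also have "\<dots> \<le> exp (- u\<^sup>2 / (8 * real n))"
    unfolding E_def
  proof (rule bounded_differences_tail[OF P gP])
    fix x i y assume i: "i < n"
    have "\<bar>g (x(i := y)) - g (x(i := x i))\<bar> \<le> 2"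
    proof (rule upd[OF i])
      fix f assume "f \<in> F"
      from Dnet_abs_le[OF Fd[OF this], of y] Dnet_abs_le[OF Fd[OF this], of "x i"]
      show "\<bar>f y - f (x i)\<bar> \<le> 2" by linarith
    qed
    then show "\<bar>g (x(i := y)) - g x\<bar> \<le> 2" by simp
  qed (use n u in auto)
  also have "- u\<^sup>2 / (8 * real n) = - (2 * T)"
    using n T by (simp add: u_def power_mult_distrib)
  finally show ?thesis by (simp add: T_def)
qed

text \<open>The finite bound does not depend on the number of functions, so it survives the
  increasing union along an enumeration.\<close>

lemma countable_class_deviation:
  assumes F: "countable F" "F \<noteq> {}" "F \<subseteq> Dnet p B (Suc (Suc m))"
  shows "{X \<in> space (iid P n). \<exists>f\<in>F. deviation_bound < centred_sum f X} \<in> sets (iid P n)"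
    and "measure (iid P n) {X \<in> space (iid P n). \<exists>f\<in>F. deviation_bound < centred_sum f X}
    \<le> exp (- (2 * (real p + real n * \<epsilon>\<^sup>2)))"
proof -
  interpret I: prob_space "iid P n" by (rule prob_space_iid[OF P])
  define q where "q = from_nat_into F"
  have q: "range q = F" unfolding q_def using F by (intro range_from_nat_into) auto
  have qF: "q ` {..k} \<subseteq> F" for k using q by blast
  define A where "A k = {X \<in> space (iid P n). \<exists>f\<in>q ` {..k}. deviation_bound < centred_sum f X}" for k
  have A: "A k \<in> sets (iid P n)" for k
  proof -
    have "A k = (\<Union>j\<in>{..k}. {X \<in> space (iid P n). deviation_bound < centred_sum (q j) X})"
      by (auto simp: A_def)
    moreover have "{X \<in> space (iid P n). deviation_bound < centred_sum (q j) X} \<in> sets (iid P n)" for j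
    proof -
      have "q j \<in> Dnet p B (Suc (Suc m))" using F(3) q by blast
      then have "centred_sum (q j) \<in> borel_measurable (iid P n)" by (rule bmf_measurable[OF bmf_centred_sum])
      then show ?thesis by measurable
    qed
    ultimately show ?thesis by simp
  qed
  have UA: "{X \<in> space (iid P n). \<exists>f\<in>F. deviation_bound < centred_sum f X} = (\<Union>k. A k)"
    unfolding A_def q[symmetric] by blast
  show "{X \<in> space (iid P n). \<exists>f\<in>F. deviation_bound < centred_sum f X} \<in> sets (iid P n)"
    unfolding UA using A by blast
  have "(\<lambda>k. measure (iid P n) (A k)) \<longlonglongrightarrow> measure (iid P n) (\<Union>k. A k)"
  proof (rule I.finite_Lim_measure_incseq)
    show "range A \<subseteq> sets (iid P n)" using A by blast
    show "incseq A" unfolding incseq_def A_def by (auto intro: order_trans)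
  qed
  moreover have "measure (iid P n) (A k) \<le> exp (- (2 * (real p + real n * \<epsilon>\<^sup>2)))" for k
    unfolding A_def using order_trans[OF qF F(3)] by (intro finite_class_deviation) auto
  ultimately show "measure (iid P n) {X \<in> space (iid P n). \<exists>f\<in>F. deviation_bound < centred_sum f X}
    \<le> exp (- (2 * (real p + real n * \<epsilon>\<^sup>2)))"
    unfolding UA by (intro LIMSEQ_le_const2) auto
qed

end

section \<open>Pointwise separability of the discriminator class\<close>

lemma enorm_le_sum_abs: "enorm p x \<le> (\<Sum>i<p. \<bar>x i\<bar>)"
  unfolding enorm_eq_L2_set by (rule L2_set_le_sum_abs)

lemma rational_point_near:
  assumes "0 < \<eta>"
  shows "\<exists>q \<in> {..<p} \<rightarrow>\<^sub>E \<rat>. enorm p (\<lambda>i. x i - q i) \<le> \<eta>"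
proof -
  define d where "d = \<eta> / (real p + 1)"
  have d: "0 < d" using assms by (simp add: d_def)
  have "\<exists>r\<in>\<rat>. \<bar>x i - r\<bar> < d" for i
  proof -
    obtain r where "r \<in> \<rat>" "x i < r" "r < x i + d" using Rats_dense_in_real[of "x i" "x i + d"] d by auto
    then show ?thesis by (intro bexI[of _ r]) auto
  qed
  then obtain r where r: "\<And>i. r i \<in> \<rat>" "\<And>i. \<bar>x i - r i\<bar> < d" by metis
  have "enorm p (\<lambda>i. x i - restrict r {..<p} i) \<le> (\<Sum>i<p. \<bar>x i - restrict r {..<p} i\<bar>)" by (rule enorm_le_sum_abs)
  also have "\<dots> \<le> (\<Sum>i<p. d)" using r by (intro sum_mono) (auto intro: less_imp_le)
  also have "\<dots> \<le> \<eta>" using assms by (simp add: d_def field_simps)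
  finally show ?thesis using r by (intro bexI[of _ "restrict r {..<p}"]) auto
qed

text \<open>The class is equi-Lipschitz, so it embeds into the second countable space of its values
  at rational points.\<close>

lemma Dnet_separable:
  assumes B: "0 \<le> B"
  shows "\<exists>D0. countable D0 \<and> D0 \<noteq> {} \<and> D0 \<subseteq> Dnet p B L \<and>
    (\<forall>f\<in>Dnet p B L. \<exists>h. (\<forall>k. h k \<in> D0) \<and> (\<forall>x. (\<lambda>k. h k x) \<longlonglongrightarrow> f x))"
proof -
  let ?S = "{..<p} \<rightarrow>\<^sub>E (\<rat> :: real set)"
  have cS: "countable ?S" by (intro countable_PiE finite_lessThan countable_rat)
  have "?S \<noteq> {}" using rational_point_near[of 1 p] by fastforce
  then have rq: "range (from_nat_into ?S) = ?S" using cS by (rule range_from_nat_into)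
  define e :: "((nat \<Rightarrow> real) \<Rightarrow> real) \<Rightarrow> nat \<Rightarrow> real" where "e f = (\<lambda>k. f (from_nat_into ?S k))" for f
  obtain T where T: "countable T" "T \<subseteq> e ` Dnet p B L" "e ` Dnet p B L \<subseteq> closure T"
    by (rule separable)
  have "\<forall>t\<in>T. \<exists>f. f \<in> Dnet p B L \<and> e f = t" using T(2) by blast
  then obtain c where c: "\<And>t. t \<in> T \<Longrightarrow> c t \<in> Dnet p B L" "\<And>t. t \<in> T \<Longrightarrow> e (c t) = t" by metis
  have ne: "(\<lambda>_. 0) \<in> Dnet p B L" unfolding Dnet_eq_absconv by (rule zero_in_absconv)
  have "\<exists>h. (\<forall>k. h k \<in> c ` T) \<and> (\<forall>x. (\<lambda>k. h k x) \<longlonglongrightarrow> f x)" if f: "f \<in> Dnet p B L" for f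
  proof -
    have "e f \<in> closure T" using T(3) f by blast
    then obtain s where s: "\<And>k. s k \<in> T" "s \<longlonglongrightarrow> e f" unfolding closure_sequential by blast
    have lim: "(\<lambda>k. c (s k) q) \<longlonglongrightarrow> f q" if q: "q \<in> ?S" for q
    proof -
      obtain j where j: "q = from_nat_into ?S j" using q rq by blast
      have "(\<lambda>k. s k j) \<longlonglongrightarrow> e f j"
        by (rule continuous_on_tendsto_compose[OF continuous_on_product_coordinates s(2)]) auto
      moreover have "s k j = c (s k) q" for k using c(2)[OF s(1)[of k]] by (simp add: e_def j fun_eq_iff)
      ultimately show ?thesis by (simp add: e_def j)
    qed
    have "(\<lambda>k. c (s k) x) \<longlonglongrightarrow> f x" for x
    proof (rule LIMSEQ_I)
      fix r :: real assume r: "0 < r"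
      \<comment> \<open>Each of \<open>f\<close> and its approximant moves by at most
        \<open>r / 4\<close> between \<open>x\<close> and \<open>q\<close>, and they differ by less
        than \<open>r / 4\<close> at \<open>q\<close>. The summand 1 in the denominator covers
        \<open>B = 0\<close>.\<close>
      define \<eta> where "\<eta> = r / (1 + B)"
      have \<eta>: "0 < \<eta>" using r B by (simp add: \<eta>_def)
      from rational_point_near[OF \<eta>, of p x] obtain q where q: "q \<in> ?S" "enorm p (\<lambda>i. x i - q i) \<le> \<eta>" by blast
      have near: "\<bar>g x - g q\<bar> \<le> r / 4" if "g \<in> Dnet p B L" for g
      proof -
        have "\<bar>g x - g q\<bar> \<le> B / 4 * enorm p (\<lambda>i. x i - q i)" by (rule Dnet_lipschitz[OF that B])
        also have "\<dots> \<le> B / 4 * \<eta>" using q B by (intro mult_left_mono) auto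
        also have "\<dots> \<le> r / 4" using r B by (simp add: \<eta>_def field_simps)
        finally show ?thesis .
      qed
      from LIMSEQ_D[OF lim[OF q(1)], of "r / 4"] r obtain N where
        N: "\<And>k. k \<ge> N \<Longrightarrow> \<bar>c (s k) q - f q\<bar> < r / 4" by auto
      have "\<bar>c (s k) x - f x\<bar> < r" if "k \<ge> N" for k
        using N[OF that] near[OF f] near[OF c(1)[OF s(1)[of k]]] r unfolding abs_le_iff abs_less_iff by argo
      then show "\<exists>N. \<forall>k\<ge>N. norm (c (s k) x - f x) < r" by auto
    qed
    then show ?thesis using s(1) by (intro exI[of _ "\<lambda>k. c (s k)"]) auto
  qed
  moreover have "c ` T \<noteq> {}" using calculation[OF ne] by blast
  ultimately show ?thesis using T(1) c(1) by (intro exI[of _ "c ` T"]) auto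
qed

text \<open>The event is defined through a countable subclass, hence measurable. For a fixed sample
  a pointwise limit passes through the finite sum directly and through the Gaussian mean by
  dominated convergence, and closure under negation turns the one-sided bound into an absolute
  one.\<close>

theorem uniform_deviation:
  fixes p n L :: nat
  assumes B: "0 < B" and p: "1 \<le> p" and n: "1 \<le> n" and L: "2 \<le> L" and \<epsilon>: "0 \<le> \<epsilon>"
    and P: "prob_space P" and sP: "sets P = sets (Rp p)"
    and W: "wasserstein1 p P (gauss p \<theta>) \<le> ennreal \<epsilon>"
  shows "\<exists>E\<in>sets (iid P n). measure (iid P n) (space (iid P n) - E) \<le> exp (- (2 * (real p + real n * \<epsilon>\<^sup>2))) \<and>
    (\<forall>X\<in>E. \<forall>f\<in>Dnet p B L. \<bar>(\<Sum>i<n. f (X i)) / real n - (\<integral>x. f x \<partial>gauss p \<theta>)\<bar>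
      \<le> 20 * (1 + B) * (2 ^ L * sqrt (real p / real n) + \<epsilon>))"
proof -
  let ?Q = "gauss p \<theta>" and ?cs = "centred_sum p n \<theta>"
  interpret Q: prob_space ?Q by (rule prob_space_gauss)
  obtain m where Lm: "L = Suc (Suc m)" using L by (metis One_nat_def Suc_le_D numeral_2_eq_2 Suc_le_mono)
  obtain D0 where D0: "countable D0" "D0 \<noteq> {}" "D0 \<subseteq> Dnet p B L"
    and dense: "\<And>f. f \<in> Dnet p B L \<Longrightarrow> \<exists>h. (\<forall>k. h k \<in> D0) \<and> (\<forall>x. (\<lambda>k. h k x) \<longlonglongrightarrow> f x)"
    using Dnet_separable[of B p L] B by (metis less_imp_le)
  define \<tau> where "\<tau> = deviation_bound p n m B \<epsilon>"
  define E where "E = {X \<in> space (iid P n). \<not> (\<exists>f\<in>D0. \<tau> < ?cs f X)}"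
  have Ec: "space (iid P n) - E = {X \<in> space (iid P n). \<exists>f\<in>D0. \<tau> < ?cs f X}"
    by (auto simp: E_def)
  note cd = countable_class_deviation[OF B p n \<epsilon> P sP W D0(1,2) D0(3)[unfolded Lm], folded \<tau>_def]
  have EE: "E = space (iid P n) - {X \<in> space (iid P n). \<exists>f\<in>D0. \<tau> < ?cs f X}" by (auto simp: E_def)
  have "E \<in> sets (iid P n)" unfolding EE by (intro sets.compl_sets cd(1))
  moreover have "measure (iid P n) (space (iid P n) - E) \<le> exp (- (2 * (real p + real n * \<epsilon>\<^sup>2)))"
    unfolding Ec by (rule cd(2))
  moreover have "\<bar>(\<Sum>i<n. f (X i)) / real n - (\<integral>x. f x \<partial>?Q)\<bar> \<le> 20 * (1 + B) * (2 ^ L * sqrt (real p / real n) + \<epsilon>)"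
    if X: "X \<in> E" and f: "f \<in> Dnet p B L" for X f
  proof -
    have up: "?cs g X \<le> \<tau>" if g: "g \<in> Dnet p B L" for g
    proof -
      obtain h where h: "\<And>k. h k \<in> D0" "\<And>x. (\<lambda>k. h k x) \<longlonglongrightarrow> g x" using dense[OF g] by blast
      have hD: "h k \<in> Dnet p B L" for k using h(1) D0 by blast
      have "(\<lambda>k. \<integral>x. h k x \<partial>?Q) \<longlonglongrightarrow> (\<integral>x. g x \<partial>?Q)"
      proof (rule integral_dominated_convergence[where w = "\<lambda>_. 1"])
        show "g \<in> borel_measurable ?Q" "\<And>k. h k \<in> borel_measurable ?Q"
          by (rule bmf_measurable[OF bmf_Dnet[OF g sets_gauss]], rule bmf_measurable[OF bmf_Dnet[OF hD sets_gauss]])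
        show "AE x in ?Q. norm (h k x) \<le> 1" for k using Dnet_abs_le[OF hD] by simp
      qed (use h(2) in auto)
      then have "(\<lambda>k. ?cs (h k) X) \<longlonglongrightarrow> ?cs g X"
        unfolding centred_sum_def[OF B p n \<epsilon> P sP W] by (intro tendsto_sum tendsto_diff h(2))
      moreover have "?cs (h k) X \<le> \<tau>" for k using X h(1)[of k] by (auto simp: E_def not_less)
      ultimately show ?thesis by (intro LIMSEQ_le_const2) auto
    qed
    let ?v = "(\<Sum>i<n. f (X i)) / real n - (\<integral>x. f x \<partial>?Q)"
    have cs: "?cs f X = real n * ?v" "?cs (\<lambda>x. - f x) X = - (real n * ?v)"
      unfolding centred_sum_def[OF B p n \<epsilon> P sP W] using n by (simp_all add: sum_subtractf sum_negf field_simps)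
    have "\<bar>real n * ?v\<bar> \<le> \<tau>"
      using up[OF f] up[OF Dnet_uminus[OF f]] unfolding cs by (rule abs_leI)
    then have "real n * \<bar>?v\<bar> \<le> \<tau>" by (simp add: abs_mult)
    also have "\<tau> \<le> real n * (20 * (1 + B) * (2 ^ L * sqrt (real p / real n) + \<epsilon>))"
    proof -
      define s where "s = sqrt (real p / real n)"
      have s0: "0 \<le> s" by (simp add: s_def)
      have ns: "sqrt n * sqrt p = real n * s"
      proof -
        have "real n * s = (sqrt n * sqrt n) * (sqrt p / sqrt n)" by (simp add: s_def real_sqrt_divide)
        also have "x * x * (y / x) = x * y" for x y :: real by simp
        finally show ?thesis by simp
      qed
      have "sqrt (real n * (real p + real n * \<epsilon>\<^sup>2)) \<le> real n * (s + \<epsilon>)"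
      proof (rule real_le_lsqrt)
        have "real n * (real p + real n * \<epsilon>\<^sup>2) = (real n)\<^sup>2 * (s\<^sup>2 + \<epsilon>\<^sup>2)"
          using n by (simp add: s_def power2_eq_square field_simps)
        also have "\<dots> \<le> (real n)\<^sup>2 * (s + \<epsilon>)\<^sup>2"
          using s0 \<epsilon> by (intro mult_left_mono) (auto simp: power2_eq_square algebra_simps)
        finally show "real n * (real p + real n * \<epsilon>\<^sup>2) \<le> (real n * (s + \<epsilon>))\<^sup>2" by (simp add: power_mult_distrib)
      qed (use s0 \<epsilon> in auto)
      then have "\<tau> \<le> 2 * (2 ^ m * (29 * (1 + B) * (real n * s))) + real n * (B / 4 * \<epsilon>) + 4 * (real n * (s + \<epsilon>))"
        unfolding \<tau>_def deviation_bound_def[OF B p n \<epsilon> P sP W] ns by simp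
      also have "\<dots> = real n * (58 * (1 + B) * (2 ^ m * s) + B / 4 * \<epsilon> + 4 * s + 4 * \<epsilon>)"
        by (simp add: algebra_simps)
      also have "\<dots> \<le> real n * (20 * (1 + B) * (2 ^ L * s + \<epsilon>))"
      proof (rule mult_left_mono)
        \<comment> \<open>Since \<open>L = m + 2\<close>, \<open>2 ^ L\<close> equals
          \<open>4 * 2 ^ m\<close>. The Rademacher and fluctuation terms need 58 + 4 copies of
          \<open>(1 + B) * (2 ^ m * s)\<close>, and 20 * 4 are available.\<close>
        have a: "s \<le> 2 ^ m * s" using s0 by (simp add: mult_le_cancel_right1)
        have b: "2 ^ L * s = 4 * (2 ^ m * s)" by (simp add: Lm)
        have c: "2 ^ m * s \<le> (1 + B) * (2 ^ m * s)" 
          using mult_right_mono[of 1 "1 + B" "2 ^ m * s"] B s0 by simp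
        have d: "B / 4 * \<epsilon> + 4 * \<epsilon> \<le> 20 * (1 + B) * \<epsilon>" using mult_nonneg_nonneg[of B \<epsilon>] B \<epsilon> by (simp add: algebra_simps)
        have "4 * s \<le> 4 * ((1 + B) * (2 ^ m * s))" using order_trans[OF a c] by (rule mult_left_mono) simp
        then have "58 * (1 + B) * (2 ^ m * s) + 4 * s \<le> 20 * (1 + B) * (4 * (2 ^ m * s))"
          using c a s0 by (simp add: algebra_simps)
        then show "58 * (1 + B) * (2 ^ m * s) + B / 4 * \<epsilon> + 4 * s + 4 * \<epsilon> \<le> 20 * (1 + B) * (2 ^ L * s + \<epsilon>)"
          unfolding b using d by (simp add: distrib_left)
      qed simp
      finally show ?thesis by (simp add: s_def)
    qed
    finally show ?thesis using n by simp
  qed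
  ultimately show ?thesis by blast
qed

section \<open>The discriminator does not separate perfectly\<close>

text \<open>What the empirical mean and a Gaussian mean have in common: linearity on finite
  combinations, monotonicity, normalisation. The abstraction lets the two exchange roles in the
  layer induction.\<close>

definition mean_functional :: "nat \<Rightarrow> (((nat \<Rightarrow> real) \<Rightarrow> real) \<Rightarrow> real) \<Rightarrow> bool" where
  "mean_functional p I \<longleftrightarrow>
    (\<forall>(k :: nat) a f. (\<forall>j<k. bmf (Rp p) (f j)) \<longrightarrow> I (\<lambda>x. \<Sum>j<k. a j * f j x) = (\<Sum>j<k. a j * I (f j))) \<and>
    (\<forall>f g. bmf (Rp p) f \<longrightarrow> bmf (Rp p) g \<longrightarrow> (\<forall>x. f x \<le> g x) \<longrightarrow> I f \<le> I g) \<and> (\<forall>c. I (\<lambda>_. c) = c)"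

lemma mean_functional_linear:
  fixes k :: nat
  shows "mean_functional p I \<Longrightarrow> (\<And>j. j < k \<Longrightarrow> bmf (Rp p) (f j)) \<Longrightarrow> I (\<lambda>x. \<Sum>j<k. a j * f j x) = (\<Sum>j<k. a j * I (f j))"
  by (simp add: mean_functional_def)

lemma mean_functional_mono:
  "mean_functional p I \<Longrightarrow> bmf (Rp p) f \<Longrightarrow> bmf (Rp p) g \<Longrightarrow> (\<And>x. f x \<le> g x) \<Longrightarrow> I f \<le> I g"
  by (simp add: mean_functional_def)

lemma mean_functional_const: "mean_functional p I \<Longrightarrow> I (\<lambda>_. c) = c"
  by (simp add: mean_functional_def)

lemma mean_functional_gauss: "mean_functional p (\<lambda>f. \<integral>x. f x \<partial>gauss p \<theta>)"
proof -
  interpret prob_space "gauss p \<theta>" by (rule prob_space_gauss)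
  have i: "integrable (gauss p \<theta>) f" if "bmf (Rp p) f" for f
    by (rule bmf_integrable) (use that in \<open>simp add: bmf_def measurable_gauss_iff space_gauss\<close>)
  show ?thesis
    unfolding mean_functional_def using i by (auto simp: prob_space intro!: integral_mono)
qed

lemma mean_functional_empirical:
  assumes "1 \<le> n"
  shows "mean_functional p (\<lambda>f. (\<Sum>i<n. f (X i)) / real n)"
proof -
  have "(\<Sum>i<n. \<Sum>j<k. a j * f j (X i)) / real n = (\<Sum>j<k. a j * ((\<Sum>i<n. f j (X i)) / real n))" for k :: nat and a f
    by (subst sum.swap) (simp add: sum_distrib_left sum_divide_distrib)
  then show ?thesis
    unfolding mean_functional_def using assms by (auto intro!: divide_right_mono sum_mono)
qed

lemma bmf_node: "f \<in> node p B l \<Longrightarrow> bmf (Rp p) f"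
  using node_range[of f p B l] by (intro bmfI[where C = 1] node_measurable) auto

lemma mean_functional_node_range:
  assumes I: "mean_functional p I" and f: "f \<in> node p B l"
  shows "0 \<le> I f" "I f \<le> 1"
proof -
  have "I (\<lambda>_. 0) \<le> I f" "I f \<le> I (\<lambda>_. 1)"
    using node_range[OF f] by (auto intro!: mean_functional_mono[OF I] bmf_const bmf_node[OF f])
  then show "0 \<le> I f" "I f \<le> 1" by (simp_all add: mean_functional_const[OF I])
qed

text \<open>The weight \<open>1 / 2\<close> on \<open>J\<close> makes the bound stable under the ReLU layers, uniformly in the depth:
  a negative coefficient contributes at most half of its size.\<close>

lemma node_advantage:
  assumes I: "mean_functional p I" and J: "mean_functional p J" and \<kappa>: "0 \<le> \<kappa>" "\<kappa> \<le> 1"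
    and gap: "\<And>f. f \<in> node p B (Suc 0) \<Longrightarrow> I f - J f \<le> 1 - \<kappa>"
  shows "f \<in> node p B (Suc l) \<Longrightarrow> I f - J f / 2 \<le> 1 - \<kappa> / 2"
proof (induction l arbitrary: f)
  case 0
  have "i - j \<le> 1 - \<kappa> \<Longrightarrow> i \<le> 1 \<Longrightarrow> i - j / 2 \<le> 1 - \<kappa> / 2" for i j by argo
  from this[OF gap[OF 0] mean_functional_node_range(2)[OF I 0]] show ?case .
next
  case (Suc l)
  then obtain k :: nat and a h where f: "f = (\<lambda>x. max (\<Sum>j<k. a j * h j x) 0)"
    and a: "(\<Sum>j<k. \<bar>a j\<bar>) \<le> 1" and h: "\<And>j. j < k \<Longrightarrow> h j \<in> node p B (Suc l)"
    by auto
  have bh: "bmf (Rp p) (h j)" if "j < k" for j by (rule bmf_node[OF h[OF that]])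
  have bsum: "bmf (Rp p) (\<lambda>x. \<Sum>j<k. c j * h j x)" for c by (intro bmf_sum bmf_cmult bh) auto
  have bf: "bmf (Rp p) f" by (rule bmf_node[OF Suc.prems])
  \<comment> \<open>For an upper bound on \<open>I f\<close> the negative weights are dropped, the
    nodes being nonnegative; for a lower bound on \<open>J f\<close> the ReLU is dropped
    instead.\<close>
  have "I f \<le> I (\<lambda>x. \<Sum>j<k. max (a j) 0 * h j x)"
  proof (rule mean_functional_mono[OF I bf bsum])
    fix x
    have "(\<Sum>j<k. a j * h j x) \<le> (\<Sum>j<k. max (a j) 0 * h j x)"
      using node_range[OF h] by (intro sum_mono mult_right_mono) auto
    moreover have "0 \<le> (\<Sum>j<k. max (a j) 0 * h j x)"
      using node_range[OF h] by (intro sum_nonneg mult_nonneg_nonneg) auto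
    ultimately show "f x \<le> (\<Sum>j<k. max (a j) 0 * h j x)" by (simp add: f)
  qed
  also have "\<dots> = (\<Sum>j<k. max (a j) 0 * I (h j))" by (rule mean_functional_linear[OF I bh])
  finally have If: "I f \<le> (\<Sum>j<k. max (a j) 0 * I (h j))" .
  have "(\<Sum>j<k. a j * J (h j)) = J (\<lambda>x. \<Sum>j<k. a j * h j x)"
    by (rule mean_functional_linear[OF J bh, symmetric])
  also have "\<dots> \<le> J f" by (rule mean_functional_mono[OF J bsum bf]) (simp add: f)
  finally have "I f - J f / 2 \<le> (\<Sum>j<k. max (a j) 0 * I (h j) - a j * J (h j) / 2)"
    using If by (simp add: sum_subtractf flip: sum_divide_distrib)
  also have "\<dots> \<le> (\<Sum>j<k. \<bar>a j\<bar> * (1 - \<kappa> / 2))"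
  proof (rule sum_mono)
    fix j assume "j \<in> {..<k}"
    then have j: "h j \<in> node p B (Suc l)" using h by simp
    show "max (a j) 0 * I (h j) - a j * J (h j) / 2 \<le> \<bar>a j\<bar> * (1 - \<kappa> / 2)"
    proof (cases "0 \<le> a j")
      case True
      then show ?thesis using mult_left_mono[OF Suc.IH[OF j] True] by (simp add: right_diff_distrib)
    next
      case False
      \<comment> \<open>A negative weight contributes only through \<open>J\<close>, which is at
        most 1, so its half is at most 1/2 and \<open>\<kappa> \<le> 1\<close> closes the
        case.\<close>
      have "J (h j) / 2 \<le> 1 - \<kappa> / 2"
        using mean_functional_node_range(2)[OF J j] \<kappa> by argo
      then have "- a j * (J (h j) / 2) \<le> - a j * (1 - \<kappa> / 2)" using False by (intro mult_left_mono) auto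
      then show ?thesis using False by simp
    qed
  qed
  also have "\<dots> \<le> 1 * (1 - \<kappa> / 2)"
    unfolding sum_distrib_right[symmetric] using a \<kappa> by (intro mult_right_mono) auto
  finally show ?case by simp
qed

text \<open>The output layer has signed weights, so the node bound is used with \<open>I\<close> and
  \<open>J\<close> in both orders. Nonnegativity of the node means replaces the half weight by the
  full one, since i - j <= i - j / 2.\<close>

lemma Dnet_advantage:
  assumes I: "mean_functional p I" and J: "mean_functional p J" and \<kappa>: "0 \<le> \<kappa>" "\<kappa> \<le> 1" and L: "2 \<le> L"
    and gap: "\<And>f. f \<in> node p B (Suc 0) \<Longrightarrow> \<bar>I f - J f\<bar> \<le> 1 - \<kappa>"
    and f: "f \<in> Dnet p B L"
  shows "I f - J f \<le> 1 - \<kappa> / 2"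
proof -
  have L1: "L - 1 = Suc (L - 2)" using L by simp
  obtain k :: nat and a h where fe: "f = (\<lambda>x. \<Sum>j<k. a j * h j x)"
    and a: "(\<Sum>j<k. \<bar>a j\<bar>) \<le> 1" and h: "\<And>j. j < k \<Longrightarrow> h j \<in> node p B (Suc (L - 2))"
    using f unfolding Dnet_def L1 by auto
  have bh: "bmf (Rp p) (h j)" if "j < k" for j by (rule bmf_node[OF h[OF that]])
  have "I f - J f = (\<Sum>j<k. a j * (I (h j) - J (h j)))"
    using mean_functional_linear[OF I bh, where k = k and a = a] mean_functional_linear[OF J bh, where k = k and a = a]
    unfolding fe by (simp add: sum_subtractf right_diff_distrib)
  also have "\<dots> \<le> \<bar>\<dots>\<bar>" by simp
  also have "\<dots> \<le> 1 - \<kappa> / 2"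
  proof (rule abs_weighted_sum_le[OF a])
    fix j assume "j < k"
    note hj = h[OF this]
    have g: "I g - J g \<le> 1 - \<kappa>" "J g - I g \<le> 1 - \<kappa>" if "g \<in> node p B (Suc 0)" for g
      using gap[OF that] by (auto simp: abs_le_iff)
    have "I (h j) - J (h j) / 2 \<le> 1 - \<kappa> / 2" by (rule node_advantage[OF I J \<kappa> _ hj]) (rule g)
    moreover have "J (h j) - I (h j) / 2 \<le> 1 - \<kappa> / 2" by (rule node_advantage[OF J I \<kappa> _ hj]) (rule g)
    moreover note mean_functional_node_range(1)[OF I hj] mean_functional_node_range(1)[OF J hj]
    ultimately show "\<bar>I (h j) - J (h j)\<bar> \<le> 1 - \<kappa> / 2" unfolding abs_le_iff by argo
  qed (use \<kappa> in auto)
  finally show ?thesis .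
qed

text \<open>A universal constant: how far the Gaussian mean of a unit neuron with argument -1 at the
  centre exceeds \<open>sigmoid (- 1)\<close>. An empirical mean above that value certifies sample
  mass where the neuron exceeds it, that is, in a half-space through the centre.\<close>

definition gap0 :: real where
  "gap0 = gsig 1 (- 1) - sigmoid (- 1)"

lemma gap0_bounds: "0 < gap0" "gap0 \<le> 1"
  using gsig_gap gsig_le_one[of 1 "- 1"] sigmoid_pos[of "- 1"] by (auto simp: gap0_def)

text \<open>The test neuron \<open>f1\<close> points against \<open>w\<close> and has argument -1 at
  \<open>\<theta>\<close>. Its empirical mean is at least \<open>sigmoid (- 1) + gap0 / 2\<close>,
  so enough of the sample lies where the given sigmoid is at most 1/2. Only the direction of
  \<open>w\<close> is used, so its norm may be arbitrary.\<close>

lemma empirical_sigmoid_le: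
  fixes w \<theta> :: "nat \<Rightarrow> real"
  assumes n: "1 \<le> n" and b: "(\<Sum>i<p. w i * \<theta> i) + b \<le> 0"
    and dev: "\<And>f. f \<in> Dnet p 1 2 \<Longrightarrow> \<bar>(\<Sum>i<n. f (X i)) / real n - (\<integral>x. f x \<partial>gauss p \<theta>)\<bar> \<le> gap0 / 2"
  shows "(\<Sum>i<n. sigmoid ((\<Sum>k<p. w k * X i k) + b)) / real n \<le> 1 - gap0 / 4"
proof (cases "enorm p w = 0")
  case True
  then have w0: "\<forall>k<p. w k = 0" by (simp add: enorm_def sum_nonneg_eq_0_iff)
  then have "b \<le> 0" using b by simp
  then have "sigmoid b \<le> 1 / 2" using sigmoid_mono[of b 0] by (simp add: sigmoid_zero)
  moreover have "(\<Sum>i<n. sigmoid ((\<Sum>k<p. w k * X i k) + b)) / real n = sigmoid b" using w0 n by simp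
  ultimately show ?thesis using gap0_bounds by simp
next
  case False
  define s where "s = enorm p w"
  have s: "0 < s" using False enorm_nonneg[of p w] by (simp add: s_def)
  define v where "v = (\<lambda>k. (- 1 / s) * w k)"
  define f1 where "f1 = (\<lambda>x. sigmoid ((\<Sum>k<p. v k * x k) + (- (\<Sum>k<p. v k * \<theta> k) - 1)))"
  have v1: "enorm p v = 1" unfolding v_def enorm_cmult using s by (simp add: s_def)
  have f1D: "f1 \<in> Dnet p 1 2" unfolding f1_def by (rule sigmoid_in_Dnet) (simp_all add: v1)
  have Qf1: "(\<integral>x. f1 x \<partial>gauss p \<theta>) = gsig 1 (- 1)"
    unfolding f1_def gauss_integral_sigmoid v1 by simp
  have "gsig 1 (- 1) - gap0 / 2 \<le> (\<Sum>i<n. f1 (X i)) / real n"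
    using dev[OF f1D] unfolding Qf1 abs_le_iff by argo
  then have lower: "gap0 / 2 + sigmoid (- 1) \<le> (\<Sum>i<n. f1 (X i)) / real n"
    unfolding gap0_def by argo
  \<comment> \<open>A linear substitute for counting points: where the given sigmoid may be large,
    \<open>f1\<close> is at most \<open>sigmoid (- 1)\<close> and the right side is at least 1;
    elsewhere the left side is at most 1/2 and the right side exceeds 1/2.\<close>
  have pt: "sigmoid ((\<Sum>k<p. w k * x k) + b) \<le> 1 - (f1 x - sigmoid (- 1)) / 2" for x
  proof -
    let ?u = "\<Sum>k<p. w k * (x k - \<theta> k)"
    have wx: "(\<Sum>k<p. w k * x k) + b = ?u + ((\<Sum>k<p. w k * \<theta> k) + b)"
      by (simp add: sum_subtractf right_diff_distrib)
    have f1x: "f1 x = sigmoid (- (?u / s) - 1)"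
    proof -
      have "(\<Sum>k<p. v k * x k) - (\<Sum>k<p. v k * \<theta> k) = (\<Sum>k<p. (- 1 / s) * (w k * (x k - \<theta> k)))"
        unfolding sum_subtractf[symmetric] v_def by (intro sum.cong) (auto simp: algebra_simps diff_divide_distrib)
      also have "\<dots> = - (?u / s)" unfolding sum_distrib_left[symmetric] by simp
      finally have "(\<Sum>k<p. v k * x k) + (- (\<Sum>k<p. v k * \<theta> k) - 1) = - (?u / s) - 1" by simp
      then show ?thesis unfolding f1_def by (simp only:)
    qed
    show ?thesis
    proof (cases "?u \<le> 0")
      case True
      then have "sigmoid ((\<Sum>k<p. w k * x k) + b) \<le> 1 / 2"
        using b sigmoid_mono[of "(\<Sum>k<p. w k * x k) + b" 0] unfolding wx by (simp add: sigmoid_zero)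
      moreover have "f1 x < 1" unfolding f1_def by (rule sigmoid_less_one)
      ultimately show ?thesis using sigmoid_pos[of "- 1"] by argo
    next
      case False
      then have "f1 x \<le> sigmoid (- 1)" unfolding f1x using s by (intro sigmoid_mono) simp
      then show ?thesis using sigmoid_less_one[of "(\<Sum>k<p. w k * x k) + b"] by argo
    qed
  qed
  have "(\<Sum>i<n. sigmoid ((\<Sum>k<p. w k * X i k) + b)) / real n \<le> (\<Sum>i<n. 1 - (f1 (X i) - sigmoid (- 1)) / 2) / real n"
    by (intro divide_right_mono sum_mono pt) simp
  also have "(\<Sum>i<n. 1 - (f1 (X i) - sigmoid (- 1)) / 2) = real n * (1 + sigmoid (- 1) / 2) - (\<Sum>i<n. f1 (X i)) / 2"
  proof -
    have "(\<Sum>i<n. 1 - (f1 (X i) - sigmoid (- 1)) / 2) = (\<Sum>i<n. (1 + sigmoid (- 1) / 2) - f1 (X i) / 2)"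
      by (intro sum.cong refl) argo
    then show ?thesis by (simp add: sum_subtractf sum_divide_distrib)
  qed
  also have "\<dots> / real n = 1 + sigmoid (- 1) / 2 - ((\<Sum>i<n. f1 (X i)) / real n) / 2"
    using n by (simp add: diff_divide_distrib)
  finally show ?thesis using lower by argo
qed

text \<open>An advantage near 1 requires a large empirical mean and a small Gaussian mean. If the
  neuron is at most 1/2 at the centre, the empirical mean is held down; otherwise the Gaussian mean
  is at least 1/2. The opposite sign follows because the complement of a neuron is again a neuron of
  the same norm.\<close>

lemma empirical_gap:
  assumes n: "1 \<le> n" and f: "f \<in> node p B (Suc 0)"
    and dev: "\<And>f. f \<in> Dnet p 1 2 \<Longrightarrow> \<bar>(\<Sum>i<n. f (X i)) / real n - (\<integral>x. f x \<partial>gauss p \<theta>)\<bar> \<le> gap0 / 2"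
  shows "\<bar>(\<Sum>i<n. f (X i)) / real n - (\<integral>x. f x \<partial>gauss p \<theta>)\<bar> \<le> 1 - gap0 / 4"
proof -
  let ?s = "\<lambda>w b x. sigmoid ((\<Sum>k<p. w k * x k) + b)"
  let ?E = "\<lambda>f :: (nat \<Rightarrow> real) \<Rightarrow> real. (\<Sum>i<n. f (X i)) / real n"
  let ?Q = "\<lambda>f :: (nat \<Rightarrow> real) \<Rightarrow> real. \<integral>x. f x \<partial>gauss p \<theta>"
  have up: "?E (?s w b) - ?Q (?s w b) \<le> 1 - gap0 / 4" for w b
  proof (cases "(\<Sum>i<p. w i * \<theta> i) + b \<le> 0")
    case True
    have "0 \<le> ?Q (?s w b)" unfolding gauss_integral_sigmoid by (rule gsig_nonneg)
    moreover have "?E (?s w b) \<le> 1 - gap0 / 4" by (rule empirical_sigmoid_le[OF n True]) (rule dev)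
    ultimately show ?thesis by argo
  next
    case False
    then have "1 / 2 \<le> ?Q (?s w b)"
      unfolding gauss_integral_sigmoid gsig_zero[of "enorm p w", symmetric] by (intro gsig_mono) simp
    moreover have "?E (?s w b) \<le> 1"
      by (rule mean_functional_node_range(2)[OF mean_functional_empirical[OF n] sigmoid_in_node[OF order_refl]])
    ultimately show ?thesis using gap0_bounds by argo
  qed
  obtain w b where fe: "f = ?s w b" using f by auto
  have compl: "?s (\<lambda>k. - w k) (- b) x = 1 - ?s w b x" for x
    unfolding sigmoid_minus[symmetric] by (simp add: sum_negf add.commute)
  have E': "?E (?s (\<lambda>k. - w k) (- b)) = 1 - ?E f"
    unfolding compl fe using n by (simp add: sum_subtractf diff_divide_distrib)
  have Q': "?Q (?s (\<lambda>k. - w k) (- b)) = 1 - ?Q f"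
  proof -
    interpret prob_space "gauss p \<theta>" by (rule prob_space_gauss)
    have "integrable (gauss p \<theta>) f"
      by (rule bmf_integrable) (use bmf_node[OF f] in \<open>simp add: bmf_def measurable_gauss_iff space_gauss\<close>)
    then show ?thesis unfolding compl fe by (simp add: prob_space)
  qed
  have "?E f - ?Q f \<le> 1 - gap0 / 4" unfolding fe by (rule up)
  moreover have "(1 - ?E f) - (1 - ?Q f) \<le> 1 - gap0 / 4" unfolding E'[symmetric] Q'[symmetric] by (rule up)
  ultimately show ?thesis by (intro abs_leI) simp_all
qed

section \<open>The W-GAN estimator\<close>

lemma wgan_obj_upper:
  assumes "\<And>f. f \<in> Dnet p B L \<Longrightarrow> (\<Sum>i<n. f (X i)) / real n - (\<integral>x. f x \<partial>gauss p \<theta>) \<le> U"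
  shows "wgan_obj p B L n X \<theta> \<le> U"
  unfolding wgan_obj_def
proof (rule cSUP_least)
  show "Dnet p B L \<noteq> {}" unfolding Dnet_eq_absconv using zero_in_absconv by blast
qed (rule assms)

lemma wgan_obj_lower:
  assumes n: "1 \<le> n" and f: "f \<in> Dnet p B L"
  shows "(\<Sum>i<n. f (X i)) / real n - (\<integral>x. f x \<partial>gauss p \<theta>) \<le> wgan_obj p B L n X \<theta>"
  unfolding wgan_obj_def
\<comment> \<open>A real supremum bounds its members only when the set is bounded above; here 2 is
  an upper bound, since both means have size at most 1.\<close>
proof (rule cSUP_upper[OF f], rule bdd_aboveI2)
  fix g assume g: "g \<in> Dnet p B L"
  interpret prob_space "gauss p \<theta>" by (rule prob_space_gauss)
  have "(\<Sum>i<n. g (X i)) \<le> (\<Sum>i<n. 1)"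
    using Dnet_abs_le[OF g] by (intro sum_mono) (auto simp: abs_le_iff)
  then have "(\<Sum>i<n. g (X i)) / real n \<le> 1" using n by simp
  moreover have "\<bar>\<integral>x. g x \<partial>gauss p \<theta>\<bar> \<le> 1"
    by (rule abs_integral_le[OF bmf_integrable[OF bmf_Dnet[OF g sets_gauss]] Dnet_abs_le[OF g]])
  ultimately show "(\<Sum>i<n. g (X i)) / real n - (\<integral>x. g x \<partial>gauss p \<theta>) \<le> 2" unfolding abs_le_iff by argo
qed

text \<open>The discriminator \<open>-f\<close> detects the shift at \<open>\<theta>h\<close>, and
  minimality bounds what it gains there by the objective at \<open>\<theta>\<close>, hence by
  \<open>U\<close>. Adding the error \<open>V\<close> of \<open>f\<close> at \<open>\<theta>\<close>
  eliminates the empirical mean. The bounds stay separate because boundedness of the error uses a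
  weak \<open>U\<close> over the deep class together with a sharp \<open>V\<close> on
  neurons.\<close>

lemma wgan_estimate_witness:
  fixes p :: nat and \<theta> \<theta>h :: "nat \<Rightarrow> real"
  defines "\<delta> \<equiv> enorm p (\<lambda>i. \<theta>h i - \<theta> i)"
  assumes n: "1 \<le> n" and L: "2 \<le> L" and est: "is_wgan_estimate p B L n X \<theta>h"
    and \<beta>: "0 < \<beta>" "\<beta> \<le> B" "\<beta> \<le> 1" and \<delta>: "0 < \<delta>"
    and U: "\<And>f. f \<in> Dnet p B L \<Longrightarrow> (\<Sum>i<n. f (X i)) / real n - (\<integral>x. f x \<partial>gauss p \<theta>) \<le> U"
    and V: "\<And>w b. enorm p w = \<beta> \<Longrightarrow> (\<Sum>i<n. sigmoid ((\<Sum>k<p. w k * X i k) + b)) / real n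
      - (\<integral>x. sigmoid ((\<Sum>k<p. w k * x k) + b) \<partial>gauss p \<theta>) \<le> V"
  shows "2 * gsig \<beta> (\<beta> * \<delta> / 2) - 1 \<le> U + V"
proof -
  define w where "w = (\<lambda>k. (\<beta> / \<delta>) * (\<theta>h k - \<theta> k))"
  \<comment> \<open>The threshold is at the midpoint of the two centres, where the argument takes
    the values \<open>\<beta> * \<delta> / 2\<close> and \<open>- (\<beta> * \<delta> / 2)\<close>;
    by reflection the two Gaussian means add up to 1.\<close>
  define b where "b = - (\<Sum>k<p. w k * \<theta> k) - \<beta> * \<delta> / 2"
  define f where "f = (\<lambda>x. sigmoid ((\<Sum>k<p. w k * x k) + b))"
  have w: "enorm p w = \<beta>" unfolding w_def enorm_cmult \<delta>_def[symmetric] using \<beta> \<delta> by simp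
  have "(\<Sum>k<p. w k * \<theta>h k) - (\<Sum>k<p. w k * \<theta> k) = (\<beta> / \<delta>) * (\<Sum>k<p. (\<theta>h k - \<theta> k)\<^sup>2)"
    unfolding sum_subtractf[symmetric] sum_distrib_left w_def
    by (intro sum.cong refl) (simp add: power2_eq_square algebra_simps diff_divide_distrib)
  also have "(\<Sum>k<p. (\<theta>h k - \<theta> k)\<^sup>2) = \<delta>\<^sup>2" unfolding \<delta>_def enorm_power2 ..
  also have "(\<beta> / \<delta>) * \<delta>\<^sup>2 = \<beta> * \<delta>" using \<delta> by (simp add: power2_eq_square)
  finally have bh: "(\<Sum>k<p. w k * \<theta>h k) + b = \<beta> * \<delta> / 2" unfolding b_def by argo
  have bs: "(\<Sum>k<p. w k * \<theta> k) + b = - (\<beta> * \<delta> / 2)" unfolding b_def by argo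
  have Qh: "(\<integral>x. f x \<partial>gauss p \<theta>h) = gsig \<beta> (\<beta> * \<delta> / 2)"
    unfolding f_def gauss_integral_sigmoid w bh ..
  have Qs: "(\<integral>x. f x \<partial>gauss p \<theta>) = 1 - gsig \<beta> (\<beta> * \<delta> / 2)"
    unfolding f_def gauss_integral_sigmoid w bs gsig_minus ..
  have fD: "f \<in> Dnet p B L" unfolding f_def using w \<beta> L by (intro sigmoid_in_Dnet) auto
  have "(\<Sum>i<n. - f (X i)) / real n - (\<integral>x. - f x \<partial>gauss p \<theta>h) \<le> wgan_obj p B L n X \<theta>h"
    by (rule wgan_obj_lower[OF n Dnet_uminus[OF fD]])
  also have "\<dots> \<le> wgan_obj p B L n X \<theta>" using est by (simp add: is_wgan_estimate_def)
  also have "\<dots> \<le> U" by (rule wgan_obj_upper[OF U])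
  finally have "gsig \<beta> (\<beta> * \<delta> / 2) - (\<Sum>i<n. f (X i)) / real n \<le> U" by (simp add: sum_negf Qh)
  moreover have "(\<Sum>i<n. f (X i)) / real n - (1 - gsig \<beta> (\<beta> * \<delta> / 2)) \<le> V"
    using V[OF w, of b] unfolding Qs[symmetric] f_def .
  ultimately show ?thesis by argo
qed

text \<open>The probability is that of an explicit measurable event on which every minimiser obeys
  the bound, so no measurable selection of an estimator is involved.\<close>

theorem theorem4:
  "\<exists>c>0. \<forall>B>0. \<exists>C'>0. \<forall>(p::nat) (n::nat) (L::nat) (\<epsilon>::real) \<theta>s P.
     p \<ge> 1 \<longrightarrow> n \<ge> 1 \<longrightarrow> L \<ge> 2 \<longrightarrow> \<epsilon> \<ge> 0 \<longrightarrow>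
     prob_space P \<longrightarrow> sets P = sets (Rp p) \<longrightarrow>
     wasserstein1 p P (gauss p \<theta>s) \<le> ennreal \<epsilon> \<longrightarrow>
     2 ^ L * (real p / real n) + \<epsilon>\<^sup>2 \<le> c \<longrightarrow>
     (\<exists>E \<in> sets (\<Pi>\<^sub>M i\<in>{..<n}. P).
        measure (\<Pi>\<^sub>M i\<in>{..<n}. P) E \<ge> 1 - exp (- (real p + real n * \<epsilon>\<^sup>2)) \<and>
        (\<forall>X\<in>E. \<forall>\<theta>h. is_wgan_estimate p B L n X \<theta>h \<longrightarrow>
           enorm p (\<lambda>i. \<theta>h i - \<theta>s i) \<le> C' * max (2 ^ L * sqrt (real p / real n)) \<epsilon>))"
proof -
  \<comment> \<open>For \<open>B = 1\<close> and \<open>L = 2\<close> the deviation is at most 20 *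
    2 * (4 + 1) * c0 = 200 * c0, which this choice makes equal to \<open>gap0 / 16\<close>.\<close>
  define c0 where "c0 = gap0 / 3200"
  have c0: "0 < c0" using gap0_bounds by (simp add: c0_def)
  show ?thesis
  proof (rule exI[of _ "c0\<^sup>2"], intro conjI allI impI)
    show "0 < c0\<^sup>2" using c0 by simp
    fix B :: real assume B: "0 < B"
    \<comment> \<open>A neuron of norm \<open>\<beta>\<close> belongs both to the given class and to
      the class with \<open>B = 1\<close>, \<open>L = 2\<close>, so either deviation event applies
      to it.\<close>
    define \<beta> where "\<beta> = min B 1"
    have \<beta>: "0 < \<beta>" "\<beta> \<le> B" "\<beta> \<le> 1" using B by (auto simp: \<beta>_def)
    \<comment> \<open>The level is half of the lower bound \<open>gap0 / 32\<close> that the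
      boundedness argument yields for \<open>gsig \<beta> (- m)\<close>, so \<open>m \<ge> M\<close>
      is contradictory.\<close>
    obtain M where M: "0 < M" "gsig \<beta> (- M) \<le> gap0 / 64"
      using gsig_vanishes[of "gap0 / 64" \<beta>] gap0_bounds by auto
    obtain d where d: "0 < d" "\<And>m. 0 \<le> m \<Longrightarrow> d * min m 1 \<le> gsig \<beta> m - 1 / 2"
      using gsig_increment[of \<beta>] by blast
    define C where "C = 2 * max M 1 / (d * \<beta>) * (40 * (1 + B))"
    have C: "0 < C" using d \<beta> B by (simp add: C_def)
    show "\<exists>C'>0. \<forall>(p::nat) (n::nat) (L::nat) (\<epsilon>::real) \<theta>s P.
     p \<ge> 1 \<longrightarrow> n \<ge> 1 \<longrightarrow> L \<ge> 2 \<longrightarrow> \<epsilon> \<ge> 0 \<longrightarrow>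
     prob_space P \<longrightarrow> sets P = sets (Rp p) \<longrightarrow>
     wasserstein1 p P (gauss p \<theta>s) \<le> ennreal \<epsilon> \<longrightarrow>
     2 ^ L * (real p / real n) + \<epsilon>\<^sup>2 \<le> c0\<^sup>2 \<longrightarrow>
     (\<exists>E \<in> sets (\<Pi>\<^sub>M i\<in>{..<n}. P).
        measure (\<Pi>\<^sub>M i\<in>{..<n}. P) E \<ge> 1 - exp (- (real p + real n * \<epsilon>\<^sup>2)) \<and>
        (\<forall>X\<in>E. \<forall>\<theta>h. is_wgan_estimate p B L n X \<theta>h \<longrightarrow>
           enorm p (\<lambda>i. \<theta>h i - \<theta>s i) \<le> C' * max (2 ^ L * sqrt (real p / real n)) \<epsilon>))"
    proof (rule exI[of _ C], intro conjI allI impI C)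
      fix p n L :: nat and \<epsilon> :: real and \<theta>s :: "nat \<Rightarrow> real" and P :: "(nat \<Rightarrow> real) measure"
      assume p: "1 \<le> p" and n: "1 \<le> n" and L: "2 \<le> L" and \<epsilon>: "0 \<le> \<epsilon>"
        and P: "prob_space P" and sP: "sets P = sets (Rp p)"
        and W: "wasserstein1 p P (gauss p \<theta>s) \<le> ennreal \<epsilon>"
        and small: "2 ^ L * (real p / real n) + \<epsilon>\<^sup>2 \<le> c0\<^sup>2"
      interpret I: prob_space "iid P n" by (rule prob_space_iid[OF P])
      let ?T = "real p + real n * \<epsilon>\<^sup>2"
      let ?emp = "\<lambda>X (f :: (nat \<Rightarrow> real) \<Rightarrow> real). (\<Sum>i<n. f (X i)) / real n"
      let ?Q = "\<lambda>f :: (nat \<Rightarrow> real) \<Rightarrow> real. \<integral>x. f x \<partial>gauss p \<theta>s"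
      obtain E1 where E1: "E1 \<in> sets (iid P n)" "I.prob (space (iid P n) - E1) \<le> exp (- (2 * ?T))"
        and dev1: "\<And>X f. X \<in> E1 \<Longrightarrow> f \<in> Dnet p B L \<Longrightarrow>
          \<bar>?emp X f - ?Q f\<bar> \<le> 20 * (1 + B) * (2 ^ L * sqrt (real p / real n) + \<epsilon>)"
        using uniform_deviation[OF B p n L \<epsilon> P sP W] by blast
      obtain E2 where E2: "E2 \<in> sets (iid P n)" "I.prob (space (iid P n) - E2) \<le> exp (- (2 * ?T))"
        and dev2: "\<And>X f. X \<in> E2 \<Longrightarrow> f \<in> Dnet p 1 2 \<Longrightarrow>
          \<bar>?emp X f - ?Q f\<bar> \<le> 20 * (1 + 1) * (2 ^ 2 * sqrt (real p / real n) + \<epsilon>)"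
        using uniform_deviation[OF zero_less_one p n order_refl \<epsilon> P sP W] by blast
      have d2: "20 * (1 + 1) * (2 ^ 2 * sqrt (real p / real n) + \<epsilon>) \<le> gap0 / 16"
      proof -
        have "real p / real n \<le> 2 ^ L * (real p / real n)"
          using mult_right_mono[of 1 "2 ^ L" "real p / real n"] by simp
        then have "real p / real n \<le> c0\<^sup>2" using small zero_le_power2[of \<epsilon>] by linarith
        then have a: "sqrt (real p / real n) \<le> c0" 
          by (rule real_le_lsqrt[OF less_imp_le[OF c0]])
        have "0 \<le> 2 ^ L * (real p / real n)" by simp
        then have "\<epsilon>\<^sup>2 \<le> c0\<^sup>2" using small by linarith
        then have b: "\<epsilon> \<le> c0" 
          by (rule power2_le_imp_le[OF _ less_imp_le[OF c0]])
        have "20 * (1 + 1) * (2 ^ 2 * sqrt (real p / real n) + \<epsilon>) \<le> 20 * (1 + 1) * (2 ^ 2 * c0 + c0)"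
          using a b by (intro mult_left_mono add_mono) auto
        also have "\<dots> = gap0 / 16" by (simp add: c0_def)
        finally show ?thesis .
      qed
      show "\<exists>E \<in> sets (\<Pi>\<^sub>M i\<in>{..<n}. P).
        measure (\<Pi>\<^sub>M i\<in>{..<n}. P) E \<ge> 1 - exp (- ?T) \<and>
        (\<forall>X\<in>E. \<forall>\<theta>h. is_wgan_estimate p B L n X \<theta>h \<longrightarrow>
           enorm p (\<lambda>i. \<theta>h i - \<theta>s i) \<le> C * max (2 ^ L * sqrt (real p / real n)) \<epsilon>)"
      proof (intro bexI[of _ "E1 \<inter> E2"] conjI ballI allI impI)
        show "E1 \<inter> E2 \<in> sets (iid P n)" using E1 E2 by blast
        have "I.prob (space (iid P n) - (E1 \<inter> E2)) \<le> I.prob (space (iid P n) - E1) + I.prob (space (iid P n) - E2)"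
          unfolding Diff_Int using E1 E2 by (intro measure_Un_le) auto
        also have "\<dots> \<le> 2 * exp (- (2 * ?T))" using E1 E2 by simp
        \<comment> \<open>The doubled exponent of each event pays for their union:
          \<open>p \<ge> 1\<close> gives T >= 1, hence 2 <= exp T.\<close>
        also have "\<dots> \<le> exp (- ?T)"
        proof -
          have "1 \<le> ?T" using p by (simp add: add_increasing2)
          then have "2 \<le> exp ?T" using exp_ge_add_one_self[of ?T] by linarith
          then have "2 * exp (- (2 * ?T)) \<le> exp ?T * exp (- (2 * ?T))" by (intro mult_right_mono) auto
          also have "\<dots> = exp (- ?T)" unfolding exp_add[symmetric] by (rule arg_cong[of _ _ exp]) argo
          finally show ?thesis .
        qed
        finally show "1 - exp (- ?T) \<le> I.prob (E1 \<inter> E2)"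
          using I.prob_compl[of "E1 \<inter> E2"] E1 E2 by auto
      next
        fix X \<theta>h assume X: "X \<in> E1 \<inter> E2" and est: "is_wgan_estimate p B L n X \<theta>h"
        define \<delta> where "\<delta> = enorm p (\<lambda>i. \<theta>h i - \<theta>s i)"
        define \<Delta> where "\<Delta> = 20 * (1 + B) * (2 ^ L * sqrt (real p / real n) + \<epsilon>)"
        define R where "R = max (2 ^ L * sqrt (real p / real n)) \<epsilon>"
        have R0: "0 \<le> R" using \<epsilon> by (simp add: R_def max_def)
        have \<Delta>R: "\<Delta> \<le> 40 * (1 + B) * R"
        proof -
          have "2 ^ L * sqrt (real p / real n) + \<epsilon> \<le> R + R" by (intro add_mono) (simp_all add: R_def)
          then have "\<Delta> \<le> 20 * (1 + B) * (R + R)" unfolding \<Delta>_def using B by (intro mult_left_mono) auto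
          also have "\<dots> = 40 * (1 + B) * R" by (simp add: algebra_simps)
          finally show ?thesis .
        qed
        have D1: "\<bar>?emp X f - ?Q f\<bar> \<le> \<Delta>" if "f \<in> Dnet p B L" for f
          using dev1[OF _ that] X by (simp add: \<Delta>_def)
        have D2: "\<bar>?emp X f - ?Q f\<bar> \<le> gap0 / 16" if "f \<in> Dnet p 1 2" for f
          using dev2[OF _ that, of X] X d2 by simp
        have "\<delta> \<le> C * R"
        proof (cases "\<delta> = 0")
          case True
          then show ?thesis using C R0 by simp
        next
          case False
          then have \<delta>: "0 < \<delta>" using enorm_nonneg[of p "\<lambda>i. \<theta>h i - \<theta>s i"] by (simp add: \<delta>_def)
          define m where "m = \<beta> * \<delta> / 2"
          have m0: "0 \<le> m" using \<beta> \<delta> by (simp add: m_def)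
          note witness = wgan_estimate_witness[OF n L est \<beta> \<delta>[unfolded \<delta>_def], folded \<delta>_def m_def]
          \<comment> \<open>First use of the witness, with the true rate in both places. It bounds
            \<open>m\<close> only while the rate is below saturation.\<close>
          have "2 * gsig \<beta> m - 1 \<le> \<Delta> + \<Delta>"
          proof (rule witness)
            show "?emp X f - ?Q f \<le> \<Delta>" if "f \<in> Dnet p B L" for f using D1[OF that] by (simp add: abs_le_iff)
            show "?emp X (\<lambda>x. sigmoid ((\<Sum>k<p. w k * x k) + b)) - ?Q (\<lambda>x. sigmoid ((\<Sum>k<p. w k * x k) + b)) \<le> \<Delta>"
              if "enorm p w = \<beta>" for w b
              using D1[OF sigmoid_in_Dnet[OF _ L]] that \<beta> by (simp add: abs_le_iff)
          qed
          then have 1: "gsig \<beta> m - 1 / 2 \<le> \<Delta>" by argo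
          \<comment> \<open>Second use: the advantage over the deep class is merely bounded away
            from 1, but the lone neuron has the small universal error. The total stays below 1 by
            \<open>gap0 / 16\<close>, which excludes distant centres.\<close>
          have "2 * gsig \<beta> m - 1 \<le> (1 - (gap0 / 4) / 2) + gap0 / 16"
          proof (rule witness)
            show "?emp X f - ?Q f \<le> 1 - (gap0 / 4) / 2" if f: "f \<in> Dnet p B L" for f
            proof (rule Dnet_advantage[OF mean_functional_empirical[OF n] mean_functional_gauss _ _ L _ f])
              show "\<bar>?emp X g - ?Q g\<bar> \<le> 1 - gap0 / 4" if "g \<in> node p B (Suc 0)" for g
              proof (rule empirical_gap[OF n that])
                show "\<bar>?emp X h - ?Q h\<bar> \<le> gap0 / 2" if "h \<in> Dnet p 1 2" for h
                  using D2[OF that] gap0_bounds by linarith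
              qed
            qed (use gap0_bounds in auto)
            show "?emp X (\<lambda>x. sigmoid ((\<Sum>k<p. w k * x k) + b)) - ?Q (\<lambda>x. sigmoid ((\<Sum>k<p. w k * x k) + b)) \<le> gap0 / 16"
              if "enorm p w = \<beta>" for w b
              by (rule order_trans[OF abs_ge_self D2[OF sigmoid_in_Dnet[OF _ order_refl]]]) (use that \<beta> in simp)
          qed
          then have "gap0 / 32 \<le> gsig \<beta> (- m)" unfolding gsig_minus by argo
          moreover have "gsig \<beta> (- m) \<le> gap0 / 64" if "M \<le> m"
            using gsig_mono[of "- m" "- M" \<beta>] M that by simp
          ultimately have mM: "m < M" using gap0_bounds by fastforce
          \<comment> \<open>With \<open>m < M\<close>, removing the truncation of the increment
            bound costs only the factor \<open>max M 1\<close>, which goes into the final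
            constant.\<close>
          have "m \<le> max M 1 * min m 1"
          proof (cases "m \<le> 1")
            case True
            then show ?thesis using mult_right_mono[of 1 "max M 1" m] m0 by (simp add: min_def)
          next
            case False
            then show ?thesis using mM by (simp add: min_def)
          qed
          also have "\<dots> \<le> max M 1 * (\<Delta> / d)"
            using d(2)[OF m0] 1 d(1) by (intro mult_left_mono) (auto simp: field_simps)
          finally have "\<beta> * \<delta> / 2 \<le> max M 1 * (\<Delta> / d)" by (simp add: m_def)
          then have "\<delta> \<le> 2 * max M 1 / (d * \<beta>) * \<Delta>" using \<beta> d by (simp add: field_simps)
          also have "\<dots> \<le> 2 * max M 1 / (d * \<beta>) * (40 * (1 + B) * R)"
            using \<Delta>R \<beta> d by (intro mult_left_mono) auto
          also have "\<dots> = C * R" by (simp add: C_def)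
          finally show ?thesis .
        qed
        then show "enorm p (\<lambda>i. \<theta>h i - \<theta>s i) \<le> C * max (2 ^ L * sqrt (real p / real n)) \<epsilon>"
          by (simp add: \<delta>_def R_def)
      qed
    qed
  qed
qed

end
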